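(* Let $\mathbf D^k=\mathbf b^*\,T_k(P)\,\mathbf b\in\mathbb R^{m\times m}$, $k=0,\ldots,2n-1$, be the sampled data, where $P$ and $\mathbf b$ are the propagator and transducer function defined in the context. Form the matrices $\mathbf M,\mathbf S\in\mathbb R^{mn\times mn}$ with $m\times m$ blocks, $k,l=0,\ldots,n-1$, $$\mathbf M_{k,l}=\tfrac12\left(\mathbf D^{k+l}+\mathbf D^{|k-l|}\right),\qquad \mathbf S_{k,l}=\tfrac14\left(\mathbf D^{k+l+1}+\mathbf D^{|k-l+1|}+\mathbf D^{|k+l-1|}+\mathbf D^{|k-l-1|}\right),$$ let $\mathbf M=\mathbf L\mathbf L^*$ be a block Cholesky decomposition, with $\mathbf L\in\mathbb R^{mn\times mn}$ block lower triangular with $m\times m$ blocks, and set $$\widetilde{\mathbf P}=\mathbf L^{-1}\mathbf S\mathbf L^{-*},\qquad \widetilde{\mathbf B}=\mathbf L^{-1}\begin{bmatrix}\mathbf D^0\\ \vdots\\ \mathbf D^{n-1}\end{bmatrix}.$$ Then $\widetilde{\mathbf P}\in\mathbb R^{mn\times mn}$ and $\widetilde{\mathbf B}\in\mathbb R^{mn\times m}$ solve the interpolation problem $$\mathbf D^k=\widetilde{\mathbf B}^*\,T_k(\widetilde{\mathbf P})\,\widetilde{\mathbf B},\qquad k=0,\ldots,2n-1.$$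
   Context: Domain and operator. $\Omega\subset\mathbb R^d$, $d=2,3$, is a finite (bounded) domain with boundary split into an accessible part $\mathcal B_A$ and an inaccessible part $\mathcal B_I=\partial\Omega\setminus\mathcal B_A$. The acoustic velocity $c(x)>0$ is piecewise smooth in $\Omega$. Consider $A=c(x)^2\Delta$ with homogeneous Neumann conditions on $\mathcal B_A$ and homogeneous Dirichlet conditions on $\mathcal B_I$. The symmetrized operator $\widehat A=c(x)\Delta c(x)$ (that is, $\widehat A w=c\,\Delta(c\,w)$, related by $A=c\widehat A c^{-1}$, with $cw$ subject to the boundary conditions of $A$) is self-adjoint with respect to the standard inner product $\langle f,g\rangle=\int_\Omega \overline{f(x)}g(x)\,dx$, and $-\widehat A$ is nonnegative. Functions of $\widehat A$ are understood in the sense of the functional calculus. Transducer function. $\tau>0$ is the sampling interval and $m,n\ge 1$ are integers. The source wavelet $q$ is even and sufficiently smooth, with nonnegative Fourier transform $\widetilde q(s^2)=\int_0^\infty 2\cos(ts)q(t)\,dt$; $e_1,\ldots,e_m$ are source/receiver surface distributions supported on disjoint subsets of $\mathcal B_A$ (acting by $\int_\Omega f e_j\,dx=\int_{\mathrm{supp}\,e_j} f\,d\Sigma$), and $\theta$ is a known real function. The transducer function is the real row-vector-valued function $\mathbf b=[b_1,\ldots,b_m]:\Omega\to\mathbb R^{1\times m}$ with $b_j=\widetilde q^{1/2}(-\widehat A)\,\theta e_j$, whose components are square integrable. Notation. Operators act on row-vector-valued functions component-wise. For row-vector-valued functions $\mathbf y=[y_1,\ldots,y_p]$, $\mathbf z=[z_1,\ldots,z_r]$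 on $\Omega$, $\mathbf y^*\mathbf z$ denotes the $p\times r$ matrix with entries $\langle y_i,z_j\rangle$. For matrices, $^*$ is the (conjugate) transpose and $\mathbf L^{-*}=(\mathbf L^{-1})^*$. $T_k$ is the Chebyshev polynomial of the first kind of degree $k$. The propagator is $P=\cos(\tau\sqrt{-\widehat A})$. Standing assumption. The $mn$ component functions of the snapshots $\widehat{\mathbf u}^k=T_k(P)\mathbf b$, $k=0,\ldots,n-1$, are linearly independent, i.e. the block Krylov subspace $\mathcal K_n(P,\mathbf b)=\mathrm{span}\{\widehat{\mathbf u}^0,\ldots,\widehat{\mathbf u}^{n-1}\}$ has dimension $mn$. Block Cholesky decomposition. The diagonal blocks of $\mathbf L$ are any $m\times m$ matrices satisfying $\mathbf L_{k,k}\mathbf L_{k,k}^*=\mathbf M_{k,k}-\sum_{r=0}^{k-1}\mathbf L_{k,r}\mathbf L_{k,r}^*$ (for example the positive definite square root of the right-hand side), and for $l>k$, $\mathbf L_{l,k}=\bigl(\mathbf M_{l,k}-\sum_{r=0}^{k-1}\mathbf L_{l,r}\mathbf L_{k,r}^*\bigr)\mathbf L_{k,k}^{-*}$, so that $\mathbf L\mathbf L^*=\mathbf M$. *)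

theory Defs
  imports
    "HOL-Analysis.Analysis"
    "HOL-Computational_Algebra.Polynomial"
    "Jordan_Normal_Form.Matrix"
    "Jordan_Normal_Form.Gauss_Jordan_Elimination"
    "Jordan_Normal_Form.Schur_Decomposition"
begin

text \<open>Elements of the complex Hilbert space of square integrable functions on \<open>\<Omega>\<close> are represented
  by functions; equality in the Hilbert space is equality almost everywhere on \<open>\<Omega>\<close>.\<close>

definition L2 :: "(real^'d) set \<Rightarrow> ((real^'d) \<Rightarrow> complex) set" where
  "L2 \<Omega> = {f. f \<in> borel_measurable (lebesgue_on \<Omega>)
             \<and> integrable (lebesgue_on \<Omega>) (\<lambda>x. (cmod (f x))\<^sup>2)}"

definition inner_L2 :: "(real^'d) set \<Rightarrow> ((real^'d) \<Rightarrow> complex) \<Rightarrow> ((real^'d) \<Rightarrow> complex) \<Rightarrow> complex" where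
  "inner_L2 \<Omega> f g = (LINT x|lebesgue_on \<Omega>. cnj (f x) * g x)"

definition eq_L2 :: "(real^'d) set \<Rightarrow> ((real^'d) \<Rightarrow> complex) \<Rightarrow> ((real^'d) \<Rightarrow> complex) \<Rightarrow> bool" where
  "eq_L2 \<Omega> f g \<longleftrightarrow> (AE x in lebesgue_on \<Omega>. f x = g x)"

definition tendsto_L2 :: "(real^'d) set \<Rightarrow> (nat \<Rightarrow> (real^'d) \<Rightarrow> complex) \<Rightarrow> ((real^'d) \<Rightarrow> complex) \<Rightarrow> bool" where
  "tendsto_L2 \<Omega> f g \<longleftrightarrow> (\<lambda>k. LINT x|lebesgue_on \<Omega>. (cmod (f k x - g x))\<^sup>2) \<longlonglongrightarrow> 0"

text \<open>Infinite differentiability on an open set, coinductively: \<open>f\<close> belongs to a family of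
  differentiable functions that is closed under taking directional derivatives.\<close>

definition smooth_on :: "'a::real_normed_vector set \<Rightarrow> ('a \<Rightarrow> 'b::real_normed_vector) \<Rightarrow> bool" where
  "smooth_on S f \<longleftrightarrow> (\<exists>F. f \<in> F \<and>
     (\<forall>g\<in>F. (\<forall>x\<in>S. g differentiable (at x)) \<and> (\<forall>v. (\<lambda>x. frechet_derivative g (at x) v) \<in> F)))"

definition piecewise_smooth_on :: "(real^'d) set \<Rightarrow> ((real^'d) \<Rightarrow> real) \<Rightarrow> bool" where
  "piecewise_smooth_on \<Omega> c \<longleftrightarrow> (\<exists>\<U>. finite \<U> \<and> disjoint \<U> \<and> (\<forall>U\<in>\<U>. open U \<and> U \<subseteq> \<Omega>)
     \<and> negligible (\<Omega> - \<Union>\<U>)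
     \<and> (\<forall>U\<in>\<U>. \<exists>c'. smooth_on UNIV c' \<and> (\<forall>x\<in>U. c x = c' x)))"

definition partial :: "'d \<Rightarrow> ((real^'d) \<Rightarrow> complex) \<Rightarrow> (real^'d) \<Rightarrow> complex" where
  "partial i f x = frechet_derivative f (at x) (axis i 1)"

text \<open>\<open>H1_vanishing \<Omega> BI u G\<close>: \<open>u\<close> lies in the Sobolev space of square integrable functions with
  square integrable weak gradient that vanish on the boundary part \<open>BI\<close>, and \<open>G\<close> is the weak
  gradient of \<open>u\<close>. The space is the \<open>H\<^sup>1\<close>-closure of the smooth functions in \<open>H\<^sup>1(\<Omega>)\<close> that vanish
  near \<open>BI\<close>; by the theorem of Meyers and Serrin it is all of \<open>H\<^sup>1(\<Omega>)\<close> if \<open>BI\<close> is empty.\<close>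

definition H1_vanishing ::
    "(real^'d) set \<Rightarrow> (real^'d) set \<Rightarrow> ((real^'d) \<Rightarrow> complex) \<Rightarrow> ('d \<Rightarrow> (real^'d) \<Rightarrow> complex) \<Rightarrow> bool" where
  "H1_vanishing \<Omega> BI u G \<longleftrightarrow> u \<in> L2 \<Omega> \<and> (\<forall>i. G i \<in> L2 \<Omega>) \<and>
     (\<exists>\<phi>. (\<forall>k. smooth_on \<Omega> (\<phi> k) \<and> \<phi> k \<in> L2 \<Omega> \<and> (\<forall>i. partial i (\<phi> k) \<in> L2 \<Omega>)
              \<and> (\<exists>U. open U \<and> BI \<subseteq> U \<and> (\<forall>x\<in>U \<inter> \<Omega>. \<phi> k x = 0)))
        \<and> tendsto_L2 \<Omega> \<phi> u \<and> (\<forall>i. tendsto_L2 \<Omega> (\<lambda>k. partial i (\<phi> k)) (G i)))"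

text \<open>\<open>mixed_laplacian \<Omega> BI u h\<close>: \<open>\<Delta> u = h\<close> with \<open>u = 0\<close> on \<open>BI\<close> and vanishing normal derivative
  on the rest of the boundary. The Neumann condition is expressed by Green's formula, in which the
  boundary term is absent for all test functions vanishing on \<open>BI\<close>.\<close>

definition mixed_laplacian ::
    "(real^'d) set \<Rightarrow> (real^'d) set \<Rightarrow> ((real^'d) \<Rightarrow> complex) \<Rightarrow> ((real^'d) \<Rightarrow> complex) \<Rightarrow> bool" where
  "mixed_laplacian \<Omega> BI u h \<longleftrightarrow> h \<in> L2 \<Omega> \<and>
     (\<exists>G. H1_vanishing \<Omega> BI u G \<and>
        (\<forall>v K. H1_vanishing \<Omega> BI v K \<longrightarrow>
           (\<Sum>i\<in>UNIV. inner_L2 \<Omega> (K i) (G i)) = - inner_L2 \<Omega> v h))"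

text \<open>The graph of the unbounded operator \<open>w \<mapsto> c \<Delta>(c w)\<close>, with \<open>c w\<close> subject to the boundary
  conditions: \<open>sym_op \<Omega> BI c w g\<close> means that \<open>w\<close> is in the domain and is mapped to \<open>g\<close>.\<close>

definition sym_op ::
    "(real^'d) set \<Rightarrow> (real^'d) set \<Rightarrow> ((real^'d) \<Rightarrow> real) \<Rightarrow> ((real^'d) \<Rightarrow> complex) \<Rightarrow> ((real^'d) \<Rightarrow> complex) \<Rightarrow> bool" where
  "sym_op \<Omega> BI c w g \<longleftrightarrow> w \<in> L2 \<Omega> \<and> g \<in> L2 \<Omega> \<and>
     (\<exists>h. mixed_laplacian \<Omega> BI (\<lambda>x. complex_of_real (c x) * w x) h
        \<and> eq_L2 \<Omega> g (\<lambda>x. complex_of_real (c x) * h x))"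

definition resolution_of_identity ::
    "(real^'d) set \<Rightarrow> (real set \<Rightarrow> ((real^'d) \<Rightarrow> complex) \<Rightarrow> (real^'d) \<Rightarrow> complex) \<Rightarrow> bool" where
  "resolution_of_identity \<Omega> E \<longleftrightarrow>
     (\<forall>B\<in>sets borel. \<forall>f\<in>L2 \<Omega>. E B f \<in> L2 \<Omega>) \<and>
     (\<forall>B\<in>sets borel. \<forall>f\<in>L2 \<Omega>. \<forall>g\<in>L2 \<Omega>. inner_L2 \<Omega> f (E B g) = inner_L2 \<Omega> (E B f) g) \<and>
     (\<forall>B\<in>sets borel. \<forall>C\<in>sets borel. \<forall>f\<in>L2 \<Omega>. eq_L2 \<Omega> (E B (E C f)) (E (B \<inter> C) f)) \<and>
     (\<forall>f\<in>L2 \<Omega>. eq_L2 \<Omega> (E UNIV f) f) \<and>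
     (\<forall>B. range B \<subseteq> sets borel \<longrightarrow> disjoint_family B \<longrightarrow>
        (\<forall>f\<in>L2 \<Omega>. (\<lambda>i::nat. inner_L2 \<Omega> f (E (B i) f)) sums inner_L2 \<Omega> f (E (\<Union>i. B i) f)))"

definition spectral_measure ::
    "(real^'d) set \<Rightarrow> (real set \<Rightarrow> ((real^'d) \<Rightarrow> complex) \<Rightarrow> (real^'d) \<Rightarrow> complex) \<Rightarrow> ((real^'d) \<Rightarrow> complex) \<Rightarrow> real measure" where
  "spectral_measure \<Omega> E f = measure_of UNIV (sets borel) (\<lambda>B. ennreal (Re (inner_L2 \<Omega> f (E B f))))"

definition spectral_domain ::
    "(real^'d) set \<Rightarrow> (real set \<Rightarrow> ((real^'d) \<Rightarrow> complex) \<Rightarrow> (real^'d) \<Rightarrow> complex) \<Rightarrow> (real \<Rightarrow> real) \<Rightarrow> ((real^'d) \<Rightarrow> complex) set" where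
  "spectral_domain \<Omega> E F = {w \<in> L2 \<Omega>. integrable (spectral_measure \<Omega> E w) (\<lambda>s. (F s)\<^sup>2)}"

text \<open>\<open>\<integral> F d\<langle>v, E w\<rangle>\<close>, the integral with respect to a complex measure, by polarization.\<close>

definition spectral_integral ::
    "(real^'d) set \<Rightarrow> (real set \<Rightarrow> ((real^'d) \<Rightarrow> complex) \<Rightarrow> (real^'d) \<Rightarrow> complex) \<Rightarrow> (real \<Rightarrow> real)
       \<Rightarrow> ((real^'d) \<Rightarrow> complex) \<Rightarrow> ((real^'d) \<Rightarrow> complex) \<Rightarrow> complex" where
  "spectral_integral \<Omega> E F v w = (\<Sum>k<4::nat. (- \<i>) ^ k *
     complex_of_real (LINT s|spectral_measure \<Omega> E (\<lambda>x. v x + \<i> ^ k * w x). F s)) / 4"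

text \<open>The graph of the (possibly unbounded) operator \<open>\<integral> F dE\<close>, determined weakly: the domain is dense.\<close>

definition fun_calc ::
    "(real^'d) set \<Rightarrow> (real set \<Rightarrow> ((real^'d) \<Rightarrow> complex) \<Rightarrow> (real^'d) \<Rightarrow> complex) \<Rightarrow> (real \<Rightarrow> real)
       \<Rightarrow> ((real^'d) \<Rightarrow> complex) \<Rightarrow> ((real^'d) \<Rightarrow> complex) \<Rightarrow> bool" where
  "fun_calc \<Omega> E F w g \<longleftrightarrow> w \<in> spectral_domain \<Omega> E F \<and> g \<in> L2 \<Omega> \<and>
     (\<forall>v\<in>spectral_domain \<Omega> E F. inner_L2 \<Omega> v g = spectral_integral \<Omega> E F v w)"

text \<open>\<open>E\<close> is the spectral resolution of the operator with graph \<open>T\<close>. By the spectral theorem, such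
  an \<open>E\<close> exists (and is unique up to equality almost everywhere) iff \<open>T\<close> is self-adjoint; so
  this expresses both self-adjointness and that functions of the operator are formed with \<open>E\<close>.\<close>

definition spectral_resolution ::
    "(real^'d) set \<Rightarrow> (((real^'d) \<Rightarrow> complex) \<Rightarrow> ((real^'d) \<Rightarrow> complex) \<Rightarrow> bool)
       \<Rightarrow> (real set \<Rightarrow> ((real^'d) \<Rightarrow> complex) \<Rightarrow> (real^'d) \<Rightarrow> complex) \<Rightarrow> bool" where
  "spectral_resolution \<Omega> T E \<longleftrightarrow> resolution_of_identity \<Omega> E \<and>
     (\<forall>w. (\<exists>g. T w g) \<longleftrightarrow> w \<in> spectral_domain \<Omega> E (\<lambda>s. s)) \<and>
     (\<forall>w g. T w g \<longrightarrow> fun_calc \<Omega> E (\<lambda>s. s) w g)"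

text \<open>\<open>(d - 1)\<close>-dimensional Hausdorff measure, normalized to agree with surface area.\<close>

definition hausdorff_pre :: "real \<Rightarrow> real \<Rightarrow> 'a::metric_space set \<Rightarrow> ennreal" where
  "hausdorff_pre s \<delta> A =
     (INF C\<in>{C :: nat \<Rightarrow> 'a set. A \<subseteq> (\<Union>i. C i) \<and> (\<forall>i. bounded (C i) \<and> diameter (C i) \<le> \<delta>)}.
        \<Sum>i. ennreal (unit_ball_vol s * (diameter (C i) / 2) powr s))"

definition surface_measure :: "(real^'d) measure" where
  "surface_measure = measure_of UNIV (sets borel)
     (\<lambda>A. SUP \<delta>\<in>{0<..}. hausdorff_pre (real CARD('d) - 1) \<delta> A)"

text \<open>\<open>t\<close> is the boundary value on \<open>\<Gamma>\<close> of the element \<open>g\<close> of \<open>L\<^sup>2(\<Omega>)\<close>.\<close>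

definition boundary_value ::
    "(real^'d) set \<Rightarrow> (real^'d) set \<Rightarrow> ((real^'d) \<Rightarrow> complex) \<Rightarrow> ((real^'d) \<Rightarrow> complex) \<Rightarrow> bool" where
  "boundary_value \<Omega> \<Gamma> g t \<longleftrightarrow> (\<exists>h. eq_L2 \<Omega> h g \<and>
     (AE x in restrict_space surface_measure \<Gamma>. (h \<longlongrightarrow> t x) (at x within \<Omega>)))"

text \<open>\<open>wavelet_ft q (s\<^sup>2)\<close> is the Fourier transform of the even function \<open>q\<close> at frequency \<open>s \<ge> 0\<close>.\<close>

definition wavelet_ft :: "(real \<Rightarrow> real) \<Rightarrow> real \<Rightarrow> real" where
  "wavelet_ft q lam = (LBINT t:{0..}. 2 * cos (t * sqrt lam) * q t)"

text \<open>\<open>\<beta> = F(T) (\<theta> e)\<close>, where \<open>T\<close> is self-adjoint with spectral resolution \<open>E\<close>, \<open>F\<close> is real, and \<open>e\<close>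
  is the surface distribution \<open>f \<mapsto> \<integral>\<^bsub>\<Gamma>\<^esub> f d\<Sigma>\<close>. Since \<open>\<theta> e\<close> is not a function, \<open>F(T)\<close> is extended to it
  by duality: \<open>\<langle>\<beta>, \<phi>\<rangle> = \<langle>\<theta> e, F(T) \<phi>\<rangle> = \<integral>\<^bsub>\<Gamma>\<^esub> \<theta> F(T) \<phi> d\<Sigma>\<close> for \<open>\<phi>\<close> in the domain of \<open>T\<close>.\<close>

definition fun_calc_surface ::
    "(real^'d) set \<Rightarrow> (real set \<Rightarrow> ((real^'d) \<Rightarrow> complex) \<Rightarrow> (real^'d) \<Rightarrow> complex) \<Rightarrow> (real \<Rightarrow> real)
       \<Rightarrow> ((real^'d) \<Rightarrow> real) \<Rightarrow> (real^'d) set \<Rightarrow> ((real^'d) \<Rightarrow> complex) \<Rightarrow> bool" where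
  "fun_calc_surface \<Omega> E F \<theta> \<Gamma> \<beta> \<longleftrightarrow> \<beta> \<in> L2 \<Omega> \<and>
     (\<forall>\<phi> g t. \<phi> \<in> spectral_domain \<Omega> E (\<lambda>s. s) \<longrightarrow> fun_calc \<Omega> E F \<phi> g \<longrightarrow> boundary_value \<Omega> \<Gamma> g t \<longrightarrow>
        integrable (restrict_space surface_measure \<Gamma>) (\<lambda>x. complex_of_real (\<theta> x) * t x) \<longrightarrow>
        inner_L2 \<Omega> \<beta> \<phi> = (LINT x|restrict_space surface_measure \<Gamma>. complex_of_real (\<theta> x) * t x))"

fun chebyshev :: "nat \<Rightarrow> real poly" where
  "chebyshev 0 = 1"
| "chebyshev (Suc 0) = [:0, 1:]"
| "chebyshev (Suc (Suc k)) = [:0, 2:] * chebyshev (Suc k) - chebyshev k"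

definition poly_op :: "real poly \<Rightarrow> (('a \<Rightarrow> complex) \<Rightarrow> ('a \<Rightarrow> complex)) \<Rightarrow> ('a \<Rightarrow> complex) \<Rightarrow> 'a \<Rightarrow> complex" where
  "poly_op p P f = (\<lambda>x. \<Sum>i\<le>degree p. complex_of_real (coeff p i) * (P ^^ i) f x)"

definition poly_mat :: "real poly \<Rightarrow> complex mat \<Rightarrow> complex mat" where
  "poly_mat p A = Matrix.mat (dim_row A) (dim_row A)
     (\<lambda>rs. \<Sum>i\<le>degree p. complex_of_real (coeff p i) * (A ^\<^sub>m i) $$ rs)"

definition block_matrix :: "nat \<Rightarrow> nat \<Rightarrow> nat \<Rightarrow> (nat \<Rightarrow> nat \<Rightarrow> 'a mat) \<Rightarrow> 'a mat" where
  "block_matrix m p r F = Matrix.mat (m * p) (m * r) (\<lambda>(i, j). F (i div m) (j div m) $$ (i mod m, j mod m))"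

definition block :: "nat \<Rightarrow> 'a mat \<Rightarrow> nat \<Rightarrow> nat \<Rightarrow> 'a mat" where
  "block m A k l = Matrix.mat m m (\<lambda>(i, j). A $$ (k * m + i, l * m + j))"

definition minv :: "'a::field mat \<Rightarrow> 'a mat" where
  "minv A = the (mat_inverse A)"

definition mat_sum :: "nat \<Rightarrow> (nat \<Rightarrow> 'a::comm_monoid_add mat) \<Rightarrow> nat \<Rightarrow> 'a mat" where
  "mat_sum m F k = Matrix.mat m m (\<lambda>ij. \<Sum>r<k. F r $$ ij)"

text \<open>The diagonal blocks need not be triangular: any factor of the Schur complement is allowed.\<close>

definition block_cholesky :: "nat \<Rightarrow> nat \<Rightarrow> complex mat \<Rightarrow> complex mat \<Rightarrow> bool" where
  "block_cholesky m n M L \<longleftrightarrow> L \<in> carrier_mat (m * n) (m * n) \<and>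
     (\<forall>k<n. \<forall>l<k. block m L l k = 0\<^sub>m m m) \<and>
     (\<forall>k<n. block m L k k * mat_adjoint (block m L k k) =
        block m M k k - mat_sum m (\<lambda>r. block m L k r * mat_adjoint (block m L k r)) k) \<and>
     (\<forall>k<n. \<forall>l. k < l \<and> l < n \<longrightarrow> block m L l k =
        (block m M l k - mat_sum m (\<lambda>r. block m L l r * mat_adjoint (block m L k r)) k)
          * mat_adjoint (minv (block m L k k))) \<and>
     L * mat_adjoint L = M"

end

(* The propagator P is self-adjoint, so <p(P) b_i, q(P) b_j> depends only on the product p q. Since
2 T_k T_l = T_{k+l} + T_{|k-l|}, this makes M and S the Gram and stiffness matrices of the snapshots,
and the three-term recurrence P u^k = (u^{k+1} + u^{|k-1|})/2 shows that T_k(Pt) Bt is, for k < n,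
the coordinate matrix of u^k in the orthonormalized Krylov basis. Hence both moment functionals agree
on the products T_k T_l (entries of M) and T_{n-1} x T_{n-1} (an entry of S), so on T_0, ..., T_{2n-1}.

That the data are real is the analytic part: P must commute with complex conjugation J, although only
the operator A, not its spectral resolution E, is known to. On the range of E((a, b]) the functions are
approximate eigenvectors of A with error b - a, and so are their conjugates. As cos(tau sqrt s) is
Lipschitz, the norm of PJ - JP is there O(b - a). Halving the interval gains a factor 2 and loses only
sqrt 2 because the two spectral subspaces are orthogonal, so PJ - JP vanishes on E((a, b]). *)

theory Submission
  imports Defs
begin

section \<open>The semi-inner product on square integrable functions\<close>

text \<open>Neither \<open>E\<close> nor \<open>P\<close> is assumed linear, both are given up to
  null functions, and \<open>P\<close> only weakly, through integrals polarized over four positive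
  measures. Operator identities are therefore obtained inside \<open>inner_L2\<close>, by moving an
  operator to the other factor, or as the vanishing of an L2 seminorm. The estimate on an interval
  rests on one formula of the functional calculus: if g = F(T) w, then the squared norm of g - a w
  is the integral of (F - a)^2 against the spectral measure of \<open>w\<close>. It applies to
  conjugates too, whose spectral measure has no known support but the same second moment about a.

  On the algebraic side the obstacle is the top degree. Products T_k T_l with k, l < n have degree
  at most 2n - 2; the last moment comes from 4 x T_k^2 = T_(2k+1) + T_(2k-1) + 2 T_1 with k = n - 1,
  whose other terms have lower degree if n > 1. Linear independence of the snapshots enters as
  invertibility of the Gram matrix \<open>M\<close>, hence of \<open>L\<close>.\<close>

lemma L2_measurable[measurable_dest]: "f \<in> L2 \<Omega> \<Longrightarrow> f \<in> borel_measurable (lebesgue_on \<Omega>)"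
  by (simp add: L2_def)

lemma borel_measurable_cnj[measurable (raw)]:
  "f \<in> borel_measurable M \<Longrightarrow> (\<lambda>x. cnj (f x)) \<in> borel_measurable M"
  by (rule borel_measurable_continuous_on) (intro continuous_intros)

lemma integrable_inner_L2:
  assumes "f \<in> L2 \<Omega>" "g \<in> L2 \<Omega>"
  shows "integrable (lebesgue_on \<Omega>) (\<lambda>x. cnj (f x) * g x)"
proof (rule Bochner_Integration.integrable_bound)
  show "integrable (lebesgue_on \<Omega>) (\<lambda>x. (cmod (f x))\<^sup>2 + (cmod (g x))\<^sup>2)"
    using assms by (simp add: L2_def)
  show "(\<lambda>x. cnj (f x) * g x) \<in> borel_measurable (lebesgue_on \<Omega>)"
    using L2_measurable[OF assms(1)] L2_measurable[OF assms(2)] by measurable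
  have "cmod a * cmod b \<le> (cmod a)\<^sup>2 + (cmod b)\<^sup>2" for a b
    using sum_squares_bound[of "cmod a" "cmod b"] zero_le_power2[of "cmod a"] zero_le_power2[of "cmod b"]
      mult_nonneg_nonneg[OF norm_ge_zero norm_ge_zero, of a b] by linarith
  then show "AE x in lebesgue_on \<Omega>. norm (cnj (f x) * g x) \<le> norm ((cmod (f x))\<^sup>2 + (cmod (g x))\<^sup>2)"
    by (simp add: norm_mult)
qed

lemma L2_scale: "f \<in> L2 \<Omega> \<Longrightarrow> (\<lambda>x. a * f x) \<in> L2 \<Omega>"
  by (auto simp: L2_def norm_mult power_mult_distrib)

lemma L2_add:
  assumes "f \<in> L2 \<Omega>" "g \<in> L2 \<Omega>"
  shows "(\<lambda>x. f x + g x) \<in> L2 \<Omega>"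
proof -
  have "integrable (lebesgue_on \<Omega>) (\<lambda>x. (cmod (f x + g x))\<^sup>2)"
  proof (rule Bochner_Integration.integrable_bound)
    show "integrable (lebesgue_on \<Omega>) (\<lambda>x. 2 * (cmod (f x))\<^sup>2 + 2 * (cmod (g x))\<^sup>2)"
      using assms by (simp add: L2_def)
    show "(\<lambda>x. (cmod (f x + g x))\<^sup>2) \<in> borel_measurable (lebesgue_on \<Omega>)"
      using L2_measurable[OF assms(1)] L2_measurable[OF assms(2)] by measurable
    have "(cmod (a + b))\<^sup>2 \<le> 2 * (cmod a)\<^sup>2 + 2 * (cmod b)\<^sup>2" for a b
    proof -
      have "(cmod (a + b))\<^sup>2 \<le> (cmod a + cmod b)\<^sup>2"
        by (intro power_mono norm_triangle_ineq) simp
      also have "\<dots> \<le> 2 * (cmod a)\<^sup>2 + 2 * (cmod b)\<^sup>2"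
        using sum_squares_bound[of "cmod a" "cmod b"] by (simp add: power2_sum)
      finally show ?thesis .
    qed
    then show "AE x in lebesgue_on \<Omega>. norm ((cmod (f x + g x))\<^sup>2) \<le> norm (2 * (cmod (f x))\<^sup>2 + 2 * (cmod (g x))\<^sup>2)"
      by simp
  qed
  then show ?thesis
    using L2_measurable[OF assms(1)] L2_measurable[OF assms(2)] by (auto simp: L2_def)
qed

lemma L2_uminus: "f \<in> L2 \<Omega> \<Longrightarrow> (\<lambda>x. - f x) \<in> L2 \<Omega>"
  using L2_scale[of f \<Omega> "-1"] by simp

lemma L2_diff: "f \<in> L2 \<Omega> \<Longrightarrow> g \<in> L2 \<Omega> \<Longrightarrow> (\<lambda>x. f x - g x) \<in> L2 \<Omega>"
  using L2_add[OF _ L2_uminus, of f \<Omega> g] by simp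

lemma L2_zero: "(\<lambda>x. 0) \<in> L2 \<Omega>"
  by (simp add: L2_def)

lemma L2_cnj: "f \<in> L2 \<Omega> \<Longrightarrow> (\<lambda>x. cnj (f x)) \<in> L2 \<Omega>"
  by (auto simp: L2_def)

lemma L2_sum: "(\<And>i. i \<in> I \<Longrightarrow> f i \<in> L2 \<Omega>) \<Longrightarrow> (\<lambda>x. \<Sum>i\<in>I. f i x) \<in> L2 \<Omega>"
  by (induction I rule: infinite_finite_induct) (auto intro: L2_zero L2_add)

text \<open>Values off \<Omega> are left arbitrary: a partial derivative of a conjugated function is
  under control only where the function is known to be differentiable.\<close>

lemma L2_cong:
  assumes "f \<in> L2 \<Omega>" "\<And>x. x \<in> \<Omega> \<Longrightarrow> g x = f x"
  shows "g \<in> L2 \<Omega>"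
proof -
  have *: "f x = g x" if "x \<in> space (lebesgue_on \<Omega>)" for x
    using assms(2) that by (simp add: space_restrict_space)
  have "g \<in> borel_measurable (lebesgue_on \<Omega>)"
    using L2_measurable[OF assms(1)] measurable_cong[of "lebesgue_on \<Omega>" f g borel] * by auto
  moreover have "integrable (lebesgue_on \<Omega>) (\<lambda>x. (cmod (g x))\<^sup>2)"
    using assms(1) Bochner_Integration.integrable_cong[OF refl, of "lebesgue_on \<Omega>" "\<lambda>x. (cmod (f x))\<^sup>2" "\<lambda>x. (cmod (g x))\<^sup>2"] *
    by (auto simp: L2_def)
  ultimately show ?thesis by (simp add: L2_def)
qed

lemmas L2_intros = L2_add L2_diff L2_uminus L2_scale L2_zero L2_cnj L2_sum

lemma inner_L2_add_right:
  "f \<in> L2 \<Omega> \<Longrightarrow> g \<in> L2 \<Omega> \<Longrightarrow> h \<in> L2 \<Omega> \<Longrightarrow>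
    inner_L2 \<Omega> f (\<lambda>x. g x + h x) = inner_L2 \<Omega> f g + inner_L2 \<Omega> f h"
  by (simp add: inner_L2_def distrib_left integrable_inner_L2)

lemma inner_L2_diff_right:
  "f \<in> L2 \<Omega> \<Longrightarrow> g \<in> L2 \<Omega> \<Longrightarrow> h \<in> L2 \<Omega> \<Longrightarrow>
    inner_L2 \<Omega> f (\<lambda>x. g x - h x) = inner_L2 \<Omega> f g - inner_L2 \<Omega> f h"
  by (simp add: inner_L2_def right_diff_distrib integrable_inner_L2)

lemma inner_L2_scale_right: "inner_L2 \<Omega> f (\<lambda>x. a * g x) = a * inner_L2 \<Omega> f g"
  by (simp add: inner_L2_def mult.left_commute)

lemma inner_L2_cnj: "inner_L2 \<Omega> (\<lambda>x. cnj (f x)) (\<lambda>x. cnj (g x)) = cnj (inner_L2 \<Omega> f g)"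
  unfolding inner_L2_def by (subst Bochner_Integration.integral_cnj[symmetric]) simp

lemma inner_L2_commute: "inner_L2 \<Omega> f g = cnj (inner_L2 \<Omega> g f)"
  unfolding inner_L2_def by (subst Bochner_Integration.integral_cnj[symmetric]) (simp add: mult.commute)

lemma inner_L2_add_left:
  "f \<in> L2 \<Omega> \<Longrightarrow> g \<in> L2 \<Omega> \<Longrightarrow> h \<in> L2 \<Omega> \<Longrightarrow>
    inner_L2 \<Omega> (\<lambda>x. f x + g x) h = inner_L2 \<Omega> f h + inner_L2 \<Omega> g h"
  by (simp add: inner_L2_def distrib_right integrable_inner_L2)

lemma inner_L2_diff_left:
  "f \<in> L2 \<Omega> \<Longrightarrow> g \<in> L2 \<Omega> \<Longrightarrow> h \<in> L2 \<Omega> \<Longrightarrow>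
    inner_L2 \<Omega> (\<lambda>x. f x - g x) h = inner_L2 \<Omega> f h - inner_L2 \<Omega> g h"
  by (simp add: inner_L2_def left_diff_distrib integrable_inner_L2)

lemma inner_L2_scale_left: "inner_L2 \<Omega> (\<lambda>x. a * f x) g = cnj a * inner_L2 \<Omega> f g"
  by (simp add: inner_L2_def mult.assoc)

lemma inner_L2_sum_right:
  "f \<in> L2 \<Omega> \<Longrightarrow> (\<And>i. i \<in> I \<Longrightarrow> g i \<in> L2 \<Omega>) \<Longrightarrow>
    inner_L2 \<Omega> f (\<lambda>x. \<Sum>i\<in>I. g i x) = (\<Sum>i\<in>I. inner_L2 \<Omega> f (g i))"
  by (simp add: inner_L2_def sum_distrib_left integrable_inner_L2)

lemma inner_L2_sum_left:
  "f \<in> L2 \<Omega> \<Longrightarrow> (\<And>i. i \<in> I \<Longrightarrow> g i \<in> L2 \<Omega>) \<Longrightarrow>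
    inner_L2 \<Omega> (\<lambda>x. \<Sum>i\<in>I. g i x) f = (\<Sum>i\<in>I. inner_L2 \<Omega> (g i) f)"
  by (simp add: inner_L2_def sum_distrib_right integrable_inner_L2)

lemma inner_L2_cong_eq_L2:
  assumes "eq_L2 \<Omega> g g'" "f \<in> L2 \<Omega>" "g \<in> L2 \<Omega>" "g' \<in> L2 \<Omega>"
  shows "inner_L2 \<Omega> f g = inner_L2 \<Omega> f g'"
  unfolding inner_L2_def
proof (rule integral_cong_AE)
  show "(\<lambda>x. cnj (f x) * g x) \<in> borel_measurable (lebesgue_on \<Omega>)"
    "(\<lambda>x. cnj (f x) * g' x) \<in> borel_measurable (lebesgue_on \<Omega>)"
    using assms by (auto intro!: borel_measurable_integrable integrable_inner_L2)
  show "AE x in lebesgue_on \<Omega>. cnj (f x) * g x = cnj (f x) * g' x"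
    using assms(1) unfolding eq_L2_def by eventually_elim simp
qed

text \<open>Only a seminorm, since functions equal almost everywhere are not identified; equations
  of the Hilbert space appear below as the vanishing of the seminorm of a difference, or weakly
  inside \<open>inner_L2\<close>.\<close>

definition norm_L2 :: "(real^'d) set \<Rightarrow> ((real^'d) \<Rightarrow> complex) \<Rightarrow> real" where
  "norm_L2 \<Omega> f = sqrt (LINT x|lebesgue_on \<Omega>. (cmod (f x))\<^sup>2)"

lemma norm_L2_nonneg[simp]: "0 \<le> norm_L2 \<Omega> f"
  by (simp add: norm_L2_def)

lemma norm_L2_sq: "(norm_L2 \<Omega> f)\<^sup>2 = (LINT x|lebesgue_on \<Omega>. (cmod (f x))\<^sup>2)"
  by (simp add: norm_L2_def)

lemma inner_L2_self: "inner_L2 \<Omega> f f = complex_of_real ((norm_L2 \<Omega> f)\<^sup>2)"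
proof -
  have "cnj (f x) * f x = complex_of_real ((cmod (f x))\<^sup>2)" for x
    by (metis complex_norm_square mult.commute)
  then show ?thesis unfolding inner_L2_def norm_L2_sq by (simp only: integral_complex_of_real)
qed

lemma norm_L2_scale: "norm_L2 \<Omega> (\<lambda>x. a * f x) = cmod a * norm_L2 \<Omega> f"
  by (simp add: norm_L2_def norm_mult power_mult_distrib real_sqrt_mult)

lemma norm_L2_cnj: "norm_L2 \<Omega> (\<lambda>x. cnj (f x)) = norm_L2 \<Omega> f"
  by (simp add: norm_L2_def)

lemma norm_L2_diff_sq:
  assumes "f \<in> L2 \<Omega>" "g \<in> L2 \<Omega>"
  shows "(norm_L2 \<Omega> (\<lambda>x. f x - g x))\<^sup>2 = (norm_L2 \<Omega> f)\<^sup>2 - 2 * Re (inner_L2 \<Omega> f g) + (norm_L2 \<Omega> g)\<^sup>2"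
proof -
  have "inner_L2 \<Omega> (\<lambda>x. f x - g x) (\<lambda>x. f x - g x)
      = inner_L2 \<Omega> f f - inner_L2 \<Omega> f g - inner_L2 \<Omega> g f + inner_L2 \<Omega> g g"
    using assms by (simp add: inner_L2_diff_left inner_L2_diff_right L2_intros)
  also have "inner_L2 \<Omega> g f = cnj (inner_L2 \<Omega> f g)" by (rule inner_L2_commute)
  finally have "Re (inner_L2 \<Omega> (\<lambda>x. f x - g x) (\<lambda>x. f x - g x))
      = Re (inner_L2 \<Omega> f f) - 2 * Re (inner_L2 \<Omega> f g) + Re (inner_L2 \<Omega> g g)" by simp
  then show ?thesis by (simp only: inner_L2_self Re_complex_of_real)
qed

text \<open>A \<open>g\<close> of seminorm 0 is treated apart, as no projection onto it can be
  formed: it vanishes almost everywhere, and so does the integrand.\<close>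

lemma norm_L2_cauchy_schwarz:
  assumes f: "f \<in> L2 \<Omega>" and g: "g \<in> L2 \<Omega>"
  shows "cmod (inner_L2 \<Omega> f g) \<le> norm_L2 \<Omega> f * norm_L2 \<Omega> g"
proof (cases "norm_L2 \<Omega> g = 0")
  case True
  have "AE x in lebesgue_on \<Omega>. (cmod (g x))\<^sup>2 = 0"
    using True g integral_nonneg_eq_0_iff_AE[of "lebesgue_on \<Omega>" "\<lambda>x. (cmod (g x))\<^sup>2"]
    by (simp add: norm_L2_def L2_def)
  then have "eq_L2 \<Omega> g (\<lambda>x. 0)" by (simp add: eq_L2_def)
  then have "inner_L2 \<Omega> f g = inner_L2 \<Omega> f (\<lambda>x. 0)"
    by (intro inner_L2_cong_eq_L2 assms L2_zero)
  then show ?thesis by (simp add: inner_L2_def)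
next
  case False
  define s where "s = (norm_L2 \<Omega> g)\<^sup>2"
  have s: "s > 0" using False by (simp add: s_def)
  \<comment> \<open>The coefficient of the orthogonal projection of \<open>f\<close> onto
    \<open>g\<close>; nonnegativity of the squared norm of the remainder is the inequality.\<close>
  define a where "a = inner_L2 \<Omega> g f / s"
  have "0 \<le> (norm_L2 \<Omega> (\<lambda>x. f x - a * g x))\<^sup>2" by simp
  also have "\<dots> = (norm_L2 \<Omega> f)\<^sup>2 - 2 * Re (a * inner_L2 \<Omega> f g) + (cmod a * norm_L2 \<Omega> g)\<^sup>2"
    by (subst norm_L2_diff_sq) (auto simp: assms L2_scale inner_L2_scale_right norm_L2_scale)
  also have "a * inner_L2 \<Omega> f g = complex_of_real ((cmod (inner_L2 \<Omega> f g))\<^sup>2 / s)"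
    unfolding a_def inner_L2_commute[of \<Omega> g f] of_real_divide complex_norm_square
    by (simp add: mult.commute)
  also have "(cmod a * norm_L2 \<Omega> g)\<^sup>2 = (cmod (inner_L2 \<Omega> f g))\<^sup>2 / s"
    unfolding a_def inner_L2_commute[of \<Omega> g f] power_mult_distrib s_def[symmetric]
    using s by (simp add: norm_divide power_divide power2_eq_square)
  finally have "(cmod (inner_L2 \<Omega> f g))\<^sup>2 \<le> (norm_L2 \<Omega> f)\<^sup>2 * s"
    using s by (simp add: field_simps)
  then have "(cmod (inner_L2 \<Omega> f g))\<^sup>2 \<le> (norm_L2 \<Omega> f * norm_L2 \<Omega> g)\<^sup>2"
    by (simp add: s_def power_mult_distrib)
  then show ?thesis by (rule power2_le_imp_le) simp
qed

lemma norm_L2_diff_triangle: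
  assumes "f \<in> L2 \<Omega>" "g \<in> L2 \<Omega>"
  shows "norm_L2 \<Omega> (\<lambda>x. f x - g x) \<le> norm_L2 \<Omega> f + norm_L2 \<Omega> g"
proof (rule power2_le_imp_le)
  have "- Re (inner_L2 \<Omega> f g) \<le> norm_L2 \<Omega> f * norm_L2 \<Omega> g"
    using norm_L2_cauchy_schwarz[OF assms] abs_Re_le_cmod[of "inner_L2 \<Omega> f g"] by linarith
  then show "(norm_L2 \<Omega> (\<lambda>x. f x - g x))\<^sup>2 \<le> (norm_L2 \<Omega> f + norm_L2 \<Omega> g)\<^sup>2"
    unfolding norm_L2_diff_sq[OF assms] power2_sum by linarith
qed simp

lemma norm_L2_triangle:
  assumes "f \<in> L2 \<Omega>" "g \<in> L2 \<Omega>"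
  shows "norm_L2 \<Omega> (\<lambda>x. f x + g x) \<le> norm_L2 \<Omega> f + norm_L2 \<Omega> g"
  using norm_L2_diff_triangle[OF assms(1) L2_uminus[OF assms(2)]] by (simp add: norm_L2_def)

lemma norm_L2_eq_0_iff:
  assumes "f \<in> L2 \<Omega>"
  shows "norm_L2 \<Omega> f = 0 \<longleftrightarrow> eq_L2 \<Omega> f (\<lambda>x. 0)"
  using assms integral_nonneg_eq_0_iff_AE[of "lebesgue_on \<Omega>" "\<lambda>x. (cmod (f x))\<^sup>2"]
  by (simp add: norm_L2_def L2_def eq_L2_def)

lemma norm_L2_zero[simp]: "norm_L2 \<Omega> (\<lambda>x. 0) = 0"
  by (simp add: norm_L2_def)

section \<open>Integrals with respect to related measures\<close>

text \<open>Extends an identity between set functions to integrands: indicators by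
  \<open>eq\<close>, simple functions by linearity, \<open>H\<close> by dominated convergence. With
  \<open>K\<close> indexing the four terms of a polarized integral and \<open>\<nu>\<close> a single
  spectral measure, it evaluates \<open>spectral_integral\<close>.\<close>

lemma sum_integral_eq_density_integral:
  fixes a :: "'i \<Rightarrow> complex" and \<mu> :: "'i \<Rightarrow> 'a measure" and G H :: "'a \<Rightarrow> real"
  assumes fin: "\<And>k. k \<in> K \<Longrightarrow> finite_measure (\<mu> k)"
    and sets_mu: "\<And>k. k \<in> K \<Longrightarrow> sets (\<mu> k) = sets N"
    and sets_nu: "sets \<nu> = sets N"
    and G: "integrable \<nu> G"
    and eq: "\<And>C. C \<in> sets N \<Longrightarrow> (\<Sum>k\<in>K. a k * complex_of_real (measure (\<mu> k) C))
               = complex_of_real (LINT s|\<nu>. G s * indicator C s)"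
    and H: "H \<in> borel_measurable N"
    and int_mu: "\<And>k. k \<in> K \<Longrightarrow> integrable (\<mu> k) H"
    and int_nu: "integrable \<nu> (\<lambda>s. G s * H s)"
  shows "(\<Sum>k\<in>K. a k * complex_of_real (LINT s|\<mu> k. H s)) = complex_of_real (LINT s|\<nu>. G s * H s)"
proof -
  obtain F where F: "\<And>i. simple_function N (F i)"
    and lim: "\<And>x. x \<in> space N \<Longrightarrow> (\<lambda>i. F i x) \<longlonglongrightarrow> H x"
    and bound: "\<And>i x. x \<in> space N \<Longrightarrow> dist (F i x) 0 \<le> 2 * dist (H x) 0"
    using borel_measurable_implies_sequence_metric[OF H, of 0] by blast
  have bound': "\<bar>F i x\<bar> \<le> 2 * \<bar>H x\<bar>" if "x \<in> space N" for i x
    using bound[OF that, of i] by simp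
  have space_mu: "space (\<mu> k) = space N" if "k \<in> K" for k
    using sets_mu[OF that] by (rule sets_eq_imp_space_eq)
  have space_nu: "space \<nu> = space N"
    using sets_nu by (rule sets_eq_imp_space_eq)
  have F_rep: "F i x = (\<Sum>y\<in>F i ` space N. y * indicator (F i -` {y} \<inter> space N) x)" if "x \<in> space N" for i x
  proof -
    have "(\<Sum>y\<in>F i ` space N. y * indicator (F i -` {y} \<inter> space N) x) = (\<Sum>y\<in>{F i x}. y)"
      using that simple_functionD(1)[OF F[of i]] by (intro sum.mono_neutral_cong_right) auto
    then show ?thesis by simp
  qed
  have level[measurable]: "F i -` {y} \<inter> space N \<in> sets N" for i y
    by (rule simple_functionD(2)[OF F])
  have simple: "(\<Sum>k\<in>K. a k * complex_of_real (LINT s|\<mu> k. F i s)) = complex_of_real (LINT s|\<nu>. G s * F i s)" for i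
  proof -
    let ?R = "F i ` space N" and ?L = "\<lambda>y. F i -` {y} \<inter> space N"
    have mu: "(LINT s|\<mu> k. F i s) = (\<Sum>y\<in>?R. y * measure (\<mu> k) (?L y))" if k: "k \<in> K" for k
    proof -
      interpret finite_measure "\<mu> k" using fin k .
      have "(LINT s|\<mu> k. F i s) = (LINT s|\<mu> k. (\<Sum>y\<in>?R. y * indicator (?L y) s))"
        by (intro Bochner_Integration.integral_cong refl F_rep) (simp only: space_mu[OF k])
      also have "\<dots> = (\<Sum>y\<in>?R. (LINT s|\<mu> k. y * indicator (?L y) s))"
        by (intro Bochner_Integration.integral_sum integrable_mult_right integrable_real_indicator)
          (auto simp: sets_mu[OF k] emeasure_eq_measure)
      also have "\<dots> = (\<Sum>y\<in>?R. y * measure (\<mu> k) (?L y))"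
        by (simp add: space_mu[OF k])
      finally show ?thesis .
    qed
    have int_G: "integrable \<nu> (\<lambda>s. G s * indicator (?L y) s)" for y
      using integrable_mult_indicator[OF _ G, of "?L y"] by (simp add: sets_nu mult.commute)
    have "(LINT s|\<nu>. G s * F i s) = (LINT s|\<nu>. (\<Sum>y\<in>?R. y * (G s * indicator (?L y) s)))"
    proof (intro Bochner_Integration.integral_cong refl)
      fix s assume "s \<in> space \<nu>"
      then have "F i s = (\<Sum>y\<in>?R. y * indicator (?L y) s)" by (intro F_rep) (simp only: space_nu)
      then show "G s * F i s = (\<Sum>y\<in>?R. y * (G s * indicator (?L y) s))"
        by (simp only: sum_distrib_left mult.left_commute[of "G s"])
    qed
    also have "\<dots> = (\<Sum>y\<in>?R. y * (LINT s|\<nu>. G s * indicator (?L y) s))"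
      using int_G by (subst Bochner_Integration.integral_sum) auto
    finally have nu: "complex_of_real (LINT s|\<nu>. G s * F i s)
        = (\<Sum>y\<in>?R. complex_of_real y * complex_of_real (LINT s|\<nu>. G s * indicator (?L y) s))" by simp
    have "(\<Sum>k\<in>K. a k * complex_of_real (LINT s|\<mu> k. F i s))
        = (\<Sum>k\<in>K. \<Sum>y\<in>?R. complex_of_real y * (a k * complex_of_real (measure (\<mu> k) (?L y))))"
      by (intro sum.cong refl) (simp add: mu sum_distrib_left mult.left_commute)
    also have "\<dots> = (\<Sum>y\<in>?R. complex_of_real y * (\<Sum>k\<in>K. a k * complex_of_real (measure (\<mu> k) (?L y))))"
      by (subst sum.swap) (simp add: sum_distrib_left)
    also have "\<dots> = (\<Sum>y\<in>?R. complex_of_real y * complex_of_real (LINT s|\<nu>. G s * indicator (?L y) s))"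
      by (intro sum.cong refl arg_cong2[where f="(*)"] eq level)
    finally show ?thesis using nu by simp
  qed
  have F_meas: "F i \<in> borel_measurable N" for i
    using F by (rule borel_measurable_simple_function)
  \<comment> \<open>The dominating functions 2 |H| here and 2 |G H| below stem from the factor 2 in
    the choice of the simple approximants.\<close>
  have lim_mu: "(\<lambda>i. LINT s|\<mu> k. F i s) \<longlonglongrightarrow> (LINT s|\<mu> k. H s)" if k: "k \<in> K" for k
  proof (rule integral_dominated_convergence)
    show "H \<in> borel_measurable (\<mu> k)" using int_mu[OF k] by auto
    show "F i \<in> borel_measurable (\<mu> k)" for i
      using F_meas[of i] by (subst measurable_cong_sets[OF sets_mu[OF k] refl])
    show "integrable (\<mu> k) (\<lambda>x. 2 * \<bar>H x\<bar>)" using int_mu[OF k] by simp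
    show "AE x in \<mu> k. (\<lambda>i. F i x) \<longlonglongrightarrow> H x"
      using lim by (intro AE_I2) (simp only: space_mu[OF k])
    show "AE x in \<mu> k. norm (F i x) \<le> 2 * \<bar>H x\<bar>" for i
      using bound' by (intro AE_I2) (simp add: space_mu[OF k])
  qed
  have lim_nu: "(\<lambda>i. LINT s|\<nu>. G s * F i s) \<longlonglongrightarrow> (LINT s|\<nu>. G s * H s)"
  proof (rule integral_dominated_convergence)
    show "(\<lambda>s. G s * H s) \<in> borel_measurable \<nu>" using int_nu by auto
    have "F i \<in> borel_measurable \<nu>" for i
      using F_meas[of i] by (subst measurable_cong_sets[OF sets_nu refl])
    then show "(\<lambda>s. G s * F i s) \<in> borel_measurable \<nu>" for i
      using G by (intro borel_measurable_times) auto
    show "integrable \<nu> (\<lambda>x. 2 * \<bar>G x * H x\<bar>)" using int_nu by simp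
    show "AE x in \<nu>. (\<lambda>i. G x * F i x) \<longlonglongrightarrow> G x * H x"
      using lim by (auto simp: space_nu intro!: AE_I2 tendsto_mult_left)
    show "AE x in \<nu>. norm (G x * F i x) \<le> 2 * \<bar>G x * H x\<bar>" for i
    proof (intro AE_I2)
      fix x assume "x \<in> space \<nu>"
      then have "\<bar>G x\<bar> * \<bar>F i x\<bar> \<le> \<bar>G x\<bar> * (2 * \<bar>H x\<bar>)"
        using bound'[of x i] space_nu by (intro mult_left_mono) auto
      then show "norm (G x * F i x) \<le> 2 * \<bar>G x * H x\<bar>" by (simp add: abs_mult)
    qed
  qed
  have "(\<lambda>i. \<Sum>k\<in>K. a k * complex_of_real (LINT s|\<mu> k. F i s))
      \<longlonglongrightarrow> (\<Sum>k\<in>K. a k * complex_of_real (LINT s|\<mu> k. H s))"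
    using lim_mu by (intro tendsto_sum tendsto_mult_left tendsto_of_real)
  moreover have "(\<lambda>i. complex_of_real (LINT s|\<nu>. G s * F i s)) \<longlonglongrightarrow> complex_of_real (LINT s|\<nu>. G s * H s)"
    using lim_nu by (intro tendsto_of_real)
  ultimately show ?thesis
    unfolding simple by (rule LIMSEQ_unique)
qed

text \<open>Domination on sets passes to integrals by induction over nonnegative measurable
  functions. It serves to transfer integrability from the spectral measures of two functions to that
  of their combination.\<close>

lemma nn_integral_le_of_emeasure_le:
  fixes a :: ennreal
  assumes sets: "sets \<nu> = sets N" "sets \<mu>1 = sets N" "sets \<mu>2 = sets N"
    and le: "\<And>C. C \<in> sets N \<Longrightarrow> emeasure \<nu> C \<le> a * emeasure \<mu>1 C + a * emeasure \<mu>2 C"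
    and F: "F \<in> borel_measurable N"
  shows "(\<integral>\<^sup>+s. F s \<partial>\<nu>) \<le> a * (\<integral>\<^sup>+s. F s \<partial>\<mu>1) + a * (\<integral>\<^sup>+s. F s \<partial>\<mu>2)"
proof -
  have meas: "g \<in> borel_measurable \<nu>" "g \<in> borel_measurable \<mu>1" "g \<in> borel_measurable \<mu>2"
    if "g \<in> borel_measurable N" for g :: "_ \<Rightarrow> ennreal"
    using that by (simp_all only: measurable_cong_sets[OF sets(1) refl] measurable_cong_sets[OF sets(2) refl]
      measurable_cong_sets[OF sets(3) refl])
  have space: "space \<nu> = space N" "space \<mu>1 = space N" "space \<mu>2 = space N"
    using sets by (auto dest: sets_eq_imp_space_eq)
  from F show ?thesis
  proof (induction rule: borel_measurable_induct)
    case (cong f g)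
    have "(\<integral>\<^sup>+s. f s \<partial>\<nu>) = (\<integral>\<^sup>+s. g s \<partial>\<nu>)" "(\<integral>\<^sup>+s. f s \<partial>\<mu>1) = (\<integral>\<^sup>+s. g s \<partial>\<mu>1)"
      "(\<integral>\<^sup>+s. f s \<partial>\<mu>2) = (\<integral>\<^sup>+s. g s \<partial>\<mu>2)"
      using cong(3) by (auto intro!: nn_integral_cong simp: space)
    then show ?case using cong(4) by simp
  next
    case (set A)
    then show ?case using le[of A] by (simp add: sets)
  next
    case (mult u c)
    then show ?case using mult_left_mono[OF mult(4), of c] meas[OF mult(2)]
      by (simp add: nn_integral_cmult distrib_left mult.left_commute)
  next
    case (add u v)
    then show ?case using add_mono[OF add(6) add(7)] meas[OF add(1)] meas[OF add(3)]
      by (simp add: nn_integral_add distrib_left add_ac)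
  next
    case (seq U)
    have mono: "(\<integral>\<^sup>+s. U i s \<partial>\<mu>) \<le> (\<integral>\<^sup>+s. (SUP i. U i) s \<partial>\<mu>)" for i \<mu>
      by (intro nn_integral_mono) (rule le_funD[OF Sup_upper[OF rangeI]])
    have "(\<integral>\<^sup>+s. (SUP i. U i) s \<partial>\<nu>) = (SUP i. \<integral>\<^sup>+s. U i s \<partial>\<nu>)"
      unfolding SUP_apply using seq(3) meas[OF seq(1)] by (intro nn_integral_monotone_convergence_SUP) auto
    also have "\<dots> \<le> a * (\<integral>\<^sup>+s. (SUP i. U i) s \<partial>\<mu>1) + a * (\<integral>\<^sup>+s. (SUP i. U i) s \<partial>\<mu>2)"
      by (intro SUP_least order_trans[OF seq(5)] add_mono mult_left_mono mono) auto
    finally show ?case .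
  qed
qed

section \<open>Spectral measures\<close>

locale spectral_family =
  fixes \<Omega> :: "(real^'d) set"
    and E :: "real set \<Rightarrow> ((real^'d) \<Rightarrow> complex) \<Rightarrow> (real^'d) \<Rightarrow> complex"
  assumes resolution_of_identity: "resolution_of_identity \<Omega> E"
begin

abbreviation "\<mu> \<equiv> spectral_measure \<Omega> E"

lemma E_L2: "B \<in> sets borel \<Longrightarrow> f \<in> L2 \<Omega> \<Longrightarrow> E B f \<in> L2 \<Omega>"
  using resolution_of_identity by (simp add: resolution_of_identity_def)

lemma E_adjoint: "B \<in> sets borel \<Longrightarrow> f \<in> L2 \<Omega> \<Longrightarrow> g \<in> L2 \<Omega> \<Longrightarrow>
    inner_L2 \<Omega> f (E B g) = inner_L2 \<Omega> (E B f) g"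
  using resolution_of_identity by (simp add: resolution_of_identity_def)

text \<open>The laws of \<open>E\<close> hold almost everywhere only; paired with a fixed function
  they become equations between numbers and can be rewritten.\<close>

lemma E_Int:
  assumes "B \<in> sets borel" "C \<in> sets borel" "f \<in> L2 \<Omega>" "g \<in> L2 \<Omega>"
  shows "inner_L2 \<Omega> f (E B (E C g)) = inner_L2 \<Omega> f (E (B \<inter> C) g)"
proof (rule inner_L2_cong_eq_L2)
  show "eq_L2 \<Omega> (E B (E C g)) (E (B \<inter> C) g)"
    using resolution_of_identity assms by (simp add: resolution_of_identity_def)
qed (use assms in \<open>auto intro!: E_L2\<close>)

lemma E_UNIV:
  assumes "f \<in> L2 \<Omega>" "g \<in> L2 \<Omega>"
  shows "inner_L2 \<Omega> f (E UNIV g) = inner_L2 \<Omega> f g"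
proof (rule inner_L2_cong_eq_L2)
  show "eq_L2 \<Omega> (E UNIV g) g"
    using resolution_of_identity assms by (simp add: resolution_of_identity_def)
qed (use assms in \<open>auto intro!: E_L2\<close>)

lemma E_sums:
  assumes "range B \<subseteq> sets borel" "disjoint_family B" "f \<in> L2 \<Omega>"
  shows "(\<lambda>i::nat. inner_L2 \<Omega> f (E (B i) f)) sums inner_L2 \<Omega> f (E (\<Union>i. B i) f)"
  using resolution_of_identity assms unfolding resolution_of_identity_def by blast

text \<open>Up to null functions \<open>E B\<close> is a self-adjoint idempotent, so its quadratic
  form is a squared norm. This is the positivity that a measure requires.\<close>

lemma E_self:
  assumes "B \<in> sets borel" "f \<in> L2 \<Omega>"
  shows "inner_L2 \<Omega> f (E B f) = complex_of_real ((norm_L2 \<Omega> (E B f))\<^sup>2)"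
proof -
  have "inner_L2 \<Omega> f (E B f) = inner_L2 \<Omega> f (E B (E B f))"
    using E_Int[OF assms(1,1,2,2)] by simp
  also have "\<dots> = inner_L2 \<Omega> (E B f) (E B f)"
    by (rule E_adjoint) (use assms E_L2 in auto)
  finally show ?thesis by (simp only: inner_L2_self)
qed

lemma sets_spectral_measure[simp, measurable_cong]: "sets (\<mu> f) = sets borel"
  unfolding spectral_measure_def using sets.sigma_sets_eq[of "borel :: real measure"]
  by (subst sets_measure_of) auto

lemma space_spectral_measure[simp]: "space (\<mu> f) = UNIV"
  using sets_eq_imp_space_eq[OF sets_spectral_measure, of f] by simp

text \<open>\<open>measure_of\<close> returns the prescribed set function only once positivity and
  countable additivity are verified; the latter is the additivity axiom of \<open>E\<close> on the
  diagonal.\<close>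

lemma emeasure_spectral_measure:
  assumes f: "f \<in> L2 \<Omega>" and B: "B \<in> sets borel"
  shows "emeasure (\<mu> f) B = ennreal ((norm_L2 \<Omega> (E B f))\<^sup>2)"
proof -
  let ?m = "\<lambda>B. ennreal (Re (inner_L2 \<Omega> f (E B f)))"
  \<comment> \<open>The empty set is the disjoint union of countably many copies of itself, and a
    constant sequence is summable only if it is zero.\<close>
  have empty: "inner_L2 \<Omega> f (E {} f) = 0"
  proof -
    have "(\<lambda>i::nat. inner_L2 \<Omega> f (E {} f)) sums inner_L2 \<Omega> f (E {} f)"
      using E_sums[of "\<lambda>_. {}" f] f by (simp add: disjoint_family_on_def)
    then show ?thesis by (metis sums_summable summable_const_iff)
  qed
  have "emeasure (\<mu> f) B = ?m B"
    unfolding spectral_measure_def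
  proof (rule emeasure_measure_of_sigma)
    show "sigma_algebra UNIV (sets (borel::real measure))"
      using sets.sigma_algebra_axioms[of "borel::real measure"] by simp
    show "positive (sets borel) ?m" using empty by (simp add: positive_def)
    show "countably_additive (sets borel) ?m"
    proof (rule countably_additiveI)
      fix A :: "nat \<Rightarrow> real set"
      assume A: "range A \<subseteq> sets borel" "disjoint_family A"
      have "(\<lambda>i. Re (inner_L2 \<Omega> f (E (A i) f))) sums Re (inner_L2 \<Omega> f (E (\<Union>i. A i) f))"
        using E_sums[OF A f] by (rule sums_Re)
      note sums = this
      have "0 \<le> Re (inner_L2 \<Omega> f (E (A i) f))" for i
        using A f by (subst E_self) auto
      then have "(\<Sum>i. ennreal (Re (inner_L2 \<Omega> f (E (A i) f)))) = ennreal (\<Sum>i. Re (inner_L2 \<Omega> f (E (A i) f)))"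
        by (rule suminf_ennreal2) (rule sums_summable[OF sums])
      then show "(\<Sum>i. ?m (A i)) = ?m (\<Union> (range A))"
        using sums_unique[OF sums] by simp
    qed
  qed (use B in auto)
  then show ?thesis by (simp only: E_self[OF B f] Re_complex_of_real)
qed

lemma finite_measure_spectral_measure:
  assumes "f \<in> L2 \<Omega>"
  shows "finite_measure (\<mu> f)"
  by (rule finite_measureI) (simp add: emeasure_spectral_measure[OF assms])

lemma measure_spectral_measure:
  assumes "f \<in> L2 \<Omega>" "B \<in> sets borel"
  shows "measure (\<mu> f) B = (norm_L2 \<Omega> (E B f))\<^sup>2"
  by (simp add: measure_def emeasure_spectral_measure[OF assms])

lemma complex_of_real_measure_spectral_measure:
  assumes "f \<in> L2 \<Omega>" "B \<in> sets borel"
  shows "complex_of_real (measure (\<mu> f) B) = inner_L2 \<Omega> f (E B f)"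
  by (simp only: measure_spectral_measure[OF assms] E_self[OF assms(2,1)])

lemma measure_spectral_measure_UNIV:
  assumes "f \<in> L2 \<Omega>"
  shows "measure (\<mu> f) UNIV = (norm_L2 \<Omega> f)\<^sup>2"
proof -
  have UNIV: "UNIV \<in> sets (borel :: real measure)" by simp
  have "complex_of_real (measure (\<mu> f) UNIV) = complex_of_real ((norm_L2 \<Omega> f)\<^sup>2)"
    by (simp only: complex_of_real_measure_spectral_measure[OF assms UNIV]
        E_UNIV[OF assms assms] inner_L2_self)
  then show ?thesis by (simp only: of_real_eq_iff)
qed

text \<open>\<open>E C\<close> is not assumed linear, but it can be moved to the left factor, where
  linearity of \<open>inner_L2\<close> in its right argument does the expansion.\<close>

lemma inner_E_expand:
  assumes "v \<in> L2 \<Omega>" "w \<in> L2 \<Omega>" and C: "C \<in> sets borel"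
  shows "inner_L2 \<Omega> (\<lambda>x. v x + a * w x) (E C (\<lambda>x. v x + a * w x))
    = inner_L2 \<Omega> v (E C v) + a * inner_L2 \<Omega> v (E C w) + cnj a * inner_L2 \<Omega> w (E C v)
      + (cnj a * a) * inner_L2 \<Omega> w (E C w)"
proof -
  have aw: "(\<lambda>x. a * w x) \<in> L2 \<Omega>" using assms by (simp add: L2_intros)
  have E: "inner_L2 \<Omega> u (E C (\<lambda>x. v x + a * w x)) = inner_L2 \<Omega> u (E C v) + a * inner_L2 \<Omega> u (E C w)"
    if u: "u \<in> L2 \<Omega>" for u
  proof -
    have "inner_L2 \<Omega> u (E C (\<lambda>x. v x + a * w x)) = inner_L2 \<Omega> (E C u) (\<lambda>x. v x + a * w x)"
      by (intro E_adjoint C u L2_add assms aw)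
    also have "\<dots> = inner_L2 \<Omega> (E C u) v + a * inner_L2 \<Omega> (E C u) w"
      by (simp add: inner_L2_add_right inner_L2_scale_right E_L2 C u assms aw)
    finally show ?thesis using E_adjoint[OF C u] assms by simp
  qed
  have "inner_L2 \<Omega> (\<lambda>x. v x + a * w x) (E C (\<lambda>x. v x + a * w x))
      = inner_L2 \<Omega> v (E C (\<lambda>x. v x + a * w x)) + cnj a * inner_L2 \<Omega> w (E C (\<lambda>x. v x + a * w x))"
    by (simp add: inner_L2_add_left inner_L2_scale_left E_L2 C assms aw L2_add)
  then show ?thesis by (simp add: E assms algebra_simps)
qed

text \<open>Weighting the expansion for a = i^k by (-i)^k and summing over k kills every term except
  the one with \<open>v\<close> on the left and \<open>w\<close> on the right. Antilinearity of
  \<open>inner_L2\<close> in its left argument decides between i and -i.\<close>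

lemma spectral_measure_polarization:
  assumes "v \<in> L2 \<Omega>" "w \<in> L2 \<Omega>" and C: "C \<in> sets borel"
  shows "(\<Sum>k<4::nat. (- \<i>) ^ k * complex_of_real (measure (\<mu> (\<lambda>x. v x + \<i> ^ k * w x)) C))
    = 4 * inner_L2 \<Omega> v (E C w)"
proof -
  have "(\<lambda>x. v x + \<i> ^ k * w x) \<in> L2 \<Omega>" for k
    using assms by (simp add: L2_intros)
  then have "complex_of_real (measure (\<mu> (\<lambda>x. v x + \<i> ^ k * w x)) C)
    = inner_L2 \<Omega> v (E C v) + \<i> ^ k * inner_L2 \<Omega> v (E C w) + cnj (\<i> ^ k) * inner_L2 \<Omega> w (E C v)
      + (cnj (\<i> ^ k) * \<i> ^ k) * inner_L2 \<Omega> w (E C w)" for k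
    by (simp only: complex_of_real_measure_spectral_measure[OF _ C] inner_E_expand[OF assms])
  then show ?thesis
    by (simp add: lessThan_nat_numeral lessThan_Suc eval_nat_numeral algebra_simps)
qed

text \<open>The parallelogram law for the quadratic form of \<open>E C\<close>, with the summand for
  v - a w dropped.\<close>

lemma emeasure_spectral_measure_add_le:
  assumes v: "v \<in> L2 \<Omega>" and w: "w \<in> L2 \<Omega>" and C: "C \<in> sets borel" and a: "cmod a = 1"
  shows "emeasure (\<mu> (\<lambda>x. v x + a * w x)) C \<le> 2 * emeasure (\<mu> v) C + 2 * emeasure (\<mu> w) C"
proof -
  have L: "(\<lambda>x. v x + a * w x) \<in> L2 \<Omega>" "(\<lambda>x. v x + (- a) * w x) \<in> L2 \<Omega>"
    by (rule L2_add[OF v L2_scale[OF w]])+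
  have a': "cnj a * a = 1" using a complex_norm_square[of a] by (simp add: mult.commute)
  have "complex_of_real (measure (\<mu> (\<lambda>x. v x + a * w x)) C + measure (\<mu> (\<lambda>x. v x + (- a) * w x)) C)
      = complex_of_real (2 * measure (\<mu> v) C + 2 * measure (\<mu> w) C)"
    unfolding of_real_add of_real_mult complex_of_real_measure_spectral_measure[OF L(1) C]
      complex_of_real_measure_spectral_measure[OF L(2) C] inner_E_expand[OF v w C]
      complex_of_real_measure_spectral_measure[OF v C] complex_of_real_measure_spectral_measure[OF w C]
    by (simp add: a')
  then have "measure (\<mu> (\<lambda>x. v x + a * w x)) C + measure (\<mu> (\<lambda>x. v x + (- a) * w x)) C
      = 2 * measure (\<mu> v) C + 2 * measure (\<mu> w) C" by (simp only: of_real_eq_iff)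
  then have "measure (\<mu> (\<lambda>x. v x + a * w x)) C \<le> 2 * measure (\<mu> v) C + 2 * measure (\<mu> w) C"
    using measure_nonneg[of "\<mu> (\<lambda>x. v x + (- a) * w x)" C] by linarith
  then have "ennreal (measure (\<mu> (\<lambda>x. v x + a * w x)) C) \<le> ennreal (2 * measure (\<mu> v) C + 2 * measure (\<mu> w) C)"
    by (rule ennreal_leI)
  also have "\<dots> = 2 * ennreal (measure (\<mu> v) C) + 2 * ennreal (measure (\<mu> w) C)"
    by (simp add: ennreal_plus ennreal_mult)
  finally show ?thesis
    by (simp only: finite_measure.emeasure_eq_measure[OF finite_measure_spectral_measure[OF L(1)]]
        finite_measure.emeasure_eq_measure[OF finite_measure_spectral_measure[OF v]]
        finite_measure.emeasure_eq_measure[OF finite_measure_spectral_measure[OF w]])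
qed

lemma borel_measurable_spectral_measure:
  fixes H :: "real \<Rightarrow> 'b::topological_space"
  shows "H \<in> borel_measurable (\<mu> f) \<longleftrightarrow> H \<in> borel_measurable borel"
  by (rule iffD1[OF set_eq_iff, THEN spec]) (rule measurable_cong_sets[OF sets_spectral_measure refl])

lemma integrable_spectral_measure_dominated:
  fixes H :: "real \<Rightarrow> real"
  assumes H: "integrable (\<mu> v) H" "integrable (\<mu> w) H"
    and le: "\<And>C. C \<in> sets borel \<Longrightarrow> emeasure (\<mu> u) C \<le> 2 * emeasure (\<mu> v) C + 2 * emeasure (\<mu> w) C"
  shows "integrable (\<mu> u) H"
proof (rule integrableI_bounded)
  have H_meas: "H \<in> borel_measurable borel"
    using H(1) borel_measurable_spectral_measure by auto
  then show "H \<in> borel_measurable (\<mu> u)" by (simp add: borel_measurable_spectral_measure)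
  have "(\<integral>\<^sup>+s. ennreal (norm (H s)) \<partial>\<mu> u)
      \<le> 2 * (\<integral>\<^sup>+s. ennreal (norm (H s)) \<partial>\<mu> v) + 2 * (\<integral>\<^sup>+s. ennreal (norm (H s)) \<partial>\<mu> w)"
    using H_meas by (intro nn_integral_le_of_emeasure_le[where N=borel] le) auto
  also have "\<dots> < \<infinity>"
    using H by (simp add: integrable_iff_bounded ennreal_mult_less_top)
  finally show "(\<integral>\<^sup>+s. ennreal (norm (H s)) \<partial>\<mu> u) < \<infinity>" .
qed

lemma integrable_spectral_measure_add:
  fixes H :: "real \<Rightarrow> real"
  assumes "v \<in> L2 \<Omega>" "w \<in> L2 \<Omega>" "cmod a = 1" "integrable (\<mu> v) H" "integrable (\<mu> w) H"
  shows "integrable (\<mu> (\<lambda>x. v x + a * w x)) H"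
  by (rule integrable_spectral_measure_dominated[OF assms(4,5)])
    (rule emeasure_spectral_measure_add_le[OF assms(1,2) _ assms(3)])

text \<open>Projections multiply by intersecting their sets, so the spectral measure of
  \<open>E B f\<close> is that of \<open>f\<close> restricted to \<open>B\<close>. This makes
  spectral projections usable as cutoffs.\<close>

lemma measure_spectral_measure_E:
  assumes "f \<in> L2 \<Omega>" "B \<in> sets borel" "C \<in> sets borel"
  shows "measure (\<mu> (E B f)) C = measure (\<mu> f) (B \<inter> C)"
proof -
  have "inner_L2 \<Omega> (E B f) (E C (E B f)) = inner_L2 \<Omega> f (E B (E C (E B f)))"
    by (rule E_adjoint[symmetric]) (auto intro!: E_L2 assms)
  also have "\<dots> = inner_L2 \<Omega> f (E (B \<inter> C) (E B f))"
    by (rule E_Int) (auto intro!: E_L2 assms)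
  also have "\<dots> = inner_L2 \<Omega> f (E (B \<inter> C \<inter> B) f)"
    by (rule E_Int) (auto intro!: E_L2 assms)
  also have "B \<inter> C \<inter> B = B \<inter> C" by blast
  finally have "complex_of_real (measure (\<mu> (E B f)) C) = complex_of_real (measure (\<mu> f) (B \<inter> C))"
    using assms by (subst (1 2) complex_of_real_measure_spectral_measure) (auto intro!: E_L2)
  then show ?thesis by (simp only: of_real_eq_iff)
qed

lemma integrable_spectral_measure_E:
  fixes H :: "real \<Rightarrow> real"
  assumes f: "f \<in> L2 \<Omega>" and B: "B \<in> sets borel" and H: "integrable (\<mu> f) H"
  shows "integrable (\<mu> (E B f)) H"
proof (rule integrable_spectral_measure_dominated[OF H H])
  fix C :: "real set" assume C: "C \<in> sets borel"
  interpret finite_measure "\<mu> f" by (rule finite_measure_spectral_measure[OF f])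
  interpret B: finite_measure "\<mu> (E B f)" by (rule finite_measure_spectral_measure[OF E_L2[OF B f]])
  have "measure (\<mu> f) (B \<inter> C) \<le> measure (\<mu> f) C" using C by (intro finite_measure_mono) auto
  then have "emeasure (\<mu> (E B f)) C \<le> emeasure (\<mu> f) C"
    by (simp add: emeasure_eq_measure B.emeasure_eq_measure measure_spectral_measure_E[OF f B C])
  also have "\<dots> \<le> 2 * emeasure (\<mu> f) C + 2 * emeasure (\<mu> f) C"
    by (simp add: emeasure_eq_measure flip: ennreal_mult' ennreal_plus ennreal_numeral)
  finally show "emeasure (\<mu> (E B f)) C \<le> 2 * emeasure (\<mu> f) C + 2 * emeasure (\<mu> f) C" .
qed

section \<open>Evaluating the weakly defined functional calculus\<close>

lemma integrable_of_square:
  fixes F :: "real \<Rightarrow> real"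
  assumes f: "f \<in> L2 \<Omega>" and F: "F \<in> borel_measurable borel" and int: "integrable (\<mu> f) (\<lambda>s. (F s)\<^sup>2)"
  shows "integrable (\<mu> f) F"
proof (rule Bochner_Integration.integrable_bound)
  interpret finite_measure "\<mu> f" by (rule finite_measure_spectral_measure[OF f])
  show "integrable (\<mu> f) (\<lambda>s. 1 + (F s)\<^sup>2)" using int by simp
  show "F \<in> borel_measurable (\<mu> f)" using F by (simp add: borel_measurable_spectral_measure)
  have "\<bar>y\<bar> \<le> 1 + y\<^sup>2" for y :: real
    using sum_squares_bound[of 1 "\<bar>y\<bar>"] by simp
  then show "AE s in \<mu> f. norm (F s) \<le> norm (1 + (F s)\<^sup>2)" by simp
qed

text \<open>As soon as the complex measure sending \<open>C\<close> to
  \<open>inner_L2 \<Omega> v (E C w)\<close> has a density with respect to one spectral measure, the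
  four polarized integrals collapse to a single integral that can be estimated.\<close>

lemma spectral_integral_eqI:
  fixes F G :: "real \<Rightarrow> real"
  assumes v: "v \<in> L2 \<Omega>" and w: "w \<in> L2 \<Omega>" and F: "F \<in> borel_measurable borel"
    and int_F: "integrable (\<mu> v) F" "integrable (\<mu> w) F"
    and G: "integrable (\<mu> u) G" "integrable (\<mu> u) (\<lambda>s. G s * F s)"
    and eq: "\<And>C. C \<in> sets borel \<Longrightarrow> inner_L2 \<Omega> v (E C w) = complex_of_real (LINT s|\<mu> u. G s * indicator C s)"
  shows "spectral_integral \<Omega> E F v w = complex_of_real (LINT s|\<mu> u. G s * F s)"
proof -
  have L: "(\<lambda>x. v x + \<i> ^ k * w x) \<in> L2 \<Omega>" for k
    using v w by (simp add: L2_intros)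
  have "(\<Sum>k<4::nat. ((- \<i>) ^ k / 4) * complex_of_real (LINT s|\<mu> (\<lambda>x. v x + \<i> ^ k * w x). F s))
      = complex_of_real (LINT s|\<mu> u. G s * F s)"
  proof (rule sum_integral_eq_density_integral[where N=borel])
    fix C :: "real set" assume C: "C \<in> sets borel"
    show "(\<Sum>k<4::nat. ((- \<i>) ^ k / 4) * complex_of_real (measure (\<mu> (\<lambda>x. v x + \<i> ^ k * w x)) C))
        = complex_of_real (LINT s|\<mu> u. G s * indicator C s)"
      using spectral_measure_polarization[OF v w C] eq[OF C]
      by (simp add: sum_divide_distrib[symmetric])
  next
    fix k :: nat
    show "integrable (\<mu> (\<lambda>x. v x + \<i> ^ k * w x)) F"
      by (rule integrable_spectral_measure_add[OF v w _ int_F]) (simp add: norm_power)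
  qed (use G F in \<open>auto intro: finite_measure_spectral_measure[OF L]\<close>)
  then show ?thesis by (simp add: spectral_integral_def sum_divide_distrib)
qed

lemma fun_calcD:
  assumes "fun_calc \<Omega> E F w g"
  shows "w \<in> L2 \<Omega>" "g \<in> L2 \<Omega>" "integrable (\<mu> w) (\<lambda>s. (F s)\<^sup>2)"
    and "\<And>v. v \<in> L2 \<Omega> \<Longrightarrow> integrable (\<mu> v) (\<lambda>s. (F s)\<^sup>2) \<Longrightarrow> inner_L2 \<Omega> v g = spectral_integral \<Omega> E F v w"
  using assms by (auto simp: fun_calc_def spectral_domain_def)

text \<open>Testing \<open>g\<close> against \<open>E B w\<close> stays within the domain, because
  the cutoff only shrinks the spectral measure; the resulting complex measure has density
  \<open>indicator B\<close> with respect to the spectral measure of \<open>w\<close>.\<close>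

lemma fun_calc_inner_E:
  assumes fc: "fun_calc \<Omega> E F w g" and F: "F \<in> borel_measurable borel" and B: "B \<in> sets borel"
  shows "inner_L2 \<Omega> w (E B g) = complex_of_real (LINT s|\<mu> w. indicator B s * F s)"
proof -
  note w = fun_calcD(1)[OF fc] and g = fun_calcD(2)[OF fc] and F2 = fun_calcD(3)[OF fc]
  interpret finite_measure "\<mu> w" by (rule finite_measure_spectral_measure[OF w])
  have F_w: "integrable (\<mu> w) F" by (rule integrable_of_square[OF w F F2])
  have "inner_L2 \<Omega> w (E B g) = inner_L2 \<Omega> (E B w) g" by (rule E_adjoint[OF B w g])
  also have "\<dots> = spectral_integral \<Omega> E F (E B w) w"
    by (intro fun_calcD(4)[OF fc] E_L2 B w integrable_spectral_measure_E F2)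
  also have "\<dots> = complex_of_real (LINT s|\<mu> w. indicator B s * F s)"
  proof (rule spectral_integral_eqI[OF E_L2[OF B w] w F integrable_spectral_measure_E[OF w B F_w] F_w])
    show "integrable (\<mu> w) (indicator B :: real \<Rightarrow> real)"
      using B by (intro integrable_real_indicator) (auto simp: emeasure_eq_measure)
    show "integrable (\<mu> w) (\<lambda>s. indicator B s * F s)"
      using integrable_mult_indicator[OF _ F_w, of B] B by simp
    fix C :: "real set" assume C: "C \<in> sets borel"
    have "inner_L2 \<Omega> (E B w) (E C w) = inner_L2 \<Omega> w (E B (E C w))"
      by (rule E_adjoint[symmetric]) (auto intro!: E_L2 B C w)
    also have "\<dots> = inner_L2 \<Omega> w (E (B \<inter> C) w)"
      by (rule E_Int[OF B C w w])
    also have "\<dots> = complex_of_real (measure (\<mu> w) (B \<inter> C))"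
      using B C w by (subst complex_of_real_measure_spectral_measure) auto
    also have "measure (\<mu> w) (B \<inter> C) = (LINT s|\<mu> w. indicator (B \<inter> C) s)"
      by simp
    finally show "inner_L2 \<Omega> (E B w) (E C w) = complex_of_real (LINT s|\<mu> w. indicator B s * indicator C s)"
      by (simp add: indicator_inter_arith)
  qed
  finally show ?thesis .
qed

lemma fun_calc_inner:
  assumes "fun_calc \<Omega> E F w g" "F \<in> borel_measurable borel"
  shows "inner_L2 \<Omega> w g = complex_of_real (LINT s|\<mu> w. F s)"
  using fun_calc_inner_E[OF assms, of UNIV] E_UNIV[OF fun_calcD(1,2)[OF assms(1)]] by simp

text \<open>\<open>g\<close> need not lie in the domain of F(T), so it cannot be tested against
  itself. Its cutoff to the set where |F| <= M does lie there and gives the identity on that set,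
  the density being F times the indicator; then M tends to infinity.\<close>

lemma fun_calc_norm:
  assumes fc: "fun_calc \<Omega> E F w g" and F[measurable]: "F \<in> borel_measurable borel"
  shows "(norm_L2 \<Omega> g)\<^sup>2 = (LINT s|\<mu> w. (F s)\<^sup>2)"
proof -
  note w = fun_calcD(1)[OF fc] and g = fun_calcD(2)[OF fc] and F2 = fun_calcD(3)[OF fc]
  interpret w: finite_measure "\<mu> w" by (rule finite_measure_spectral_measure[OF w])
  interpret g: finite_measure "\<mu> g" by (rule finite_measure_spectral_measure[OF g])
  have F_w: "integrable (\<mu> w) F" by (rule integrable_of_square[OF w F F2])
  define A where "A M = {s. \<bar>F s\<bar> \<le> real M}" for M
  have A[measurable]: "A M \<in> sets borel" for M
  proof -
    have "A M = {s \<in> space borel. \<bar>F s\<bar> \<le> real M}" by (simp add: A_def)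
    then show ?thesis by simp
  qed
  have truncated: "measure (\<mu> g) (A M) = (LINT s|\<mu> w. (F s)\<^sup>2 * indicator (A M) s)" for M
  proof -
    let ?v = "E (A M) g"
    have v: "?v \<in> L2 \<Omega>" by (rule E_L2[OF A g])
    interpret v: finite_measure "\<mu> ?v" by (rule finite_measure_spectral_measure[OF v])
    have AE_v: "AE s in \<mu> ?v. \<bar>F s\<bar> \<le> real M"
    proof (rule AE_I)
      show "- A M \<in> sets (\<mu> ?v)" using A[of M] by (simp add: borel_comp)
      have "measure (\<mu> ?v) (- A M) = measure (\<mu> g) (A M \<inter> - A M)"
        using A[of M] by (intro measure_spectral_measure_E[OF g]) (simp_all add: borel_comp)
      then show "emeasure (\<mu> ?v) (- A M) = 0" by (simp add: v.emeasure_eq_measure)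
    qed (auto simp: A_def)
    have F2_v: "integrable (\<mu> ?v) (\<lambda>s. (F s)\<^sup>2)"
    proof (rule v.integrable_const_bound[where B="(real M)\<^sup>2"])
      show "AE s in \<mu> ?v. norm ((F s)\<^sup>2) \<le> (real M)\<^sup>2"
        using AE_v by eventually_elim (simp add: abs_le_square_iff[symmetric])
    qed simp
    have "inner_L2 \<Omega> ?v g = spectral_integral \<Omega> E F ?v w"
      by (rule fun_calcD(4)[OF fc v F2_v])
    also have "\<dots> = complex_of_real (LINT s|\<mu> w. (F s * indicator (A M) s) * F s)"
    proof (rule spectral_integral_eqI[OF v w F integrable_of_square[OF v F F2_v] F_w])
      show "integrable (\<mu> w) (\<lambda>s. F s * indicator (A M) s)"
        using integrable_mult_indicator[OF _ F_w, of "A M"] A[of M] by (simp add: mult.commute)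
      show "integrable (\<mu> w) (\<lambda>s. F s * indicator (A M) s * F s)"
        using integrable_mult_indicator[OF _ F2, of "A M"] A[of M]
        by (simp add: mult.commute mult.left_commute power2_eq_square)
      fix C :: "real set" assume C[measurable]: "C \<in> sets borel"
      have CA: "C \<inter> A M \<in> sets borel" by simp
      \<comment> \<open>Computed with the factors exchanged, where \<open>fun_calc_inner_E\<close>
        applies; the value is real, hence equal to its conjugate.\<close>
      have "inner_L2 \<Omega> (E C w) ?v = inner_L2 \<Omega> w (E C ?v)"
        by (rule E_adjoint[symmetric, OF C w v])
      also have "\<dots> = inner_L2 \<Omega> w (E (C \<inter> A M) g)"
        by (rule E_Int[OF C A w g])
      also have "\<dots> = complex_of_real (LINT s|\<mu> w. indicator (C \<inter> A M) s * F s)"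
        by (rule fun_calc_inner_E[OF fc F CA])
      also have "(LINT s|\<mu> w. indicator (C \<inter> A M) s * F s) = (LINT s|\<mu> w. F s * indicator (A M) s * indicator C s)"
        by (simp add: indicator_inter_arith mult.commute mult.left_commute)
      finally show "inner_L2 \<Omega> ?v (E C w) = complex_of_real (LINT s|\<mu> w. F s * indicator (A M) s * indicator C s)"
        by (subst inner_L2_commute) simp
    qed
    also have "(LINT s|\<mu> w. (F s * indicator (A M) s) * F s) = (LINT s|\<mu> w. (F s)\<^sup>2 * indicator (A M) s)"
      by (simp add: mult.commute mult.left_commute power2_eq_square)
    finally have "inner_L2 \<Omega> ?v g = complex_of_real (LINT s|\<mu> w. (F s)\<^sup>2 * indicator (A M) s)" .
    moreover have "inner_L2 \<Omega> ?v g = complex_of_real (measure (\<mu> g) (A M))"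
      using E_adjoint[OF A g g] complex_of_real_measure_spectral_measure[OF g A] by simp
    ultimately show ?thesis by (simp only: of_real_eq_iff)
  qed
  have UN_A: "(\<Union>M. A M) = UNIV"
    using real_arch_simple by (auto simp: A_def)
  have "incseq A" by (auto simp: incseq_def A_def)
  then have "(\<lambda>M. measure (\<mu> g) (A M)) \<longlonglongrightarrow> measure (\<mu> g) (\<Union>M. A M)"
    using A by (intro g.finite_Lim_measure_incseq) auto
  moreover have "(\<lambda>M. LINT s|\<mu> w. (F s)\<^sup>2 * indicator (A M) s) \<longlonglongrightarrow> (LINT s|\<mu> w. (F s)\<^sup>2)"
  proof (rule integral_dominated_convergence[where w="\<lambda>s. (F s)\<^sup>2"])
    show "AE s in \<mu> w. (\<lambda>M. (F s)\<^sup>2 * indicator (A M) s) \<longlonglongrightarrow> (F s)\<^sup>2"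
    proof (rule AE_I2)
      fix s
      obtain M0 where "\<bar>F s\<bar> \<le> real M0" using real_arch_simple by blast
      then have "eventually (\<lambda>M. (F s)\<^sup>2 * indicator (A M) s = (F s)\<^sup>2) sequentially"
        by (auto simp: eventually_sequentially A_def intro!: exI[of _ M0])
      then show "(\<lambda>M. (F s)\<^sup>2 * indicator (A M) s) \<longlonglongrightarrow> (F s)\<^sup>2" by (rule tendsto_eventually)
    qed
    show "AE s in \<mu> w. norm ((F s)\<^sup>2 * indicator (A M) s) \<le> (F s)\<^sup>2" for M
      by (intro AE_I2) (simp add: indicator_def)
  qed (use F2 in simp_all)
  ultimately have "measure (\<mu> g) UNIV = (LINT s|\<mu> w. (F s)\<^sup>2)"
    unfolding truncated UN_A by (rule LIMSEQ_unique)
  then show ?thesis by (simp only: measure_spectral_measure_UNIV[OF g])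
qed

text \<open>The norm of \<open>g\<close> and its pairing with \<open>w\<close> are integrals against
  the same spectral measure, so the expanded square recombines. With \<open>a\<close> a value of
  \<open>F\<close>, this measures how far \<open>w\<close> is from being an eigenvector.\<close>

lemma fun_calc_norm_diff:
  assumes fc: "fun_calc \<Omega> E F w g" and F: "F \<in> borel_measurable borel"
  shows "integrable (\<mu> w) (\<lambda>s. (F s - a)\<^sup>2)"
    and "(norm_L2 \<Omega> (\<lambda>x. g x - complex_of_real a * w x))\<^sup>2 = (LINT s|\<mu> w. (F s - a)\<^sup>2)"
proof -
  note w = fun_calcD(1)[OF fc] and g = fun_calcD(2)[OF fc] and F2 = fun_calcD(3)[OF fc]
  interpret w: finite_measure "\<mu> w" by (rule finite_measure_spectral_measure[OF w])
  have F_w: "integrable (\<mu> w) F" by (rule integrable_of_square[OF w F F2])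
  have eq: "(F s - a)\<^sup>2 = (F s)\<^sup>2 - 2 * a * F s + a\<^sup>2" for s
    by (simp add: power2_diff)
  show "integrable (\<mu> w) (\<lambda>s. (F s - a)\<^sup>2)"
    unfolding eq using F2 F_w by simp
  have "(LINT s|\<mu> w. (F s - a)\<^sup>2) = (LINT s|\<mu> w. (F s)\<^sup>2) - 2 * a * (LINT s|\<mu> w. F s) + a\<^sup>2 * measure (\<mu> w) UNIV"
    unfolding eq using F2 F_w by simp
  also have "\<dots> = (norm_L2 \<Omega> g)\<^sup>2 - 2 * a * Re (inner_L2 \<Omega> w g) + a\<^sup>2 * (norm_L2 \<Omega> w)\<^sup>2"
    by (simp add: fun_calc_norm[OF fc F] fun_calc_inner[OF fc F] measure_spectral_measure_UNIV[OF w])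
  also have "\<dots> = (norm_L2 \<Omega> (\<lambda>x. g x - complex_of_real a * w x))\<^sup>2"
    using inner_L2_commute[of \<Omega> g w]
    by (simp add: norm_L2_diff_sq g L2_scale[OF w] inner_L2_scale_right norm_L2_scale power_mult_distrib)
  finally show "(norm_L2 \<Omega> (\<lambda>x. g x - complex_of_real a * w x))\<^sup>2 = (LINT s|\<mu> w. (F s - a)\<^sup>2)" by simp
qed

lemma spectral_measure_scale:
  assumes f: "f \<in> L2 \<Omega>" and a: "cmod a = 1"
  shows "\<mu> (\<lambda>x. a * f x) = \<mu> f"
proof (rule measure_eqI)
  fix B assume "B \<in> sets (\<mu> (\<lambda>x. a * f x))"
  then have B: "B \<in> sets borel" by simp
  have af: "(\<lambda>x. a * f x) \<in> L2 \<Omega>" by (rule L2_scale[OF f])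
  have a': "cnj a * a = 1" using a complex_norm_square[of a] by (simp add: mult.commute)
  have "inner_L2 \<Omega> (\<lambda>x. a * f x) (E B (\<lambda>x. a * f x)) = cnj a * inner_L2 \<Omega> (E B f) (\<lambda>x. a * f x)"
    by (simp only: inner_L2_scale_left E_adjoint[OF B f af])
  also have "\<dots> = (cnj a * a) * inner_L2 \<Omega> f (E B f)"
    by (simp only: inner_L2_scale_right E_adjoint[OF B f f] mult.assoc)
  finally have "complex_of_real (measure (\<mu> (\<lambda>x. a * f x)) B) = complex_of_real (measure (\<mu> f) B)"
    by (simp only: complex_of_real_measure_spectral_measure[OF af B] complex_of_real_measure_spectral_measure[OF f B] a' mult_1)
  then show "emeasure (\<mu> (\<lambda>x. a * f x)) B = emeasure (\<mu> f) B"
    by (simp only: of_real_eq_iff finite_measure.emeasure_eq_measure[OF finite_measure_spectral_measure[OF af]]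
        finite_measure.emeasure_eq_measure[OF finite_measure_spectral_measure[OF f]])
qed simp

text \<open>Since w + a v = a (v + cnj a w) for |a| = 1 and phases do not affect spectral measures,
  exchanging \<open>v\<close> and \<open>w\<close> replaces i^k by its conjugate, so the four real
  integrals are merely permuted.\<close>

lemma spectral_integral_commute:
  assumes v: "v \<in> L2 \<Omega>" and w: "w \<in> L2 \<Omega>"
  shows "spectral_integral \<Omega> E F w v = cnj (spectral_integral \<Omega> E F v w)"
proof -
  have eq: "\<mu> (\<lambda>x. w x + a * v x) = \<mu> (\<lambda>x. v x + cnj a * w x)" if a: "cmod a = 1" for a
  proof -
    have "cnj a * a = 1" using a complex_norm_square[of a] by (simp add: mult.commute)
    then have "a * (v x + cnj a * w x) = w x + a * v x" for x
      by (simp add: algebra_simps)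
    moreover have "(\<lambda>x. v x + cnj a * w x) \<in> L2 \<Omega>" by (intro L2_add L2_scale v w)
    ultimately show ?thesis using spectral_measure_scale[of "\<lambda>x. v x + cnj a * w x" a] a by simp
  qed
  have "\<mu> (\<lambda>x. w x + v x) = \<mu> (\<lambda>x. v x + w x)" "\<mu> (\<lambda>x. w x + \<i> * v x) = \<mu> (\<lambda>x. v x - \<i> * w x)"
    "\<mu> (\<lambda>x. w x - v x) = \<mu> (\<lambda>x. v x - w x)" "\<mu> (\<lambda>x. w x - \<i> * v x) = \<mu> (\<lambda>x. v x + \<i> * w x)"
    using eq[of 1] eq[of \<i>] eq[of "-1"] eq[of "-\<i>"] by simp_all
  then show ?thesis
    by (simp add: spectral_integral_def lessThan_nat_numeral lessThan_Suc eval_nat_numeral)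
qed

end

section \<open>Conjugation and Lipschitz functions of an operator\<close>

context spectral_family begin

lemma inner_E_E:
  assumes f: "f \<in> L2 \<Omega>" and A: "A \<in> sets borel" and B: "B \<in> sets borel"
  shows "inner_L2 \<Omega> (E A f) (E B f) = complex_of_real (measure (\<mu> f) (A \<inter> B))"
proof -
  have "inner_L2 \<Omega> (E A f) (E B f) = inner_L2 \<Omega> f (E A (E B f))"
    by (rule E_adjoint[symmetric]) (auto intro!: E_L2 A B f)
  also have "\<dots> = inner_L2 \<Omega> f (E (A \<inter> B) f)" by (rule E_Int[OF A B f f])
  finally show ?thesis using A B f by (simp add: complex_of_real_measure_spectral_measure)
qed

text \<open>All inner products among the three projections are masses of intersections, so the
  squared norm of the defect cancels. This supplies additivity of \<open>E\<close> in its set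
  argument, which is given only for the diagonal quadratic form.\<close>

lemma norm_E_split:
  assumes f: "f \<in> L2 \<Omega>" and A: "A \<in> sets borel" and B: "B \<in> sets borel" and disj: "A \<inter> B = {}"
  shows "norm_L2 \<Omega> (\<lambda>x. E (A \<union> B) f x - E A f x - E B f x) = 0"
    and "(norm_L2 \<Omega> (E (A \<union> B) f))\<^sup>2 = (norm_L2 \<Omega> (E A f))\<^sup>2 + (norm_L2 \<Omega> (E B f))\<^sup>2"
proof -
  let ?C = "A \<union> B"
  have C: "?C \<in> sets borel" using A B by simp
  interpret finite_measure "\<mu> f" by (rule finite_measure_spectral_measure[OF f])
  note L = E_L2[OF A f] E_L2[OF B f] E_L2[OF C f]
  have m: "measure (\<mu> f) ?C = measure (\<mu> f) A + measure (\<mu> f) B"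
    using A B disj by (intro finite_measure_Union) auto
  have *: "?C \<inter> A = A" "?C \<inter> B = B" by auto
  have "(norm_L2 \<Omega> (\<lambda>x. E ?C f x - E A f x))\<^sup>2 = measure (\<mu> f) B"
    by (simp add: norm_L2_diff_sq L inner_E_E f A B C * m measure_spectral_measure[symmetric] del: Int_Un_distrib2)
  then have "(norm_L2 \<Omega> (\<lambda>x. E ?C f x - E A f x - E B f x))\<^sup>2 = 0"
    by (simp add: norm_L2_diff_sq[OF L2_diff] inner_L2_diff_left L inner_E_E f A B C * disj
        measure_spectral_measure[symmetric])
  then show "norm_L2 \<Omega> (\<lambda>x. E ?C f x - E A f x - E B f x) = 0" by simp
  show "(norm_L2 \<Omega> (E ?C f))\<^sup>2 = (norm_L2 \<Omega> (E A f))\<^sup>2 + (norm_L2 \<Omega> (E B f))\<^sup>2"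
    using m by (simp add: measure_spectral_measure f A B C)
qed

lemma AE_spectral_measure_E:
  assumes f: "f \<in> L2 \<Omega>" and A: "A \<in> sets borel"
  shows "AE s in \<mu> (E A f). s \<in> A"
proof (rule AE_I)
  show "- A \<in> sets (\<mu> (E A f))" using A by (simp add: borel_comp)
  have "measure (\<mu> (E A f)) (- A) = measure (\<mu> f) (A \<inter> - A)"
    using A by (intro measure_spectral_measure_E f) (simp_all add: borel_comp)
  then show "emeasure (\<mu> (E A f)) (- A) = 0"
    by (simp add: finite_measure.emeasure_eq_measure[OF finite_measure_spectral_measure[OF E_L2[OF A f]]])
qed auto

end

section \<open>Contractions that are bounded real functions of an operator\<close>

locale spectral_contraction = spectral_family \<Omega> E
  for \<Omega> :: "(real^'d) set" and E +
  fixes F :: "real \<Rightarrow> real" and P :: "((real^'d) \<Rightarrow> complex) \<Rightarrow> (real^'d) \<Rightarrow> complex"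
  assumes F_borel[measurable]: "F \<in> borel_measurable borel"
    and F_bound: "\<And>s. \<bar>F s\<bar> \<le> 1"
    and fun_calc_P: "\<And>w. w \<in> L2 \<Omega> \<Longrightarrow> fun_calc \<Omega> E F w (P w)"
begin

lemma P_L2: "w \<in> L2 \<Omega> \<Longrightarrow> P w \<in> L2 \<Omega>"
  using fun_calcD(2)[OF fun_calc_P] .

lemma F_square_le: "(F s)\<^sup>2 \<le> 1"
  using F_bound[of s] by (simp add: abs_square_le_1)

text \<open>\<open>F\<close> is bounded and the spectral measures are finite, so every square
  integrable function is an admissible test function in the weak formula.\<close>

lemma P_inner:
  assumes v: "v \<in> L2 \<Omega>" and w: "w \<in> L2 \<Omega>"
  shows "inner_L2 \<Omega> v (P w) = spectral_integral \<Omega> E F v w"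
proof (rule fun_calcD(4)[OF fun_calc_P[OF w] v])
  interpret finite_measure "\<mu> v" by (rule finite_measure_spectral_measure[OF v])
  show "integrable (\<mu> v) (\<lambda>s. (F s)\<^sup>2)"
    by (rule integrable_const_bound[where B=1]) (simp_all add: F_square_le)
qed

lemma P_selfadjoint:
  assumes v: "v \<in> L2 \<Omega>" and w: "w \<in> L2 \<Omega>"
  shows "inner_L2 \<Omega> v (P w) = inner_L2 \<Omega> (P v) w"
  using inner_L2_commute[of \<Omega> "P v" w] P_inner[OF v w] P_inner[OF w v]
    spectral_integral_commute[OF v w] by simp

lemma norm_P_le:
  assumes w: "w \<in> L2 \<Omega>"
  shows "norm_L2 \<Omega> (P w) \<le> norm_L2 \<Omega> w"
proof (rule power2_le_imp_le)
  interpret finite_measure "\<mu> w" by (rule finite_measure_spectral_measure[OF w])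
  have "(norm_L2 \<Omega> (P w))\<^sup>2 = (LINT s|\<mu> w. (F s)\<^sup>2)"
    by (rule fun_calc_norm[OF fun_calc_P[OF w] F_borel])
  also have "\<dots> \<le> (LINT s|\<mu> w. 1)"
    using fun_calcD(3)[OF fun_calc_P[OF w]] F_square_le by (intro integral_mono) auto
  also have "\<dots> = (norm_L2 \<Omega> w)\<^sup>2"
    using measure_spectral_measure_UNIV[OF w] by simp
  finally show "(norm_L2 \<Omega> (P w))\<^sup>2 \<le> (norm_L2 \<Omega> w)\<^sup>2" .
qed simp

text \<open>\<open>P\<close> is determined only up to null sets, so it is additive only in this sense.\<close>

lemma P_diff_diff:
  assumes f: "f \<in> L2 \<Omega>" and g: "g \<in> L2 \<Omega>" and h: "h \<in> L2 \<Omega>"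
  shows "norm_L2 \<Omega> (\<lambda>x. P h x - P f x - P g x) \<le> norm_L2 \<Omega> (\<lambda>x. h x - f x - g x)"
proof -
  define d where "d = (\<lambda>x. P h x - P f x - P g x)"
  define r where "r = (\<lambda>x. h x - f x - g x)"
  have d: "d \<in> L2 \<Omega>" and r: "r \<in> L2 \<Omega>"
    unfolding d_def r_def by (intro L2_diff P_L2 f g h)+
  \<comment> \<open>Moving \<open>P\<close> off each of its three arguments collects them into
    \<open>r\<close> without any linearity of \<open>P\<close>; Cauchy-Schwarz and contractivity
    then finish.\<close>
  have "inner_L2 \<Omega> d d = inner_L2 \<Omega> d (P h) - inner_L2 \<Omega> d (P f) - inner_L2 \<Omega> d (P g)"
    by (subst (2) d_def) (simp add: inner_L2_diff_right d L2_diff P_L2 f g h)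
  also have "\<dots> = inner_L2 \<Omega> (P d) h - inner_L2 \<Omega> (P d) f - inner_L2 \<Omega> (P d) g"
    by (simp add: P_selfadjoint d f g h)
  also have "\<dots> = inner_L2 \<Omega> (P d) r"
    by (simp add: r_def inner_L2_diff_right d L2_diff P_L2 f g h)
  finally have "(norm_L2 \<Omega> d)\<^sup>2 = cmod (inner_L2 \<Omega> (P d) r)"
    unfolding inner_L2_self by (metis abs_of_nonneg norm_of_real zero_le_power2)
  also have "\<dots> \<le> norm_L2 \<Omega> (P d) * norm_L2 \<Omega> r"
    by (rule norm_L2_cauchy_schwarz[OF P_L2[OF d] r])
  also have "\<dots> \<le> norm_L2 \<Omega> d * norm_L2 \<Omega> r"
    by (intro mult_right_mono norm_P_le d) simp
  finally have "norm_L2 \<Omega> d * norm_L2 \<Omega> d \<le> norm_L2 \<Omega> d * norm_L2 \<Omega> r"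
    by (simp add: power2_eq_square)
  then have "norm_L2 \<Omega> d \<le> norm_L2 \<Omega> r"
    using norm_L2_nonneg[of \<Omega> d] norm_L2_nonneg[of \<Omega> r] by (cases "norm_L2 \<Omega> d = 0") auto
  then show ?thesis by (simp add: d_def r_def)
qed

lemma P_funpow_L2: "w \<in> L2 \<Omega> \<Longrightarrow> (P ^^ i) w \<in> L2 \<Omega>"
  by (induction i) (auto intro: P_L2)

lemma inner_P_funpow:
  assumes "v \<in> L2 \<Omega>" and w: "w \<in> L2 \<Omega>"
  shows "inner_L2 \<Omega> v ((P ^^ i) w) = inner_L2 \<Omega> ((P ^^ i) v) w"
  using assms(1)
proof (induction i arbitrary: v)
  case (Suc i)
  have "inner_L2 \<Omega> v ((P ^^ Suc i) w) = inner_L2 \<Omega> (P v) ((P ^^ i) w)"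
    using P_selfadjoint[OF Suc.prems P_funpow_L2[OF w, of i]] by simp
  also have "\<dots> = inner_L2 \<Omega> ((P ^^ i) (P v)) w" by (rule Suc.IH[OF P_L2[OF Suc.prems]])
  finally show ?case by (simp add: funpow_swap1)
qed simp

end

section \<open>The commutator with complex conjugation\<close>

locale conjugation_invariant = spectral_contraction \<Omega> E F P
  for \<Omega> :: "(real^'d) set" and E F P +
  fixes T :: "((real^'d) \<Rightarrow> complex) \<Rightarrow> ((real^'d) \<Rightarrow> complex) \<Rightarrow> bool" and K :: real
  assumes T_resolution: "spectral_resolution \<Omega> T E"
    and T_cnj: "\<And>w g. T w g \<Longrightarrow> T (\<lambda>x. cnj (w x)) (\<lambda>x. cnj (g x))"
    and F_lipschitz: "\<And>s t. \<bar>F s - F t\<bar> \<le> K * \<bar>s - t\<bar>"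
begin

definition commutator :: "((real^'d) \<Rightarrow> complex) \<Rightarrow> (real^'d) \<Rightarrow> complex" where
  "commutator f = (\<lambda>x. P (\<lambda>x. cnj (f x)) x - cnj (P f x))"

lemma commutator_L2: "f \<in> L2 \<Omega> \<Longrightarrow> commutator f \<in> L2 \<Omega>"
  by (simp add: commutator_def L2_diff L2_cnj P_L2)

lemma K_nonneg: "0 \<le> K"
  using F_lipschitz[of 0 1] by simp

text \<open>\<open>P\<close> meets the defect h - f - g twice, once conjugated and once not;
  \<open>P_diff_diff\<close> bounds each loss, whence the factor 2.\<close>

lemma norm_commutator_le:
  assumes f: "f \<in> L2 \<Omega>" and g: "g \<in> L2 \<Omega>" and h: "h \<in> L2 \<Omega>"
  shows "norm_L2 \<Omega> (commutator h) \<le> norm_L2 \<Omega> (commutator f) + norm_L2 \<Omega> (commutator g)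
    + 2 * norm_L2 \<Omega> (\<lambda>x. h x - f x - g x)"
proof -
  let ?p = "\<lambda>x. P (\<lambda>x. cnj (h x)) x - P (\<lambda>x. cnj (f x)) x - P (\<lambda>x. cnj (g x)) x"
  let ?q = "\<lambda>x. P h x - P f x - P g x"
  have L: "?p \<in> L2 \<Omega>" "?q \<in> L2 \<Omega>"
    by (intro L2_diff P_L2 L2_cnj f g h)+
  have "norm_L2 \<Omega> ?p \<le> norm_L2 \<Omega> (\<lambda>x. cnj (h x) - cnj (f x) - cnj (g x))"
    by (intro P_diff_diff L2_cnj f g h)
  then have p: "norm_L2 \<Omega> ?p \<le> norm_L2 \<Omega> (\<lambda>x. h x - f x - g x)"
    using norm_L2_cnj[of \<Omega> "\<lambda>x. h x - f x - g x"] by simp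
  have q: "norm_L2 \<Omega> (\<lambda>x. cnj (?q x)) \<le> norm_L2 \<Omega> (\<lambda>x. h x - f x - g x)"
    unfolding norm_L2_cnj by (intro P_diff_diff f g h)
  have "commutator h = (\<lambda>x. (commutator f x + commutator g x) + (?p x - cnj (?q x)))"
    by (simp add: commutator_def)
  then have "norm_L2 \<Omega> (commutator h)
      \<le> norm_L2 \<Omega> (\<lambda>x. commutator f x + commutator g x) + norm_L2 \<Omega> (\<lambda>x. ?p x - cnj (?q x))"
    using norm_L2_triangle[OF L2_add[OF commutator_L2[OF f] commutator_L2[OF g]] L2_diff[OF L(1) L2_cnj[OF L(2)]]]
    by simp
  also have "\<dots> \<le> (norm_L2 \<Omega> (commutator f) + norm_L2 \<Omega> (commutator g)) + (norm_L2 \<Omega> ?p + norm_L2 \<Omega> (\<lambda>x. cnj (?q x)))"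
    by (intro add_mono norm_L2_triangle norm_L2_diff_triangle commutator_L2 f g L L2_cnj)
  finally show ?thesis using p q by linarith
qed

text \<open>The interval bounds the integral of (s - a)^2 for \<open>h\<close>. As the operator is
  real, \<open>h'\<close> has the same integral, although its spectral measure may charge points
  outside the interval. The Lipschitz condition converts both into estimates against the eigenvalue
  F a, and \<open>h\<close> and \<open>h'\<close> contribute K (b - a) each.\<close>

lemma norm_commutator_interval:
  assumes f: "f \<in> L2 \<Omega>" and ab: "a \<le> b"
  shows "norm_L2 \<Omega> (commutator (E {a<..b} f)) \<le> 2 * K * (b - a) * norm_L2 \<Omega> (E {a<..b} f)"
proof -
  let ?I = "{a<..b}"
  define h where "h = E ?I f"
  define h' where "h' = (\<lambda>x. cnj (h x))"
  have h: "h \<in> L2 \<Omega>" unfolding h_def using f by (intro E_L2) auto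
  have h': "h' \<in> L2 \<Omega>" unfolding h'_def by (rule L2_cnj[OF h])
  interpret finite_measure "\<mu> h" by (rule finite_measure_spectral_measure[OF h])
  have AE_h: "AE s in \<mu> h. s \<in> ?I" unfolding h_def by (rule AE_spectral_measure_E[OF f]) simp
  have bound: "(LINT s|\<mu> h. (G s)\<^sup>2) \<le> M\<^sup>2 * (norm_L2 \<Omega> h)\<^sup>2"
    if "integrable (\<mu> h) (\<lambda>s. (G s)\<^sup>2)" "\<And>s. s \<in> ?I \<Longrightarrow> \<bar>G s\<bar> \<le> M" for G :: "real \<Rightarrow> real" and M
  proof -
    have "AE s in \<mu> h. (G s)\<^sup>2 \<le> M\<^sup>2"
      using AE_h
    proof eventually_elim
      case (elim s)
      then show ?case using power_mono[OF that(2)[OF elim] abs_ge_zero, of 2] by simp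
    qed
    then have "(LINT s|\<mu> h. (G s)\<^sup>2) \<le> (LINT s|\<mu> h. M\<^sup>2)"
      by (intro integral_mono_AE that) auto
    then show ?thesis using measure_spectral_measure_UNIV[OF h] by (simp add: mult.commute)
  qed
  \<comment> \<open>Boundedness of the interval puts \<open>h\<close> into the domain of the
    operator, so it has an image \<open>g\<close>; \<open>T_cnj\<close> then supplies an image of
    \<open>h'\<close>.\<close>
  have "integrable (\<mu> h) (\<lambda>s. s\<^sup>2)"
  proof (rule integrable_const_bound[where B="(\<bar>a\<bar> + \<bar>b\<bar>)\<^sup>2"])
    show "AE s in \<mu> h. norm (s\<^sup>2) \<le> (\<bar>a\<bar> + \<bar>b\<bar>)\<^sup>2"
      using AE_h
    proof eventually_elim
      case (elim s)
      then have "\<bar>s\<bar> \<le> \<bar>a\<bar> + \<bar>b\<bar>" by auto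
      then show ?case using power_mono[of "\<bar>s\<bar>" "\<bar>a\<bar> + \<bar>b\<bar>" 2] by simp
    qed
  qed simp
  then have "h \<in> spectral_domain \<Omega> E (\<lambda>s. s)" using h by (simp add: spectral_domain_def)
  then obtain g where g: "T h g" using T_resolution unfolding spectral_resolution_def by blast
  have fc: "fun_calc \<Omega> E (\<lambda>s. s) h g" "fun_calc \<Omega> E (\<lambda>s. s) h' (\<lambda>x. cnj (g x))"
    using g T_cnj[OF g] T_resolution unfolding spectral_resolution_def h'_def by blast+
  have id: "(\<lambda>s::real. s) \<in> borel_measurable borel" by simp
  have "(LINT s|\<mu> h'. (s - a)\<^sup>2) = (norm_L2 \<Omega> (\<lambda>x. cnj (g x) - complex_of_real a * h' x))\<^sup>2"
    by (rule fun_calc_norm_diff(2)[OF fc(2) id, symmetric])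
  also have "\<dots> = (norm_L2 \<Omega> (\<lambda>x. g x - complex_of_real a * h x))\<^sup>2"
    using norm_L2_cnj[of \<Omega> "\<lambda>x. g x - complex_of_real a * h x"] by (simp add: h'_def)
  also have "\<dots> = (LINT s|\<mu> h. (s - a)\<^sup>2)"
    by (rule fun_calc_norm_diff(2)[OF fc(1) id])
  also have "\<dots> \<le> (b - a)\<^sup>2 * (norm_L2 \<Omega> h)\<^sup>2"
    by (rule bound[OF fun_calc_norm_diff(1)[OF fc(1) id]]) auto
  finally have cnj_bound: "(LINT s|\<mu> h'. (s - a)\<^sup>2) \<le> (b - a)\<^sup>2 * (norm_L2 \<Omega> h)\<^sup>2" .
  define p where "p = (\<lambda>x. P h x - complex_of_real (F a) * h x)"
  define p' where "p' = (\<lambda>x. P h' x - complex_of_real (F a) * h' x)"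
  have L: "p \<in> L2 \<Omega>" "p' \<in> L2 \<Omega>"
    unfolding p_def p'_def by (intro L2_diff L2_scale P_L2 h h')+
  have "(norm_L2 \<Omega> p)\<^sup>2 = (LINT s|\<mu> h. (F s - F a)\<^sup>2)"
    unfolding p_def by (rule fun_calc_norm_diff(2)[OF fun_calc_P[OF h] F_borel])
  also have "\<dots> \<le> (K * (b - a))\<^sup>2 * (norm_L2 \<Omega> h)\<^sup>2"
  proof (rule bound[OF fun_calc_norm_diff(1)[OF fun_calc_P[OF h] F_borel]])
    fix s assume s: "s \<in> ?I"
    have "K * \<bar>s - a\<bar> \<le> K * (b - a)" using s by (intro mult_left_mono K_nonneg) auto
    then show "\<bar>F s - F a\<bar> \<le> K * (b - a)" using F_lipschitz[of s a] by linarith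
  qed
  finally have "(norm_L2 \<Omega> p)\<^sup>2 \<le> (K * (b - a) * norm_L2 \<Omega> h)\<^sup>2" by (simp add: power_mult_distrib)
  then have p: "norm_L2 \<Omega> p \<le> K * (b - a) * norm_L2 \<Omega> h"
    by (rule power2_le_imp_le) (use K_nonneg ab in simp)
  have "(norm_L2 \<Omega> p')\<^sup>2 = (LINT s|\<mu> h'. (F s - F a)\<^sup>2)"
    unfolding p'_def by (rule fun_calc_norm_diff(2)[OF fun_calc_P[OF h'] F_borel])
  also have "\<dots> \<le> (LINT s|\<mu> h'. K\<^sup>2 * (s - a)\<^sup>2)"
  proof (rule integral_mono[OF fun_calc_norm_diff(1)[OF fun_calc_P[OF h'] F_borel]])
    show "integrable (\<mu> h') (\<lambda>s. K\<^sup>2 * (s - a)\<^sup>2)"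
      using fun_calc_norm_diff(1)[OF fc(2) id] by (rule integrable_mult_right)
    fix s
    have "\<bar>F s - F a\<bar>\<^sup>2 \<le> (K * \<bar>s - a\<bar>)\<^sup>2" by (intro power_mono F_lipschitz) simp
    then show "(F s - F a)\<^sup>2 \<le> K\<^sup>2 * (s - a)\<^sup>2" by (simp add: power_mult_distrib)
  qed
  also have "\<dots> \<le> K\<^sup>2 * ((b - a)\<^sup>2 * (norm_L2 \<Omega> h)\<^sup>2)"
    using cnj_bound by (simp add: mult_left_mono)
  finally have "(norm_L2 \<Omega> p')\<^sup>2 \<le> (K * (b - a) * norm_L2 \<Omega> h)\<^sup>2"
    by (simp add: power_mult_distrib mult.assoc)
  then have p': "norm_L2 \<Omega> p' \<le> K * (b - a) * norm_L2 \<Omega> h"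
    by (rule power2_le_imp_le) (use K_nonneg ab in simp)
  \<comment> \<open>The scalar F a is real, so its two occurrences cancel.\<close>
  have "commutator h = (\<lambda>x. p' x - cnj (p x))"
    by (simp add: commutator_def p_def p'_def h'_def)
  then have "norm_L2 \<Omega> (commutator h) \<le> norm_L2 \<Omega> p' + norm_L2 \<Omega> p"
    using norm_L2_diff_triangle[OF L(2) L2_cnj[OF L(1)]] by (simp add: norm_L2_cnj)
  then show ?thesis using p p' unfolding h_def by simp
qed

text \<open>The two halves of an interval have orthogonal spectral subspaces, so the sum of the norms of the
  components exceeds the norm by at most \<open>sqrt 2\<close>, while the length is halved.\<close>

lemma norm_commutator_interval_halving:
  assumes f: "f \<in> L2 \<Omega>" and ab: "a \<le> b"
  shows "norm_L2 \<Omega> (commutator (E {a<..b} f)) \<le> 2 * K * (b - a) / sqrt 2 ^ n * norm_L2 \<Omega> (E {a<..b} f)"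
  using ab
proof (induction n arbitrary: a b)
  case 0
  then show ?case using norm_commutator_interval[OF f] by simp
next
  case (Suc n)
  define m where "m = (a + b) / 2"
  have m: "a \<le> m" "m \<le> b" "m - a = (b - a) / 2" "b - m = (b - a) / 2"
    using Suc.prems by (auto simp: m_def field_simps)
  let ?f1 = "E {a<..m} f" and ?f2 = "E {m<..b} f" and ?f = "E {a<..b} f"
  define C where "C = 2 * K * ((b - a) / 2) / sqrt 2 ^ n"
  have C: "0 \<le> C" using K_nonneg Suc.prems by (simp add: C_def)
  have I: "{a<..b} = {a<..m} \<union> {m<..b}" using m by auto
  have split: "norm_L2 \<Omega> (\<lambda>x. ?f x - ?f1 x - ?f2 x) = 0"
    "(norm_L2 \<Omega> ?f)\<^sup>2 = (norm_L2 \<Omega> ?f1)\<^sup>2 + (norm_L2 \<Omega> ?f2)\<^sup>2"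
    using norm_E_split[OF f, of "{a<..m}" "{m<..b}"] unfolding I[symmetric] by auto
  have "norm_L2 \<Omega> (commutator ?f) \<le> norm_L2 \<Omega> (commutator ?f1) + norm_L2 \<Omega> (commutator ?f2)"
    using norm_commutator_le[of ?f1 ?f2 ?f] f split(1) by (simp add: E_L2)
  also have "\<dots> \<le> C * norm_L2 \<Omega> ?f1 + C * norm_L2 \<Omega> ?f2"
    using Suc.IH[OF m(1)] Suc.IH[OF m(2)] unfolding m(3,4) C_def by (rule add_mono)
  also have "\<dots> = C * (norm_L2 \<Omega> ?f1 + norm_L2 \<Omega> ?f2)" by (simp add: distrib_left)
  also have "\<dots> \<le> C * (sqrt 2 * norm_L2 \<Omega> ?f)"
  proof (rule mult_left_mono[OF power2_le_imp_le C])
    show "(norm_L2 \<Omega> ?f1 + norm_L2 \<Omega> ?f2)\<^sup>2 \<le> (sqrt 2 * norm_L2 \<Omega> ?f)\<^sup>2"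
      using sum_squares_bound[of "norm_L2 \<Omega> ?f1" "norm_L2 \<Omega> ?f2"]
      by (simp add: power_mult_distrib split(2) power2_sum)
  qed simp
  also have "C * (sqrt 2 * norm_L2 \<Omega> ?f) = (C * sqrt 2) * norm_L2 \<Omega> ?f" by simp
  also have "C * sqrt 2 = 2 * K * (b - a) / sqrt 2 ^ Suc n"
  proof -
    have "C * sqrt 2 = C * (2 / sqrt 2)" by (simp add: real_div_sqrt)
    also have "\<dots> = 2 * K * (b - a) / sqrt 2 ^ Suc n" by (simp add: C_def field_simps)
    finally show ?thesis .
  qed
  finally show ?case .
qed

text \<open>The left side does not depend on the number of halvings, while the bound decays
  geometrically with ratio 1 / sqrt 2.\<close>

lemma norm_commutator_interval_eq_0:
  assumes f: "f \<in> L2 \<Omega>" and ab: "a \<le> b"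
  shows "norm_L2 \<Omega> (commutator (E {a<..b} f)) = 0"
proof -
  let ?c = "2 * K * (b - a)" and ?N = "norm_L2 \<Omega> (E {a<..b} f)"
  have "(\<lambda>n. ?c * ?N * (1 / sqrt 2) ^ n) \<longlonglongrightarrow> ?c * ?N * 0"
    by (intro tendsto_mult tendsto_const LIMSEQ_realpow_zero) auto
  moreover have "norm_L2 \<Omega> (commutator (E {a<..b} f)) \<le> ?c * ?N * (1 / sqrt 2) ^ n" for n
    using norm_commutator_interval_halving[OF f ab, of n] by (simp add: power_divide)
  ultimately have "norm_L2 \<Omega> (commutator (E {a<..b} f)) \<le> 0"
    by (intro LIMSEQ_le_const[of _ 0]) auto
  then show ?thesis by (simp add: order_antisym)
qed

text \<open>The intervals (-n, n] exhaust the line, and the part of \<open>f\<close> that they miss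
  has squared norm equal to the missing spectral mass, which tends to 0.\<close>

lemma norm_commutator_eq_0:
  assumes f: "f \<in> L2 \<Omega>"
  shows "norm_L2 \<Omega> (commutator f) = 0"
proof -
  interpret finite_measure "\<mu> f" by (rule finite_measure_spectral_measure[OF f])
  let ?I = "\<lambda>n. {- real n<..real n}"
  \<comment> \<open>\<open>P\<close> of the zero function is only known to be null, so this takes an
    argument; zero serves as second summand in \<open>norm_commutator_le\<close>.\<close>
  have "norm_L2 \<Omega> (commutator (\<lambda>x. 0)) \<le> 0"
  proof -
    have "norm_L2 \<Omega> (P (\<lambda>x. 0)) = 0"
      using norm_P_le[OF L2_zero] by (simp add: order_antisym)
    then show ?thesis
      using norm_L2_diff_triangle[OF P_L2[OF L2_zero] L2_cnj[OF P_L2[OF L2_zero]]]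
      by (simp add: commutator_def norm_L2_cnj)
  qed
  then have "norm_L2 \<Omega> (commutator f) \<le> 2 * norm_L2 \<Omega> (\<lambda>x. f x - E (?I n) f x)" for n
    using norm_commutator_le[of "E (?I n) f" "\<lambda>x. 0" f] f norm_commutator_interval_eq_0[OF f, of "- real n" "real n"]
    by (simp add: E_L2 L2_zero)
  moreover have "(norm_L2 \<Omega> (\<lambda>x. f x - E (?I n) f x))\<^sup>2 = measure (\<mu> f) UNIV - measure (\<mu> f) (?I n)" for n
    by (simp add: norm_L2_diff_sq f E_L2 complex_of_real_measure_spectral_measure[OF f, symmetric]
        measure_spectral_measure[OF f, symmetric] measure_spectral_measure_UNIV[OF f, symmetric])
  then have "norm_L2 \<Omega> (\<lambda>x. f x - E (?I n) f x) = sqrt (measure (\<mu> f) UNIV - measure (\<mu> f) (?I n))" for n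
    by (intro real_sqrt_unique[symmetric]) auto
  ultimately have le: "norm_L2 \<Omega> (commutator f) \<le> 2 * sqrt (measure (\<mu> f) UNIV - measure (\<mu> f) (?I n))" for n
    by simp
  have "(\<Union>n. ?I n) = UNIV"
  proof -
    have "\<exists>n. s \<in> ?I n" for s
    proof -
      obtain n where "\<bar>s\<bar> < real n" using reals_Archimedean2 by blast
      then show ?thesis by (intro exI[of _ n]) auto
    qed
    then show ?thesis by blast
  qed
  moreover have "(\<lambda>n. measure (\<mu> f) (?I n)) \<longlonglongrightarrow> measure (\<mu> f) (\<Union>n. ?I n)"
    by (intro finite_Lim_measure_incseq) (auto simp: incseq_def)
  ultimately have lim: "(\<lambda>n. measure (\<mu> f) (?I n)) \<longlonglongrightarrow> measure (\<mu> f) UNIV" by simp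
  have "(\<lambda>n. 2 * sqrt (measure (\<mu> f) UNIV - measure (\<mu> f) (?I n)))
      \<longlonglongrightarrow> 2 * sqrt (measure (\<mu> f) UNIV - measure (\<mu> f) UNIV)"
    by (intro tendsto_intros lim)
  then have "norm_L2 \<Omega> (commutator f) \<le> 2 * sqrt (measure (\<mu> f) UNIV - measure (\<mu> f) UNIV)"
    by (rule LIMSEQ_le_const) (use le in blast)
  then show ?thesis by (simp add: order_antisym)
qed

lemma inner_cnj_P:
  assumes f: "f \<in> L2 \<Omega>" and h: "h \<in> L2 \<Omega>"
  shows "inner_L2 \<Omega> h (\<lambda>x. cnj (P f x)) = inner_L2 \<Omega> h (P (\<lambda>x. cnj (f x)))"
proof -
  have "cmod (inner_L2 \<Omega> h (commutator f)) \<le> 0"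
    using norm_L2_cauchy_schwarz[OF h commutator_L2[OF f]] by (simp add: norm_commutator_eq_0[OF f])
  then show ?thesis
    by (simp add: commutator_def inner_L2_diff_right h f P_L2 L2_cnj)
qed

text \<open>Conjugation commutes with \<open>P\<close> only up to a null function, so the factors
  are moved one at a time to the test function \<open>h\<close> instead of being rewritten inside
  the iterate.\<close>

lemma inner_cnj_P_funpow:
  assumes f: "f \<in> L2 \<Omega>" and h: "h \<in> L2 \<Omega>"
  shows "inner_L2 \<Omega> h (\<lambda>x. cnj ((P ^^ i) f x)) = inner_L2 \<Omega> h ((P ^^ i) (\<lambda>x. cnj (f x)))"
proof -
  have "inner_L2 \<Omega> h (\<lambda>x. cnj ((P ^^ i) f x)) = inner_L2 \<Omega> ((P ^^ i) h) (\<lambda>x. cnj (f x))"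
    using h
  proof (induction i arbitrary: h)
    case (Suc i)
    have L: "(P ^^ i) f \<in> L2 \<Omega>" by (rule P_funpow_L2[OF f])
    have "inner_L2 \<Omega> h (\<lambda>x. cnj ((P ^^ Suc i) f x)) = inner_L2 \<Omega> (P h) (\<lambda>x. cnj ((P ^^ i) f x))"
      using inner_cnj_P[OF L Suc.prems] P_selfadjoint[OF Suc.prems L2_cnj[OF L]] by simp
    also have "\<dots> = inner_L2 \<Omega> ((P ^^ i) (P h)) (\<lambda>x. cnj (f x))"
      by (rule Suc.IH[OF P_L2[OF Suc.prems]])
    finally show ?case by (simp add: funpow_swap1)
  qed simp
  then show ?thesis using inner_P_funpow[OF h L2_cnj[OF f]] by simp
qed

end

section \<open>The symmetrized operator is real\<close>

text \<open>Smoothness is coinductive, so closure under differentiation has to be exhibited for a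
  whole family of conjugates, not for a single function.\<close>

lemma smooth_on_cnj:
  fixes f :: "'a::real_normed_vector \<Rightarrow> complex"
  assumes "open S" "smooth_on S f"
  shows "smooth_on S (\<lambda>x. cnj (f x))"
proof -
  obtain H where H: "f \<in> H"
    "\<And>g x. g \<in> H \<Longrightarrow> x \<in> S \<Longrightarrow> g differentiable (at x)"
    "\<And>g v. g \<in> H \<Longrightarrow> (\<lambda>x. frechet_derivative g (at x) v) \<in> H"
    using assms(2) unfolding smooth_on_def by blast
  text \<open>Outside \<open>S\<close>, where \<open>frechet_derivative\<close> may be a junk value, nothing is required of \<open>h\<close>.\<close>
  define H' where "H' = {h. \<exists>g\<in>H. \<forall>x\<in>S. h x = cnj (g x)}"
  have deriv: "(h has_derivative (\<lambda>v. cnj (frechet_derivative g (at x) v))) (at x)"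
    if "g \<in> H" "\<forall>x\<in>S. h x = cnj (g x)" "x \<in> S" for g h x
  proof -
    have "(g has_derivative frechet_derivative g (at x)) (at x)"
      using H(2)[OF that(1,3)] frechet_derivative_works by blast
    then have "((\<lambda>x. cnj (g x)) has_derivative (\<lambda>v. cnj (frechet_derivative g (at x) v))) (at x)"
      by (rule bounded_linear.has_derivative[OF bounded_linear_cnj])
    then show ?thesis
      by (rule has_derivative_transform_within_open[OF _ assms(1) that(3)]) (use that(2) in simp)
  qed
  have "h differentiable (at x)" if h: "h \<in> H'" and x: "x \<in> S" for h x
  proof -
    obtain g where g: "g \<in> H" "\<forall>x\<in>S. h x = cnj (g x)" using h unfolding H'_def by blast
    show ?thesis by (rule differentiableI[OF deriv[OF g x]])
  qed
  moreover have "(\<lambda>x. frechet_derivative h (at x) v) \<in> H'" if h: "h \<in> H'" for h v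
  proof -
    obtain g where g: "g \<in> H" "\<forall>x\<in>S. h x = cnj (g x)" using h unfolding H'_def by blast
    have "frechet_derivative h (at x) v = cnj (frechet_derivative g (at x) v)" if "x \<in> S" for x
      using fun_cong[OF frechet_derivative_at[OF deriv[OF g that]]] by simp
    then show ?thesis
      unfolding H'_def by (intro CollectI bexI[OF _ H(3)[OF g(1), of v]]) simp
  qed
  moreover have "(\<lambda>x. cnj (f x)) \<in> H'" using H(1) unfolding H'_def by blast
  ultimately show ?thesis unfolding smooth_on_def by blast
qed

lemma partial_cnj:
  assumes "f differentiable (at x)"
  shows "partial i (\<lambda>x. cnj (f x)) x = cnj (partial i f x)"
proof -
  have "(f has_derivative frechet_derivative f (at x)) (at x)"
    using assms frechet_derivative_works by blast
  then have "((\<lambda>x. cnj (f x)) has_derivative (\<lambda>v. cnj (frechet_derivative f (at x) v))) (at x)"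
    by (rule bounded_linear.has_derivative[OF bounded_linear_cnj])
  from fun_cong[OF frechet_derivative_at[OF this]] show ?thesis by (simp add: partial_def)
qed

lemma smooth_on_differentiable: "smooth_on S f \<Longrightarrow> x \<in> S \<Longrightarrow> f differentiable (at x)"
  unfolding smooth_on_def by blast

text \<open>\<open>f'\<close> is required to be the conjugate on \<Omega> only, with the derivatives
  of the approximating functions in view.\<close>

lemma tendsto_L2_cnj:
  assumes lim: "tendsto_L2 \<Omega> f g" and f': "\<And>k x. x \<in> \<Omega> \<Longrightarrow> f' k x = cnj (f k x)"
  shows "tendsto_L2 \<Omega> f' (\<lambda>x. cnj (g x))"
proof -
  have "(LINT x|lebesgue_on \<Omega>. (cmod (f' k x - cnj (g x)))\<^sup>2) = (LINT x|lebesgue_on \<Omega>. (cmod (f k x - g x))\<^sup>2)" for k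
  proof (intro Bochner_Integration.integral_cong refl)
    fix x assume "x \<in> space (lebesgue_on \<Omega>)"
    then have "f' k x - cnj (g x) = cnj (f k x - g x)"
      by (simp add: space_restrict_space f')
    then show "(cmod (f' k x - cnj (g x)))\<^sup>2 = (cmod (f k x - g x))\<^sup>2"
      by (simp only: complex_mod_cnj)
  qed
  then show ?thesis using lim by (simp add: tendsto_L2_def)
qed

text \<open>Conjugation acts on the approximating sequence itself: it preserves smoothness, the
  neighbourhood of vanishing and L2 distances.\<close>

lemma H1_vanishing_cnj:
  assumes op: "open \<Omega>" and H1: "H1_vanishing \<Omega> BI u G"
  shows "H1_vanishing \<Omega> BI (\<lambda>x. cnj (u x)) (\<lambda>i x. cnj (G i x))"
proof -
  obtain \<phi> where smooth: "\<And>k. smooth_on \<Omega> (\<phi> k)" and L: "\<And>k. \<phi> k \<in> L2 \<Omega>"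
    and dL: "\<And>k i. partial i (\<phi> k) \<in> L2 \<Omega>"
    and vanish: "\<And>k. \<exists>U. open U \<and> BI \<subseteq> U \<and> (\<forall>x\<in>U \<inter> \<Omega>. \<phi> k x = 0)"
    and lim: "tendsto_L2 \<Omega> \<phi> u" "\<And>i. tendsto_L2 \<Omega> (\<lambda>k. partial i (\<phi> k)) (G i)"
    and uG: "u \<in> L2 \<Omega>" "\<And>i. G i \<in> L2 \<Omega>"
    using H1 unfolding H1_vanishing_def by blast
  have partial: "partial i (\<lambda>x. cnj (\<phi> k x)) x = cnj (partial i (\<phi> k) x)" if "x \<in> \<Omega>" for i k x
    by (rule partial_cnj[OF smooth_on_differentiable[OF smooth that]])
  have dL': "partial i (\<lambda>x. cnj (\<phi> k x)) \<in> L2 \<Omega>" for i k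
    by (rule L2_cong[OF L2_cnj[OF dL]]) (rule partial)
  have lim1: "tendsto_L2 \<Omega> (\<lambda>k x. cnj (\<phi> k x)) (\<lambda>x. cnj (u x))"
    by (rule tendsto_L2_cnj[OF lim(1)]) simp
  have lim2: "tendsto_L2 \<Omega> (\<lambda>k. partial i (\<lambda>x. cnj (\<phi> k x))) (\<lambda>x. cnj (G i x))" for i
    by (rule tendsto_L2_cnj[OF lim(2)]) (rule partial)
  have vanish': "\<exists>U. open U \<and> BI \<subseteq> U \<and> (\<forall>x\<in>U \<inter> \<Omega>. cnj (\<phi> k x) = 0)" for k
    using vanish[of k] by simp
  show ?thesis
    unfolding H1_vanishing_def
    by (intro conjI allI exI[of _ "\<lambda>k x. cnj (\<phi> k x)"])
      (simp_all only: L2_cnj uG smooth_on_cnj[OF op smooth] L dL' vanish' lim1 lim2)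
qed

text \<open>The test functions are closed under conjugation, so Green's formula for \<open>v\<close>
  and \<open>K\<close> is the conjugate of the one for their conjugates.\<close>

lemma mixed_laplacian_cnj:
  assumes op: "open \<Omega>" and lap: "mixed_laplacian \<Omega> BI u h"
  shows "mixed_laplacian \<Omega> BI (\<lambda>x. cnj (u x)) (\<lambda>x. cnj (h x))"
proof -
  obtain G where h: "h \<in> L2 \<Omega>" and G: "H1_vanishing \<Omega> BI u G"
    and green: "\<And>v K. H1_vanishing \<Omega> BI v K \<Longrightarrow> (\<Sum>i\<in>UNIV. inner_L2 \<Omega> (K i) (G i)) = - inner_L2 \<Omega> v h"
    using lap unfolding mixed_laplacian_def by blast
  have "(\<Sum>i\<in>UNIV. inner_L2 \<Omega> (K i) (\<lambda>x. cnj (G i x))) = - inner_L2 \<Omega> v (\<lambda>x. cnj (h x))"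
    if "H1_vanishing \<Omega> BI v K" for v K
  proof -
    have *: "inner_L2 \<Omega> a (\<lambda>x. cnj (b x)) = cnj (inner_L2 \<Omega> (\<lambda>x. cnj (a x)) b)" for a b
      using inner_L2_cnj[of \<Omega> "\<lambda>x. cnj (a x)" b] by simp
    show ?thesis
      using arg_cong[OF green[OF H1_vanishing_cnj[OF op that]], of cnj]
      by (simp add: * flip: cnj_sum)
  qed
  then show ?thesis
    using L2_cnj[OF h] H1_vanishing_cnj[OF op G] unfolding mixed_laplacian_def by blast
qed

lemma sym_op_cnj:
  assumes op: "open \<Omega>" and sym: "sym_op \<Omega> BI c w g"
  shows "sym_op \<Omega> BI c (\<lambda>x. cnj (w x)) (\<lambda>x. cnj (g x))"
proof -
  obtain h where w: "w \<in> L2 \<Omega>" and g: "g \<in> L2 \<Omega>"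
    and lap: "mixed_laplacian \<Omega> BI (\<lambda>x. complex_of_real (c x) * w x) h"
    and eq: "eq_L2 \<Omega> g (\<lambda>x. complex_of_real (c x) * h x)"
    using sym unfolding sym_op_def by blast
  have "mixed_laplacian \<Omega> BI (\<lambda>x. complex_of_real (c x) * cnj (w x)) (\<lambda>x. cnj (h x))"
    using mixed_laplacian_cnj[OF op lap] by simp
  moreover have "eq_L2 \<Omega> (\<lambda>x. cnj (g x)) (\<lambda>x. complex_of_real (c x) * cnj (h x))"
    using eq unfolding eq_L2_def by eventually_elim simp
  ultimately show ?thesis
    using L2_cnj[OF w] L2_cnj[OF g] unfolding sym_op_def by blast
qed

text \<open>cos x - cos y is twice a product of two sines, hence at most |x^2 - y^2| / 2 in absolute
  value, and the squares undo the root that would spoil an estimate near 0. As \<open>sqrt\<close>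
  is odd on the reals and \<open>cos\<close> is even, passing to absolute values covers negative
  arguments as well.\<close>

lemma cos_sqrt_lipschitz:
  fixes \<tau> :: real
  shows "\<bar>cos (\<tau> * sqrt s) - cos (\<tau> * sqrt t)\<bar> \<le> \<tau>\<^sup>2 / 2 * \<bar>s - t\<bar>"
proof -
  define x y where "x = \<bar>\<tau> * sqrt s\<bar>" and "y = \<bar>\<tau> * sqrt t\<bar>"
  have cos_abs: "cos \<bar>z\<bar> = cos z" for z :: real by (simp add: abs_if)
  have sin_le: "\<bar>sin z\<bar> \<le> \<bar>z\<bar>" for z :: real by (rule abs_sin_x_le_abs_x)
  have "\<bar>cos x - cos y\<bar> = 2 * (\<bar>sin ((x + y) / 2)\<bar> * \<bar>sin ((y - x) / 2)\<bar>)"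
    by (simp add: cos_diff_cos abs_mult)
  also have "\<dots> \<le> 2 * (\<bar>(x + y) / 2\<bar> * \<bar>(y - x) / 2\<bar>)"
    by (intro mult_left_mono mult_mono sin_le) auto
  also have "\<dots> = \<bar>(x + y) * (y - x)\<bar> / 2"
    by (simp add: abs_mult)
  also have "(x + y) * (y - x) = y\<^sup>2 - x\<^sup>2"
    by (simp add: power2_eq_square algebra_simps)
  also have "y\<^sup>2 - x\<^sup>2 = \<tau>\<^sup>2 * (\<bar>t\<bar> - \<bar>s\<bar>)"
    by (simp add: x_def y_def power_mult_distrib right_diff_distrib real_sqrt_abs2 flip: real_sqrt_power)
  also have "\<bar>\<tau>\<^sup>2 * (\<bar>t\<bar> - \<bar>s\<bar>)\<bar> / 2 \<le> \<tau>\<^sup>2 / 2 * \<bar>s - t\<bar>"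
  proof -
    have "\<bar>\<bar>t\<bar> - \<bar>s\<bar>\<bar> \<le> \<bar>s - t\<bar>" by linarith
    then show ?thesis by (simp add: abs_mult mult_left_mono)
  qed
  finally show ?thesis by (simp add: x_def y_def cos_abs)
qed

section \<open>Chebyshev polynomials and moments\<close>

text \<open>Both sides obey the three-term recurrence in \<open>l\<close>, and l <= k keeps every
  difference of indices genuine.\<close>

lemma chebyshev_mult:
  "l \<le> k \<Longrightarrow> 2 * (chebyshev k * chebyshev l) = chebyshev (k + l) + chebyshev (k - l)"
proof (induction l rule: chebyshev.induct)
  case 1
  then show ?case by (simp flip: mult_2)
next
  case 2
  then obtain k' where "k = Suc k'" by (cases k) auto
  then show ?case by (simp add: algebra_simps numeral_poly)
next
  case (3 l)
  obtain d where d: "k = Suc (Suc l) + d" using 3(3) le_Suc_ex by blast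
  have "2 * (chebyshev k * chebyshev (Suc (Suc l)))
      = [:0, 2:] * (2 * (chebyshev k * chebyshev (Suc l))) - 2 * (chebyshev k * chebyshev l)"
    by (simp add: algebra_simps)
  also have "\<dots> = [:0, 2:] * (chebyshev (Suc (k + l)) + chebyshev (Suc d)) - (chebyshev (k + l) + chebyshev (Suc (Suc d)))"
    using 3(1,2) d by (simp add: Suc_diff_le)
  also have "\<dots> = chebyshev (Suc (Suc (k + l))) + chebyshev d"
    by (simp add: algebra_simps)
  finally show ?case using d by simp
qed

text \<open>Both sides of the interpolation
  identity are of this form, with \<open>c i = \<langle>b, P\<^sup>i b\<rangle>\<close> for the respective operator.\<close>

definition moment_functional :: "(nat \<Rightarrow> complex) \<Rightarrow> real poly \<Rightarrow> complex" where
  "moment_functional c p = (\<Sum>i\<le>degree p. complex_of_real (coeff p i) * c i)"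

lemma moment_functional_alt:
  assumes "degree p \<le> N"
  shows "moment_functional c p = (\<Sum>i\<le>N. complex_of_real (coeff p i) * c i)"
  unfolding moment_functional_def
  by (rule sum.mono_neutral_left) (use assms in \<open>auto simp: coeff_eq_0\<close>)

lemma moment_functional_add: "moment_functional c (p + q) = moment_functional c p + moment_functional c q"
proof -
  let ?N = "max (degree p) (degree q)"
  have "degree (p + q) \<le> ?N" by (rule degree_add_le_max)
  then show ?thesis
    by (simp add: moment_functional_alt[of _ ?N] sum.distrib distrib_right)
qed

lemma moment_functional_smult: "moment_functional c (Polynomial.smult a p) = complex_of_real a * moment_functional c p"
  using degree_smult_le[of a p]
  by (simp add: moment_functional_alt[of "Polynomial.smult a p" "degree p"] moment_functional_alt[of p "degree p"]
      sum_distrib_left mult.assoc)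

lemma moment_functional_0[simp]: "moment_functional c 0 = 0"
  by (simp add: moment_functional_def)

lemma moment_functional_pCons:
  "moment_functional c (pCons a p) = complex_of_real a * c 0 + moment_functional (\<lambda>i. c (Suc i)) p"
  using degree_pCons_le[of a p]
  by (simp add: moment_functional_alt[of "pCons a p" "Suc (degree p)"] moment_functional_alt[of p "degree p"]
      sum.atMost_Suc_shift del: sum.atMost_Suc)

text \<open>Coefficients convolve under multiplication, so a product of polynomials amounts to
  iterating the functional over shifted sequences. Powers of operators and of matrices are handled
  alike by this.\<close>

lemma moment_functional_mult:
  "moment_functional c (p * q) = moment_functional (\<lambda>i. moment_functional (\<lambda>j. c (i + j)) q) p"
proof (induction p arbitrary: c)
  case (pCons a p)
  then show ?case
    by (simp add: moment_functional_add moment_functional_smult moment_functional_pCons)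
qed simp

lemma moment_functional_cong: "(\<And>i. c i = c' i) \<Longrightarrow> moment_functional c p = moment_functional c' p"
  by (simp add: moment_functional_def)

lemma moment_functional_sum:
  "moment_functional (\<lambda>i. \<Sum>a\<in>A. c a i) p = (\<Sum>a\<in>A. moment_functional (c a) p)"
  unfolding moment_functional_def by (simp add: sum_distrib_left sum.swap[of _ A])

lemma moment_functional_mult_left: "moment_functional (\<lambda>i. x * c i) p = x * moment_functional c p"
  by (simp add: moment_functional_def sum_distrib_left mult.left_commute)

lemma moment_functional_mult_right: "moment_functional (\<lambda>i. c i * x) p = moment_functional c p * x"
  by (simp add: moment_functional_def sum_distrib_right mult.assoc)

lemma cnj_moment_functional: "cnj (moment_functional c p) = moment_functional (\<lambda>i. cnj (c i)) p"
  by (simp add: moment_functional_def)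

section \<open>Adjoints and polynomials of complex matrices\<close>

lemma mat_adjoint_carrier[simp, intro]: "A \<in> carrier_mat r s \<Longrightarrow> mat_adjoint A \<in> carrier_mat s r"
  by (auto simp: mat_adjoint_def mat_of_rows_def)

lemma dim_mat_adjoint[simp]: "dim_row (mat_adjoint A) = dim_col A" "dim_col (mat_adjoint A) = dim_row A"
  by (auto simp: mat_adjoint_def mat_of_rows_def)

lemma mat_adjoint_index[simp]:
  fixes A :: "complex mat"
  shows "i < dim_col A \<Longrightarrow> j < dim_row A \<Longrightarrow> mat_adjoint A $$ (i, j) = cnj (A $$ (j, i))"
  by (simp add: mat_adjoint_def mat_of_rows_def)

lemma mult_mat_index:
  "A \<in> carrier_mat r s \<Longrightarrow> B \<in> carrier_mat s t \<Longrightarrow> i < r \<Longrightarrow> j < t \<Longrightarrow>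
    (A * B) $$ (i, j) = (\<Sum>k<s. A $$ (i, k) * B $$ (k, j))"
  by (simp add: scalar_prod_def atLeast0LessThan)

lemma mat_adjoint_mult:
  fixes A B :: "complex mat"
  assumes A: "A \<in> carrier_mat r s" and B: "B \<in> carrier_mat s t"
  shows "mat_adjoint (A * B) = mat_adjoint B * mat_adjoint A"
proof (rule eq_matI)
  fix i j assume "i < dim_row (mat_adjoint B * mat_adjoint A)" "j < dim_col (mat_adjoint B * mat_adjoint A)"
  then have ij: "i < t" "j < r" using A B by auto
  then show "mat_adjoint (A * B) $$ (i, j) = (mat_adjoint B * mat_adjoint A) $$ (i, j)"
    using A B mult_mat_index[OF A B ij(2,1)]
      mult_mat_index[OF mat_adjoint_carrier[OF B] mat_adjoint_carrier[OF A] ij]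
    by (auto simp: mult.commute intro!: sum.cong)
qed (use A B in auto)

lemma mat_adjoint_mat_adjoint[simp]:
  fixes A :: "complex mat"
  shows "mat_adjoint (mat_adjoint A) = A"
  by (rule eq_matI) auto

lemma mat_adjoint_one[simp]: "mat_adjoint (1\<^sub>m k :: complex mat) = 1\<^sub>m k"
  by (rule eq_matI) auto

lemma poly_mat_carrier[simp, intro]: "A \<in> carrier_mat N N \<Longrightarrow> poly_mat p A \<in> carrier_mat N N"
  by (auto simp: poly_mat_def)

text \<open>Reduces identities for polynomials of a matrix to identities for scalar sequences, one
  entry at a time.\<close>

lemma poly_mat_index:
  "A \<in> carrier_mat N N \<Longrightarrow> a < N \<Longrightarrow> b < N \<Longrightarrow>
    poly_mat p A $$ (a, b) = moment_functional (\<lambda>i. (A ^\<^sub>m i) $$ (a, b)) p"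
  by (simp add: poly_mat_def moment_functional_def)

lemma pow_mat_add:
  fixes A :: "'a::semiring_1 mat"
  assumes A: "A \<in> carrier_mat N N"
  shows "A ^\<^sub>m (i + j) = A ^\<^sub>m i * A ^\<^sub>m j"
proof (induction j)
  case (Suc j)
  then show ?case using A by (simp add: assoc_mult_mat[of _ N N _ N _ N])
qed (use A in simp)

lemma poly_mat_mult:
  assumes A: "A \<in> carrier_mat N N"
  shows "poly_mat (p * q) A = poly_mat p A * poly_mat q A"
proof (rule eq_matI)
  fix a b assume "a < dim_row (poly_mat p A * poly_mat q A)" "b < dim_col (poly_mat p A * poly_mat q A)"
  then have ab: "a < N" "b < N" using poly_mat_carrier[OF A, of p] poly_mat_carrier[OF A, of q] by auto
  have "poly_mat (p * q) A $$ (a, b)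
      = moment_functional (\<lambda>i. moment_functional (\<lambda>j. (A ^\<^sub>m (i + j)) $$ (a, b)) q) p"
    by (simp add: poly_mat_index[OF A ab] moment_functional_mult)
  also have "\<dots> = moment_functional (\<lambda>i. moment_functional (\<lambda>j. \<Sum>c<N. (A ^\<^sub>m i) $$ (a, c) * (A ^\<^sub>m j) $$ (c, b)) q) p"
    by (intro moment_functional_cong) (simp add: pow_mat_add[OF A] mult_mat_index[OF pow_carrier_mat[OF A] pow_carrier_mat[OF A] ab] del: index_mult_mat)
  also have "\<dots> = (\<Sum>c<N. poly_mat p A $$ (a, c) * poly_mat q A $$ (c, b))"
    by (simp add: moment_functional_sum moment_functional_mult_left moment_functional_mult_right poly_mat_index[OF A] ab)
  also have "\<dots> = (poly_mat p A * poly_mat q A) $$ (a, b)"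
    by (rule mult_mat_index[symmetric, OF poly_mat_carrier[OF A] poly_mat_carrier[OF A] ab])
  finally show "poly_mat (p * q) A $$ (a, b) = (poly_mat p A * poly_mat q A) $$ (a, b)" .
qed (use poly_mat_carrier[OF A, of p] poly_mat_carrier[OF A, of q] poly_mat_carrier[OF A, of "p * q"] in auto)

lemma mat_adjoint_pow:
  fixes A :: "complex mat"
  assumes A: "A \<in> carrier_mat N N" and herm: "mat_adjoint A = A"
  shows "mat_adjoint (A ^\<^sub>m i) = A ^\<^sub>m i"
proof (induction i)
  case (Suc i)
  have "mat_adjoint (A ^\<^sub>m Suc i) = A ^\<^sub>m 1 * A ^\<^sub>m i"
    using Suc A herm by (simp add: mat_adjoint_mult[OF pow_carrier_mat[OF A] A])
  then show ?case by (simp only: pow_mat_add[OF A, symmetric]) simp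
qed (use A in simp)

lemma mat_adjoint_poly_mat:
  assumes A: "A \<in> carrier_mat N N" and herm: "mat_adjoint A = A"
  shows "mat_adjoint (poly_mat p A) = poly_mat p A"
proof (rule eq_matI)
  fix a b assume "a < dim_row (poly_mat p A)" "b < dim_col (poly_mat p A)"
  then have ab: "a < N" "b < N" using poly_mat_carrier[OF A, of p] by auto
  have "cnj ((A ^\<^sub>m i) $$ (b, a)) = (A ^\<^sub>m i) $$ (a, b)" for i
    using mat_adjoint_index[of a "A ^\<^sub>m i" b] pow_carrier_mat[OF A, of i] ab
    by (simp add: mat_adjoint_pow[OF A herm] del: pow_mat_dim)
  moreover have "poly_mat p A \<in> carrier_mat N N" by (rule poly_mat_carrier[OF A])
  ultimately show "mat_adjoint (poly_mat p A) $$ (a, b) = poly_mat p A $$ (a, b)"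
    using ab by (auto simp: poly_mat_index[OF A] cnj_moment_functional)
qed (use poly_mat_carrier[OF A, of p] in auto)

section \<open>The reduced order model\<close>

lemma block_index_less: "k < n \<Longrightarrow> i < m \<Longrightarrow> k * m + i < m * (n::nat)"
  using mult_le_mono1[of "Suc k" n m] by (simp add: mult.commute)

lemma block_indexE:
  assumes "a < m * (n::nat)"
  obtains k i where "a = k * m + i" "k < n" "i < m"
proof
  have "0 < m" using assms by (cases m) auto
  then show "a = a div m * m + a mod m" "a mod m < m" by simp_all
  show "a div m < n" using assms by (simp add: less_mult_imp_div_less mult.commute)
qed

lemma block_matrix_index:
  assumes "k < p" "l < r" "i < m" "j < m"
  shows "block_matrix m p r F $$ (k * m + i, l * m + j) = F k l $$ (i, j)"
  using assms block_index_less[of k p i m] block_index_less[of l r j m] by (simp add: block_matrix_def)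

lemma block_matrix_carrier: "block_matrix m p r F \<in> carrier_mat (m * p) (m * r)"
  by (simp add: block_matrix_def)

text \<open>The \<open>k\<close>-th block column of the identity matrix: multiplying by it on the
  right selects a block column, so block identities become matrix products.\<close>

definition unit_block :: "nat \<Rightarrow> nat \<Rightarrow> nat \<Rightarrow> complex mat" where
  "unit_block m n k = Matrix.mat (m * n) m (\<lambda>(a, j). if a = k * m + j then 1 else 0)"

lemma unit_block_carrier[simp, intro]: "unit_block m n k \<in> carrier_mat (m * n) m"
  by (simp add: unit_block_def)

lemma mult_unit_block_index:
  assumes Z: "Z \<in> carrier_mat r (m * n)" and "k < n" "a < r" "j < m"
  shows "(Z * unit_block m n k) $$ (a, j) = Z $$ (a, k * m + j)"
proof -
  have "(Z * unit_block m n k) $$ (a, j) = (\<Sum>b<m * n. Z $$ (a, b) * unit_block m n k $$ (b, j))"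
    by (rule mult_mat_index[OF Z unit_block_carrier assms(3,4)])
  also have "\<dots> = (\<Sum>b<m * n. if b = k * m + j then Z $$ (a, b) else 0)"
    using assms by (intro sum.cong) (auto simp: unit_block_def)
  also have "\<dots> = Z $$ (a, k * m + j)"
    using block_index_less[OF assms(2,4)] by simp
  finally show ?thesis .
qed

lemma unit_block_sandwich_index:
  assumes Z: "Z \<in> carrier_mat (m * n) (m * n)" and "k < n" "l < n" "i < m" "j < m"
  shows "(mat_adjoint (unit_block m n k) * (Z * unit_block m n l)) $$ (i, j) = Z $$ (k * m + i, l * m + j)"
proof -
  have ZU: "Z * unit_block m n l \<in> carrier_mat (m * n) m"
    using Z unit_block_carrier by (rule mult_carrier_mat)
  have "(mat_adjoint (unit_block m n k) * (Z * unit_block m n l)) $$ (i, j)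
      = (\<Sum>b<m * n. mat_adjoint (unit_block m n k) $$ (i, b) * (Z * unit_block m n l) $$ (b, j))"
    by (rule mult_mat_index[OF mat_adjoint_carrier[OF unit_block_carrier] ZU assms(4,5)])
  also have "\<dots> = (\<Sum>b<m * n. if b = k * m + i then Z $$ (b, l * m + j) else 0)"
    using assms by (intro sum.cong refl, subst mult_unit_block_index[OF Z]) (auto simp: unit_block_def)
  also have "\<dots> = Z $$ (k * m + i, l * m + j)"
    using block_index_less[OF assms(2,4)] by simp
  finally show ?thesis .
qed

text \<open>The finite-dimensional half of the theorem, without reference to the Hilbert space. Only
  \<open>D k\<close> with k < 2 n is constrained, so block indices have to be checked against this
  bound; the largest, k + l + 1 in \<open>S\<close>, just meets it. \<open>X\<close> stands for the
  inverse of \<open>L\<close>.\<close>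

locale sampled_data =
  fixes m n :: nat and D :: "nat \<Rightarrow> complex mat" and M S L X :: "complex mat"
  assumes n_pos: "n \<ge> 1"
    and D_carrier: "\<And>k. k < 2 * n \<Longrightarrow> D k \<in> carrier_mat m m"
    and D_hermitian: "\<And>k. k < 2 * n \<Longrightarrow> mat_adjoint (D k) = D k"
    and M_def: "M = block_matrix m n n (\<lambda>k l.
         (1/2) \<cdot>\<^sub>m (D (k + l) + D (nat \<bar>int k - int l\<bar>)))"
    and S_def: "S = block_matrix m n n (\<lambda>k l.
         (1/4) \<cdot>\<^sub>m (D (k + l + 1) + D (nat \<bar>int k - int l + 1\<bar>)
                   + D (nat \<bar>int k + int l - 1\<bar>) + D (nat \<bar>int k - int l - 1\<bar>)))"
    and L: "L \<in> carrier_mat (m * n) (m * n)" "L * mat_adjoint L = M"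
    and X: "X \<in> carrier_mat (m * n) (m * n)" "X * L = 1\<^sub>m (m * n)"
begin

lemma M_index:
  assumes "k < n" "l < n" "i < m" "j < m"
  shows "M $$ (k * m + i, l * m + j) = (D (k + l) $$ (i, j) + D (nat \<bar>int k - int l\<bar>) $$ (i, j)) / 2"
proof -
  have "k + l < 2 * n" "nat \<bar>int k - int l\<bar> < 2 * n" using assms by auto
  from this[THEN D_carrier] show ?thesis
    unfolding M_def block_matrix_index[OF assms] using assms by simp
qed

lemma S_index:
  assumes "k < n" "l < n" "i < m" "j < m"
  shows "S $$ (k * m + i, l * m + j) = (D (k + l + 1) $$ (i, j) + D (nat \<bar>int k - int l + 1\<bar>) $$ (i, j)
      + D (nat \<bar>int k + int l - 1\<bar>) $$ (i, j) + D (nat \<bar>int k - int l - 1\<bar>) $$ (i, j)) / 4"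
proof -
  have "k + l + 1 < 2 * n" "nat \<bar>int k - int l + 1\<bar> < 2 * n" "nat \<bar>int k + int l - 1\<bar> < 2 * n"
    "nat \<bar>int k - int l - 1\<bar> < 2 * n"
    using assms by auto
  from this[THEN D_carrier] show ?thesis
    unfolding S_def block_matrix_index[OF assms] using assms by simp
qed

lemma M_carrier: "M \<in> carrier_mat (m * n) (m * n)"
  unfolding M_def by (rule block_matrix_carrier)

lemma S_carrier: "S \<in> carrier_mat (m * n) (m * n)"
  unfolding S_def by (rule block_matrix_carrier)

lemma D_cnj: "k < 2 * n \<Longrightarrow> i < m \<Longrightarrow> j < m \<Longrightarrow> cnj (D k $$ (i, j)) = D k $$ (j, i)"
  using D_hermitian[of k] D_carrier[of k] mat_adjoint_index[of j "D k" i] by auto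

text \<open>Exchanging \<open>k\<close> and \<open>l\<close> swaps the second and fourth summands of
  a block of \<open>S\<close> and fixes the other two; each summand is Hermitian.\<close>

lemma S_hermitian: "mat_adjoint S = S"
proof (rule eq_matI)
  fix a b assume "a < dim_row S" "b < dim_col S"
  then have "a < m * n" "b < m * n" using S_carrier by auto
  then obtain k i l j where a: "a = k * m + i" "k < n" "i < m" and b: "b = l * m + j" "l < n" "j < m"
    by (metis block_indexE)
  have bounds: "k + l + 1 < 2 * n" "nat \<bar>int k - int l + 1\<bar> < 2 * n" "nat \<bar>int k + int l - 1\<bar> < 2 * n"
    "nat \<bar>int k - int l - 1\<bar> < 2 * n"
    using a b by auto
  have swap: "l + k + 1 = k + l + 1" "\<bar>int l - int k + 1\<bar> = \<bar>int k - int l - 1\<bar>"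
    "\<bar>int l + int k - 1\<bar> = \<bar>int k + int l - 1\<bar>" "\<bar>int l - int k - 1\<bar> = \<bar>int k - int l + 1\<bar>"
    by auto
  have "mat_adjoint S $$ (a, b) = cnj (S $$ (b, a))"
    using S_carrier \<open>a < dim_row S\<close> \<open>b < dim_col S\<close> by (intro mat_adjoint_index) auto
  also have "\<dots> = S $$ (a, b)"
    unfolding a(1) b(1) S_index[OF a(2) b(2) a(3) b(3)] S_index[OF b(2) a(2) b(3) a(3)] swap
    by (simp only: complex_cnj_divide complex_cnj_add complex_cnj_numeral
        D_cnj[OF bounds(1) b(3) a(3)] D_cnj[OF bounds(2) b(3) a(3)]
        D_cnj[OF bounds(3) b(3) a(3)] D_cnj[OF bounds(4) b(3) a(3)]) (simp only: add_ac)
  finally show "mat_adjoint S $$ (a, b) = S $$ (a, b)" .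
qed (use S_carrier in auto)

definition reduced_P where "reduced_P = X * S * mat_adjoint X"
definition reduced_B where "reduced_B = X * block_matrix m n 1 (\<lambda>k _. D k)"

text \<open>\<open>W k\<close> is the coordinate matrix of the \<open>k\<close>-th snapshot in the orthonormalized Krylov basis.\<close>

definition W where "W k = mat_adjoint L * unit_block m n k"

lemma X_adjoint: "mat_adjoint X \<in> carrier_mat (m * n) (m * n)"
  using X(1) by (rule mat_adjoint_carrier)

lemma L_adjoint: "mat_adjoint L \<in> carrier_mat (m * n) (m * n)"
  using L(1) by (rule mat_adjoint_carrier)

lemma reduced_P_carrier: "reduced_P \<in> carrier_mat (m * n) (m * n)"
  unfolding reduced_P_def using X(1) S_carrier X_adjoint by (meson mult_carrier_mat)

lemma reduced_B_carrier: "reduced_B \<in> carrier_mat (m * n) m"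
  unfolding reduced_B_def using mult_carrier_mat[OF X(1) block_matrix_carrier[of m n 1]] by simp

lemma W_carrier: "W k \<in> carrier_mat (m * n) m"
  unfolding W_def by (rule mult_carrier_mat[OF L_adjoint unit_block_carrier])

lemma reduced_P_hermitian: "mat_adjoint reduced_P = reduced_P"
proof -
  have "mat_adjoint reduced_P = X * (S * mat_adjoint X)"
    unfolding reduced_P_def
    by (simp add: mat_adjoint_mult[OF mult_carrier_mat[OF X(1) S_carrier] X_adjoint]
        mat_adjoint_mult[OF X(1) S_carrier] S_hermitian)
  also have "\<dots> = reduced_P" unfolding reduced_P_def by (rule assoc_mult_mat[symmetric, OF X(1) S_carrier X_adjoint])
  finally show ?thesis .
qed

text \<open>\<open>X\<close> cancels the left factor in the factorization of \<open>M\<close>, which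
  leaves the adjoint of \<open>L\<close>.\<close>

lemma X_M_unit: "X * (M * unit_block m n k) = W k"
proof -
  have "X * (M * unit_block m n k) = X * (L * W k)"
    unfolding L(2)[symmetric] W_def by (simp only: assoc_mult_mat[OF L(1) L_adjoint unit_block_carrier])
  also have "\<dots> = (X * L) * W k" by (rule assoc_mult_mat[symmetric, OF X(1) L(1) W_carrier])
  also have "\<dots> = W k" unfolding X(2) using W_carrier by (rule left_mult_one_mat)
  finally show ?thesis .
qed

text \<open>The data column is the first block column of \<open>M\<close>, because k + 0 and |k - 0|
  coincide.\<close>

lemma reduced_B_eq: "reduced_B = W 0"
proof -
  have "block_matrix m n 1 (\<lambda>k _. D k) = M * unit_block m n 0" (is "?B = ?M")
  proof (rule eq_matI)
    fix a j assume "a < dim_row ?M" "j < dim_col ?M"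
    then have "a < m * n" and j: "j < m" using M_carrier by (auto simp: unit_block_def)
    then obtain k i where a: "a = k * m + i" "k < n" "i < m" by (metis block_indexE)
    have "?M $$ (a, j) = M $$ (k * m + i, 0 * m + j)"
      using mult_unit_block_index[OF M_carrier _ \<open>a < m * n\<close> j, of 0] n_pos a by simp
    also have "\<dots> = D k $$ (i, j)"
      using M_index[OF a(2) _ a(3) j, of 0] n_pos by simp
    also have "\<dots> = ?B $$ (a, j)"
      using block_matrix_index[of k n 0 1 i m j "\<lambda>k _. D k"] a j by simp
    finally show "?B $$ (a, j) = ?M $$ (a, j)" by simp
  qed (use M_carrier in \<open>auto simp: block_matrix_def unit_block_def\<close>)
  then show ?thesis unfolding reduced_B_def by (simp only: X_M_unit)
qed

text \<open>The adjoint of \<open>X\<close> cancels the adjoint of \<open>L\<close> in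
  \<open>W k\<close>, so only a block column of \<open>S\<close> remains.\<close>

lemma reduced_P_W: "reduced_P * W k = X * (S * unit_block m n k)"
proof -
  have LX: "mat_adjoint X * mat_adjoint L = 1\<^sub>m (m * n)"
  proof -
    have "L * X = 1\<^sub>m (m * n)" using X L(1) mat_mult_left_right_inverse by blast
    then show ?thesis using mat_adjoint_mult[OF L(1) X(1)] by simp
  qed
  have "reduced_P * W k = X * S * (mat_adjoint X * W k)"
    unfolding reduced_P_def by (rule assoc_mult_mat[OF mult_carrier_mat[OF X(1) S_carrier] X_adjoint W_carrier])
  also have "mat_adjoint X * W k = mat_adjoint X * mat_adjoint L * unit_block m n k"
    unfolding W_def by (rule assoc_mult_mat[symmetric, OF X_adjoint L_adjoint unit_block_carrier])
  also have "\<dots> = unit_block m n k" unfolding LX by (rule left_mult_one_mat[OF unit_block_carrier])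
  also have "X * S * unit_block m n k = X * (S * unit_block m n k)"
    by (rule assoc_mult_mat[OF X(1) S_carrier unit_block_carrier])
  finally show ?thesis .
qed

text \<open>By the factorization of \<open>M\<close>, the columns of the \<open>W k\<close> have the
  same Gram matrix as the snapshots.\<close>

lemma W_inner:
  assumes "k < n" "l < n" "i < m" "j < m"
  shows "(mat_adjoint (W k) * W l) $$ (i, j) = M $$ (k * m + i, l * m + j)"
proof -
  have "mat_adjoint (W k) * W l = (mat_adjoint (unit_block m n k) * L) * W l"
    unfolding W_def by (simp add: mat_adjoint_mult[OF L_adjoint unit_block_carrier])
  also have "\<dots> = mat_adjoint (unit_block m n k) * (L * W l)"
    by (rule assoc_mult_mat[OF mat_adjoint_carrier[OF unit_block_carrier] L(1) W_carrier])
  also have "L * W l = M * unit_block m n l"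
    unfolding W_def L(2)[symmetric] by (rule assoc_mult_mat[symmetric, OF L(1) L_adjoint unit_block_carrier])
  finally show ?thesis using unit_block_sandwich_index[OF M_carrier assms] by simp
qed

lemma W_reduced_P_inner:
  assumes "k < n" "l < n" "i < m" "j < m"
  shows "(mat_adjoint (W k) * (reduced_P * W l)) $$ (i, j) = S $$ (k * m + i, l * m + j)"
proof -
  have SU: "S * unit_block m n l \<in> carrier_mat (m * n) m"
    by (rule mult_carrier_mat[OF S_carrier unit_block_carrier])
  have LX: "L * X = 1\<^sub>m (m * n)" using X L(1) mat_mult_left_right_inverse by blast
  have "mat_adjoint (W k) * (reduced_P * W l) = (mat_adjoint (unit_block m n k) * L) * (X * (S * unit_block m n l))"
    unfolding reduced_P_W unfolding W_def by (simp add: mat_adjoint_mult[OF L_adjoint unit_block_carrier])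
  also have "\<dots> = mat_adjoint (unit_block m n k) * (L * (X * (S * unit_block m n l)))"
    by (rule assoc_mult_mat[OF mat_adjoint_carrier[OF unit_block_carrier] L(1) mult_carrier_mat[OF X(1) SU]])
  also have "L * (X * (S * unit_block m n l)) = L * X * (S * unit_block m n l)"
    by (rule assoc_mult_mat[symmetric, OF L(1) X(1) SU])
  also have "\<dots> = S * unit_block m n l" unfolding LX by (rule left_mult_one_mat[OF SU])
  finally show ?thesis using unit_block_sandwich_index[OF S_carrier assms] by simp
qed

text \<open>Block column k of \<open>S\<close> is the average of block columns k + 1 and |k - 1| of
  \<open>M\<close>, and multiplying by \<open>X\<close> turns this into the recurrence. The bound k
  + 1 < n ensures that column k + 1 exists.\<close>

lemma reduced_P_W_recurrence:
  assumes k: "Suc k < n" and a: "a < m * n" and j: "j < m"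
  shows "(reduced_P * W k) $$ (a, j) = (W (Suc k) $$ (a, j) + W (nat \<bar>int k - 1\<bar>) $$ (a, j)) / 2"
proof -
  let ?k' = "nat \<bar>int k - 1\<bar>"
  have k': "?k' < n" "k < n" using k by auto
  have S_M: "(S * unit_block m n k) $$ (b, j)
      = ((M * unit_block m n (Suc k)) $$ (b, j) + (M * unit_block m n ?k') $$ (b, j)) / 2"
    if b: "b < m * n" for b
  proof -
    obtain l i where bl: "b = l * m + i" "l < n" "i < m" using b by (metis block_indexE)
    \<comment> \<open>For k = 0 the absolute value reflects index -1 to 1, in accordance with T_(-1)
      = T_1; the two neighbouring columns then coincide.\<close>
    have *: "nat \<bar>int l - int k + 1\<bar> = (if 1 \<le> k then nat \<bar>int l - int ?k'\<bar> else l + 1)"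
      "nat \<bar>int l + int k - 1\<bar> = (if 1 \<le> k then l + ?k' else nat \<bar>int l - 1\<bar>)"
      "nat \<bar>int l - int k - 1\<bar> = nat \<bar>int l - int (Suc k)\<bar>" "l + k + 1 = l + Suc k"
      by (auto simp: nat_diff_distrib)
    show ?thesis
      unfolding mult_unit_block_index[OF S_carrier k'(2) b j] mult_unit_block_index[OF M_carrier k b j]
        mult_unit_block_index[OF M_carrier k'(1) b j]
      unfolding bl(1) S_index[OF bl(2) k'(2) bl(3) j] M_index[OF bl(2) k bl(3) j] M_index[OF bl(2) k'(1) bl(3) j] *
      by (cases "k = 0") (simp_all add: field_simps)
  qed
  have "(reduced_P * W k) $$ (a, j) = (\<Sum>b<m * n. X $$ (a, b) * (S * unit_block m n k) $$ (b, j))"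
    unfolding reduced_P_W by (rule mult_mat_index[OF X(1) mult_carrier_mat[OF S_carrier unit_block_carrier] a j])
  also have "\<dots> = ((\<Sum>b<m * n. X $$ (a, b) * (M * unit_block m n (Suc k)) $$ (b, j))
      + (\<Sum>b<m * n. X $$ (a, b) * (M * unit_block m n ?k') $$ (b, j))) / 2"
    unfolding sum.distrib[symmetric] sum_divide_distrib
    by (intro sum.cong refl) (simp add: S_M distrib_left del: index_mult_mat)
  also have "\<dots> = ((X * (M * unit_block m n (Suc k))) $$ (a, j) + (X * (M * unit_block m n ?k')) $$ (a, j)) / 2"
    by (simp only: mult_mat_index[OF X(1) mult_carrier_mat[OF M_carrier unit_block_carrier] a j])
  finally show ?thesis by (simp only: X_M_unit)
qed

section \<open>Moments of the reduced model\<close>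

definition moment where "moment i j r = (mat_adjoint reduced_B * (reduced_P ^\<^sub>m r * reduced_B)) $$ (i, j)"

lemma poly_mat_mult_index:
  assumes Y: "Y \<in> carrier_mat (m * n) m" and "a < m * n" "j < m"
  shows "(poly_mat p reduced_P * Y) $$ (a, j) = moment_functional (\<lambda>r. (reduced_P ^\<^sub>m r * Y) $$ (a, j)) p"
  unfolding mult_mat_index[OF poly_mat_carrier[OF reduced_P_carrier] Y assms(2,3)]
    mult_mat_index[OF pow_carrier_mat[OF reduced_P_carrier] Y assms(2,3)]
  by (simp add: moment_functional_sum moment_functional_mult_right poly_mat_index[OF reduced_P_carrier assms(2)])

lemma moment_functional_eq:
  assumes "i < m" "j < m"
  shows "(mat_adjoint reduced_B * (poly_mat p reduced_P * reduced_B)) $$ (i, j) = moment_functional (moment i j) p"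
  unfolding moment_def
    mult_mat_index[OF mat_adjoint_carrier[OF reduced_B_carrier] mult_carrier_mat[OF poly_mat_carrier[OF reduced_P_carrier] reduced_B_carrier] assms]
    mult_mat_index[OF mat_adjoint_carrier[OF reduced_B_carrier] mult_carrier_mat[OF pow_carrier_mat[OF reduced_P_carrier] reduced_B_carrier] assms]
  by (simp add: moment_functional_sum moment_functional_mult_left poly_mat_mult_index[OF reduced_B_carrier _ assms(2)] del: index_mult_mat)

lemma poly_mat_recurrence:
  assumes "a < m * n" "j < m"
  shows "(poly_mat (chebyshev (Suc (Suc k))) reduced_P * reduced_B) $$ (a, j)
    = 2 * (reduced_P * (poly_mat (chebyshev (Suc k)) reduced_P * reduced_B)) $$ (a, j) - (poly_mat (chebyshev k) reduced_P * reduced_B) $$ (a, j)"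
proof -
  let ?Q = "\<lambda>p. poly_mat p reduced_P"
  note Q = poly_mat_carrier[OF reduced_P_carrier]
  have x: "poly_mat [:0, 1:] reduced_P = reduced_P"
    using reduced_P_carrier by (intro eq_matI) (auto simp: poly_mat_def)
  have "chebyshev (Suc (Suc k)) = Polynomial.smult 2 ([:0, 1:] * chebyshev (Suc k)) + Polynomial.smult (-1) (chebyshev k)"
    by (simp add: smult_monom)
  then have "(?Q (chebyshev (Suc (Suc k))) * reduced_B) $$ (a, j)
      = 2 * (?Q ([:0, 1:] * chebyshev (Suc k)) * reduced_B) $$ (a, j) - (?Q (chebyshev k) * reduced_B) $$ (a, j)"
    by (simp only: poly_mat_mult_index[OF reduced_B_carrier assms] moment_functional_add moment_functional_smult) simp
  also have "?Q ([:0, 1:] * chebyshev (Suc k)) * reduced_B = reduced_P * (?Q (chebyshev (Suc k)) * reduced_B)"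
    by (simp only: poly_mat_mult[OF reduced_P_carrier] x assoc_mult_mat[OF reduced_P_carrier Q reduced_B_carrier])
  finally show ?thesis .
qed

text \<open>\<open>W\<close> obeys the Chebyshev recurrence and starts at \<open>reduced_B\<close>,
  but the recurrence ends where \<open>M\<close> runs out of block columns. The step from 0 to 1
  uses the reflected index.\<close>

lemma chebyshev_reduced_P_reduced_B: "k < n \<Longrightarrow> poly_mat (chebyshev k) reduced_P * reduced_B = W k"
proof (induction k rule: chebyshev.induct)
  case 1
  have "poly_mat 1 reduced_P = 1\<^sub>m (m * n)"
    using reduced_P_carrier by (intro eq_matI) (auto simp: poly_mat_def)
  then show ?case using reduced_B_carrier reduced_B_eq by simp
next
  case 2
  have "poly_mat [:0, 1:] reduced_P = reduced_P"
    using reduced_P_carrier by (intro eq_matI) (auto simp: poly_mat_def)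
  then have "poly_mat (chebyshev (Suc 0)) reduced_P * reduced_B = reduced_P * W 0" by (simp add: reduced_B_eq)
  also have "\<dots> = W 1"
  proof (rule eq_matI)
    fix a j assume "a < dim_row (W 1)" "j < dim_col (W 1)"
    then have aj: "a < m * n" "j < m" using W_carrier[of 1] by auto
    show "(reduced_P * W 0) $$ (a, j) = W 1 $$ (a, j)"
      using reduced_P_W_recurrence[OF 2 aj] by simp
  qed (use W_carrier[of 1] W_carrier[of 0] reduced_P_carrier in auto)
  finally show ?case by simp
next
  case (3 k)
  show ?case
  proof (rule eq_matI)
    fix a j assume "a < dim_row (W (Suc (Suc k)))" "j < dim_col (W (Suc (Suc k)))"
    then have aj: "a < m * n" "j < m" using W_carrier[of "Suc (Suc k)"] by auto
    show "(poly_mat (chebyshev (Suc (Suc k))) reduced_P * reduced_B) $$ (a, j) = W (Suc (Suc k)) $$ (a, j)"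
      using 3 reduced_P_W_recurrence[OF 3(3) aj]
      by (simp add: poly_mat_recurrence[OF aj] field_simps del: index_mult_mat chebyshev.simps)
  next
    show "dim_row (poly_mat (chebyshev (Suc (Suc k))) reduced_P * reduced_B) = dim_row (W (Suc (Suc k)))"
      "dim_col (poly_mat (chebyshev (Suc (Suc k))) reduced_P * reduced_B) = dim_col (W (Suc (Suc k)))"
      using W_carrier[of "Suc (Suc k)"] reduced_B_carrier poly_mat_carrier[OF reduced_P_carrier, of "chebyshev (Suc (Suc k))"]
      by (auto simp del: chebyshev.simps)
  qed
qed

text \<open>\<open>reduced_P\<close> is Hermitian, so the left Chebyshev factor can be absorbed by
  the left copy of \<open>reduced_B\<close>, where it produces the adjoint of
  \<open>W k\<close>.\<close>

lemma moment_functional_sandwich: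
  assumes "k < n" "l < n" "i < m" "j < m"
  shows "moment_functional (moment i j) (chebyshev k * (p * chebyshev l))
    = (mat_adjoint (W k) * (poly_mat p reduced_P * W l)) $$ (i, j)"
proof -
  note Q = poly_mat_carrier[OF reduced_P_carrier]
  have "moment_functional (moment i j) (chebyshev k * (p * chebyshev l))
      = (mat_adjoint reduced_B * (poly_mat (chebyshev k) reduced_P * (poly_mat p reduced_P * poly_mat (chebyshev l) reduced_P) * reduced_B)) $$ (i, j)"
    by (simp only: moment_functional_eq[OF assms(3,4), symmetric] poly_mat_mult[OF reduced_P_carrier])
  also have "poly_mat (chebyshev k) reduced_P * (poly_mat p reduced_P * poly_mat (chebyshev l) reduced_P) * reduced_B
      = poly_mat (chebyshev k) reduced_P * (poly_mat p reduced_P * W l)"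
    by (simp only: assoc_mult_mat[OF Q mult_carrier_mat[OF Q Q] reduced_B_carrier] assoc_mult_mat[OF Q Q reduced_B_carrier]
        chebyshev_reduced_P_reduced_B[OF assms(2)])
  also have "mat_adjoint reduced_B * (poly_mat (chebyshev k) reduced_P * (poly_mat p reduced_P * W l))
      = mat_adjoint reduced_B * poly_mat (chebyshev k) reduced_P * (poly_mat p reduced_P * W l)"
    by (rule assoc_mult_mat[symmetric, OF mat_adjoint_carrier[OF reduced_B_carrier] Q mult_carrier_mat[OF Q W_carrier]])
  also have "mat_adjoint reduced_B * poly_mat (chebyshev k) reduced_P = mat_adjoint (W k)"
    using mat_adjoint_mult[OF Q reduced_B_carrier, of "chebyshev k"]
    by (simp add: chebyshev_reduced_P_reduced_B[OF assms(1)] mat_adjoint_poly_mat[OF reduced_P_carrier reduced_P_hermitian])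
  finally show ?thesis .
qed

lemma moment_functional_chebyshev_mult:
  assumes "k < n" "l < n" "i < m" "j < m"
  shows "moment_functional (moment i j) (chebyshev k * chebyshev l)
    = (D (k + l) $$ (i, j) + D (nat \<bar>int k - int l\<bar>) $$ (i, j)) / 2"
proof -
  have "poly_mat 1 reduced_P = 1\<^sub>m (m * n)"
    using reduced_P_carrier by (intro eq_matI) (auto simp: poly_mat_def)
  then show ?thesis
    using moment_functional_sandwich[OF assms, of 1] W_carrier[of l] W_inner[OF assms] M_index[OF assms] by simp
qed

text \<open>Each step solves a product formula for its highest term. For r <= 2 n - 2 a product T_k
  T_l with k + l = r and both indices below \<open>n\<close> is read off from \<open>M\<close>; the
  last value r = 2 n - 1 is out of reach of such products and is read off from
  \<open>S\<close>.\<close>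

lemma moment_functional_chebyshev:
  assumes ij: "i < m" "j < m" and "r < 2 * n"
  shows "moment_functional (moment i j) (chebyshev r) = D r $$ (i, j)"
  using assms(3)
proof (induction r rule: less_induct)
  case (less r)
  let ?\<phi> = "moment_functional (moment i j)"
  have double: "?\<phi> (2 * p) = 2 * ?\<phi> p" for p
    by (simp only: mult_2 moment_functional_add)
  have "r = 0 \<or> r = 1 \<or> 2 \<le> r" by arith
  moreover have "n = 1 \<or> 2 \<le> n" using n_pos by arith
  moreover have "r \<le> 2 * n - 2 \<or> r = 2 * n - 1" using less.prems by arith
  ultimately consider "r = 0" | "r = 1" "n \<ge> 2" | "r = 1" "n = 1" | "2 \<le> r" "r \<le> 2 * n - 2" | "2 \<le> r" "r = 2 * n - 1"
    by blast
  then show ?case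
  proof cases
    case 1
    then show ?thesis using moment_functional_chebyshev_mult[of 0 0 i j] n_pos ij by simp
  next
    case 2
    then show ?thesis using moment_functional_chebyshev_mult[of 1 0 i j] ij by simp
  next
    case 3
    \<comment> \<open>With n = 1 the only block of \<open>S\<close> is \<open>D 1\<close> itself,
      all four indices being 1; the argument for the last degree below would refer back to
      T_1.\<close>
    have "poly_mat [:0, 1:] reduced_P = reduced_P"
      using reduced_P_carrier by (intro eq_matI) (auto simp: poly_mat_def)
    then show ?thesis
      using moment_functional_sandwich[of 0 0 i j "[:0, 1:]"] W_reduced_P_inner[of 0 0 i j] S_index[of 0 0 i j] ij 3 by simp
  next
    case 4
    \<comment> \<open>The most even splitting keeps both indices below \<open>n\<close> and leaves
      the remainder T_(k-l) of degree at most 1, which is below \<open>r\<close> because r >=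
      2.\<close>
    define l k where "l = r div 2" and "k = r - r div 2"
    have kl: "k < n" "l < n" "l \<le> k" "k + l = r" "k - l < r" "k - l < 2 * n"
      using 4 by (auto simp: k_def l_def)
    have "nat \<bar>int k - int l\<bar> = k - l" using kl by auto
    then have "2 * ?\<phi> (chebyshev k * chebyshev l) = D r $$ (i, j) + D (k - l) $$ (i, j)"
      using moment_functional_chebyshev_mult[OF kl(1,2) ij] kl by (simp add: field_simps)
    moreover have "2 * ?\<phi> (chebyshev k * chebyshev l) = ?\<phi> (chebyshev r) + ?\<phi> (chebyshev (k - l))"
      unfolding double[symmetric] chebyshev_mult[OF kl(3)] moment_functional_add kl(4) ..
    ultimately show ?thesis using less.IH[OF kl(5,6)] by simp
  next
    case 5
    define k where "k = n - 1"
    have k: "k < n" "1 \<le> k" "r = 2 * k + 1" using 5 n_pos by (auto simp: k_def)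
    have x: "poly_mat (chebyshev 1) reduced_P = reduced_P"
      using reduced_P_carrier by (intro eq_matI) (auto simp: poly_mat_def)
    let ?p = "chebyshev k * (chebyshev 1 * chebyshev k)"
    \<comment> \<open>The product formula applied twice. The lower terms T_(2k-1) and T_1 fall under
      the induction hypothesis because k >= 1.\<close>
    have "2 * (2 * ?p) = 2 * ((2 * (chebyshev k * chebyshev k)) * chebyshev 1)"
      by (simp only: mult_ac)
    also have "\<dots> = 2 * (chebyshev (2 * k) * chebyshev 1) + 2 * chebyshev 1"
      by (simp only: chebyshev_mult[OF order_refl] diff_self_eq_0 chebyshev.simps(1) mult_2[of k]
          distrib_left distrib_right mult_1_left)
    also have "2 * (chebyshev (2 * k) * chebyshev 1) = chebyshev (2 * k + 1) + chebyshev (2 * k - 1)"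
      using k by (intro chebyshev_mult) simp
    finally have "2 * (2 * ?p) = chebyshev (2 * k + 1) + chebyshev (2 * k - 1) + 2 * chebyshev 1" .
    then have "?\<phi> (2 * (2 * ?p)) = ?\<phi> (chebyshev (2 * k + 1) + chebyshev (2 * k - 1) + 2 * chebyshev 1)"
      by (simp only:)
    then have "2 * (2 * ?\<phi> ?p) = ?\<phi> (chebyshev r) + ?\<phi> (chebyshev (2 * k - 1)) + 2 * ?\<phi> (chebyshev 1)"
      by (simp only: double moment_functional_add k(3))
    moreover have "2 * (2 * ?\<phi> ?p) = D r $$ (i, j) + D (2 * k - 1) $$ (i, j) + 2 * D 1 $$ (i, j)"
    proof -
      have "nat (2 * int k - 1) = 2 * k - Suc 0" "nat \<bar>2 * int k - 1\<bar> = 2 * k - Suc 0" "k + k + 1 = r"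
        using k by auto
      then show ?thesis
        unfolding moment_functional_sandwich[OF k(1,1) ij] x W_reduced_P_inner[OF k(1,1) ij] S_index[OF k(1,1) ij] by simp
    qed
    moreover have "?\<phi> (chebyshev (2 * k - 1)) = D (2 * k - 1) $$ (i, j)" "?\<phi> (chebyshev 1) = D 1 $$ (i, j)"
      using k 5 by (intro less.IH; simp)+
    ultimately show ?thesis by simp
  qed
qed

lemma interpolation:
  assumes "k < 2 * n"
  shows "D k = mat_adjoint reduced_B * poly_mat (chebyshev k) reduced_P * reduced_B"
proof (rule eq_matI)
  note Q = poly_mat_carrier[OF reduced_P_carrier, of "chebyshev k"]
  let ?R = "mat_adjoint reduced_B * poly_mat (chebyshev k) reduced_P * reduced_B"
  have R: "?R = mat_adjoint reduced_B * (poly_mat (chebyshev k) reduced_P * reduced_B)"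
    by (rule assoc_mult_mat[OF mat_adjoint_carrier[OF reduced_B_carrier] Q reduced_B_carrier])
  show dims: "dim_row (D k) = dim_row ?R" "dim_col (D k) = dim_col ?R"
    using D_carrier[OF assms] reduced_B_carrier by auto
  fix i j assume "i < dim_row ?R" "j < dim_col ?R"
  then have ij: "i < m" "j < m" using reduced_B_carrier by auto
  show "D k $$ (i, j) = ?R $$ (i, j)"
    unfolding R moment_functional_eq[OF ij] by (rule moment_functional_chebyshev[OF ij assms, symmetric])
qed

end

section \<open>The interpolation theorem\<close>

lemma chebyshev_mult_abs:
  "2 * (chebyshev k * chebyshev l) = chebyshev (k + l) + chebyshev (nat \<bar>int k - int l\<bar>)"
proof (cases "l \<le> k")
  case True
  then have "nat \<bar>int k - int l\<bar> = k - l" by simp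
  then show ?thesis using chebyshev_mult[OF True] by (simp only:)
next
  case False
  then have "nat \<bar>int k - int l\<bar> = l - k" by simp
  then show ?thesis using False chebyshev_mult[of k l] by (simp only: mult.commute[of "chebyshev k"] add.commute[of k] nat_le_linear)
qed

text \<open>Applied to the moments of the exact propagator, this identifies the entries of
  \<open>M\<close> as inner products of snapshots.\<close>

lemma moment_functional_chebyshev_mult_abs:
  "moment_functional c (chebyshev k * chebyshev l)
    = (moment_functional c (chebyshev (k + l)) + moment_functional c (chebyshev (nat \<bar>int k - int l\<bar>))) / 2"
proof -
  have "moment_functional c (2 * (chebyshev k * chebyshev l)) = 2 * moment_functional c (chebyshev k * chebyshev l)"
    by (simp only: mult_2 moment_functional_add)
  then show ?thesis unfolding chebyshev_mult_abs moment_functional_add by simp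
qed

context spectral_contraction begin

lemma poly_op_L2: "f \<in> L2 \<Omega> \<Longrightarrow> poly_op p P f \<in> L2 \<Omega>"
  unfolding poly_op_def by (intro L2_sum L2_scale P_funpow_L2)

lemma inner_poly_op_right:
  assumes "f \<in> L2 \<Omega>" "g \<in> L2 \<Omega>"
  shows "inner_L2 \<Omega> f (poly_op p P g) = moment_functional (\<lambda>i. inner_L2 \<Omega> f ((P ^^ i) g)) p"
  unfolding poly_op_def moment_functional_def
  by (subst inner_L2_sum_right) (simp_all add: assms P_funpow_L2 L2_scale inner_L2_scale_right)

lemma inner_poly_op_left:
  assumes "f \<in> L2 \<Omega>" "g \<in> L2 \<Omega>"
  shows "inner_L2 \<Omega> (poly_op p P f) g = moment_functional (\<lambda>i. inner_L2 \<Omega> ((P ^^ i) f) g) p"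
  unfolding poly_op_def moment_functional_def
  by (subst inner_L2_sum_left) (simp_all add: assms P_funpow_L2 L2_scale inner_L2_scale_left)

lemma inner_poly_op:
  assumes f: "f \<in> L2 \<Omega>" and g: "g \<in> L2 \<Omega>"
  shows "inner_L2 \<Omega> (poly_op p P f) (poly_op q P g) = moment_functional (\<lambda>i. inner_L2 \<Omega> f ((P ^^ i) g)) (p * q)"
proof -
  have "inner_L2 \<Omega> ((P ^^ i) f) ((P ^^ j) g) = inner_L2 \<Omega> f ((P ^^ (i + j)) g)" for i j
    using inner_P_funpow[OF f P_funpow_L2[OF g], of i j] by (simp add: funpow_add)
  then show ?thesis
    by (simp add: inner_poly_op_left f poly_op_L2[OF g] inner_poly_op_right P_funpow_L2[OF f] g moment_functional_mult)
qed

end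

section \<open>Matrices with real entries\<close>

lemma elements_mat_mult_Reals:
  fixes A B :: "complex mat"
  assumes A: "A \<in> carrier_mat r s" "elements_mat A \<subseteq> \<real>" and B: "B \<in> carrier_mat s t" "elements_mat B \<subseteq> \<real>"
  shows "elements_mat (A * B) \<subseteq> \<real>"
proof
  fix x assume "x \<in> elements_mat (A * B)"
  then obtain i j where ij: "i < r" "j < t" and x: "x = (A * B) $$ (i, j)"
    using A B by (auto dest!: elements_matD)
  have "A $$ (i, k) \<in> \<real>" "B $$ (k, j) \<in> \<real>" if "k < s" for k
    using A B ij that elements_matI[of A r s i k] elements_matI[of B s t k j] by auto
  then show "x \<in> \<real>"
    unfolding x mult_mat_index[OF A(1) B(1) ij] by (intro sum_in_Reals Reals_mult) auto
qed

lemma elements_mat_adjoint_Reals: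
  fixes A :: "complex mat"
  assumes "elements_mat A \<subseteq> \<real>"
  shows "elements_mat (mat_adjoint A) \<subseteq> \<real>"
proof
  fix x assume "x \<in> elements_mat (mat_adjoint A)"
  then obtain i j where ij: "i < dim_col A" "j < dim_row A" and x: "x = cnj (A $$ (j, i))"
    by (auto dest!: elements_matD)
  have "A $$ (j, i) \<in> \<real>"
    using assms elements_matI[of A "dim_row A" "dim_col A" j i] ij by auto
  then show "x \<in> \<real>" unfolding x by simp
qed

text \<open>The entrywise conjugate of \<open>X\<close> inverts the conjugate of \<open>L\<close>,
  which is \<open>L\<close>; uniqueness of the inverse does the rest.\<close>

lemma elements_mat_inverse_Reals:
  fixes L X :: "complex mat"
  assumes L: "L \<in> carrier_mat N N" "elements_mat L \<subseteq> \<real>" and X: "X \<in> carrier_mat N N" "L * X = 1\<^sub>m N" "X * L = 1\<^sub>m N"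
  shows "elements_mat X \<subseteq> \<real>"
proof -
  define Y where "Y = map_mat cnj X"
  have Y: "Y \<in> carrier_mat N N" using X(1) by (simp add: Y_def)
  have L_cnj: "cnj (L $$ (i, j)) = L $$ (i, j)" if "i < N" "j < N" for i j
    using L elements_matI[of L N N i j] that by (auto simp: Reals_cnj_iff)
  have "Y * L = 1\<^sub>m N"
  proof (rule eq_matI)
    fix i j assume "i < dim_row (1\<^sub>m N :: complex mat)" "j < dim_col (1\<^sub>m N :: complex mat)"
    then have ij: "i < N" "j < N" by auto
    have "(Y * L) $$ (i, j) = (\<Sum>k<N. cnj (X $$ (i, k) * L $$ (k, j)))"
      unfolding mult_mat_index[OF Y L(1) ij] using ij X(1) by (intro sum.cong) (auto simp: Y_def L_cnj)
    also have "\<dots> = cnj ((X * L) $$ (i, j))"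
      unfolding mult_mat_index[OF X(1) L(1) ij] by simp
    finally show "(Y * L) $$ (i, j) = 1\<^sub>m N $$ (i, j)" using X(3) ij by simp
  qed (use Y L in auto)
  then have "Y = X"
    using assoc_mult_mat[OF Y L(1) X(1)] X Y by simp
  show ?thesis
  proof
    fix x assume "x \<in> elements_mat X"
    then obtain i j where ij: "i < N" "j < N" and x: "x = X $$ (i, j)"
      using X(1) by (auto dest!: elements_matD)
    have "cnj (X $$ (i, j)) = Y $$ (i, j)" using ij X(1) by (simp add: Y_def)
    then show "x \<in> \<real>" using \<open>Y = X\<close> x by (simp add: Reals_cnj_iff)
  qed
qed

lemma sum_blocks:
  fixes h :: "nat \<Rightarrow> complex"
  shows "(\<Sum>l<n. \<Sum>j<m. h (l * m + j)) = (\<Sum>b<m * n. h b)"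
proof -
  have "(\<Sum>j<m. h (l * m + j)) = sum h {l * m..<l * m + m}" for l
    using sum.shift_bounds_nat_ivl[of h 0 "l * m" m] by (simp add: atLeast0LessThan add.commute)
  then show ?thesis by (simp add: sum.nat_group mult.commute)
qed

text \<open>\<open>minv\<close> unwraps an option and is meaningful only for invertible matrices.
  The trivial kernel gives a nonzero determinant of \<open>M\<close>, and this is a multiple of the
  determinant of \<open>L\<close>. Plain functions and sums in the kernel condition match the
  independence of the snapshots.\<close>

lemma minv_left_right:
  fixes L :: "complex mat"
  assumes L: "L \<in> carrier_mat N N" and M: "L * L' = M" "L' \<in> carrier_mat N N"
    and inj: "\<forall>v :: nat \<Rightarrow> complex. (\<forall>a<N. (\<Sum>b<N. M $$ (a, b) * v b) = 0) \<longrightarrow> (\<forall>b<N. v b = 0)"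
  shows "minv L \<in> carrier_mat N N" "minv L * L = 1\<^sub>m N" "L * minv L = 1\<^sub>m N"
proof -
  have M_carrier: "M \<in> carrier_mat N N" using L M by auto
  have "Determinant.det M \<noteq> 0"
  proof
    assume "Determinant.det M = 0"
    then obtain v where v: "v \<in> carrier_vec N" "v \<noteq> 0\<^sub>v N" "M *\<^sub>v v = 0\<^sub>v N"
      using det_0_iff_vec_prod_zero[OF M_carrier] by blast
    have "(\<Sum>b<N. M $$ (a, b) * vec_index v b) = 0" if a: "a < N" for a
    proof -
      have "vec_index (M *\<^sub>v v) a = (\<Sum>b<N. M $$ (a, b) * vec_index v b)"
        using M_carrier v(1) a by (simp add: scalar_prod_def atLeast0LessThan)
      then show ?thesis using v(3) a by simp
    qed
    then have "vec_index v b = 0" if "b < N" for b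
      using inj[rule_format, of "vec_index v" b] that by simp
    then have "v = 0\<^sub>v N" using v(1) by (intro eq_vecI) auto
    then show False using v(2) by contradiction
  qed
  then have "Determinant.det L \<noteq> 0"
    using det_mult[OF L M(2)] M(1) by auto
  then have unit: "L \<in> Units (ring_mat TYPE(complex) N ())"
    by (rule det_non_zero_imp_unit[OF L])
  then obtain X where "mat_inverse L = Some X"
    using mat_inverse(1)[OF L, where b="()"] by (cases "mat_inverse L") auto
  then show "minv L \<in> carrier_mat N N" "minv L * L = 1\<^sub>m N" "L * minv L = 1\<^sub>m N"
    using mat_inverse(2)[OF L] by (auto simp: minv_def)
qed

theorem mainTheorem2:
  fixes \<Omega> BA :: "(real^'d) set"
    and c \<theta> :: "(real^'d) \<Rightarrow> real"
    and \<Gamma> :: "nat \<Rightarrow> (real^'d) set"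
    and q :: "real \<Rightarrow> real"
    and \<tau> :: real
    and m n :: nat
    and E :: "real set \<Rightarrow> ((real^'d) \<Rightarrow> complex) \<Rightarrow> (real^'d) \<Rightarrow> complex"
    and P :: "((real^'d) \<Rightarrow> complex) \<Rightarrow> (real^'d) \<Rightarrow> complex"
    and b :: "nat \<Rightarrow> (real^'d) \<Rightarrow> real"
    and bc :: "nat \<Rightarrow> (real^'d) \<Rightarrow> complex"
    and D :: "nat \<Rightarrow> complex mat"
    and M S L Pt Bt :: "complex mat"
  assumes dim: "CARD('d) = 2 \<or> CARD('d) = 3"
    and domain: "open \<Omega>" "connected \<Omega>" "bounded \<Omega>" "\<Omega> \<noteq> {}"
    and boundary: "BA \<subseteq> frontier \<Omega>"
    and velocity: "piecewise_smooth_on \<Omega> c" "\<forall>x\<in>\<Omega>. c x > 0"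
    and resolution: "spectral_resolution \<Omega> (\<lambda>w g. sym_op \<Omega> (frontier \<Omega> - BA) c w (\<lambda>x. - g x)) E"
    and params: "\<tau> > 0" "m \<ge> 1" "n \<ge> 1"
    and wavelet: "\<forall>t. q (- t) = q t" "q C1_differentiable_on UNIV" "set_integrable lborel {0..} q"
      "\<forall>s. wavelet_ft q (s\<^sup>2) \<ge> 0"
    and supports: "\<forall>j<m. \<Gamma> j \<in> sets borel \<and> \<Gamma> j \<subseteq> BA" "disjoint_family_on \<Gamma> {..<m}"
    and transducer: "\<forall>j<m. bc j = (\<lambda>x. complex_of_real (b j x))"
      "\<forall>j<m. fun_calc_surface \<Omega> E (\<lambda>s. sqrt (wavelet_ft q s)) \<theta> (\<Gamma> j) (bc j)"
    and propagator: "\<forall>w\<in>L2 \<Omega>. fun_calc \<Omega> E (\<lambda>s. cos (\<tau> * sqrt s)) w (P w)"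
    and snapshots_independent:
      "\<forall>a :: nat \<Rightarrow> nat \<Rightarrow> complex.
         eq_L2 \<Omega> (\<lambda>x. \<Sum>k<n. \<Sum>j<m. a k j * poly_op (chebyshev k) P (bc j) x) (\<lambda>x. 0)
         \<longrightarrow> (\<forall>k<n. \<forall>j<m. a k j = 0)"
    and data: "\<forall>k<2*n. D k = Matrix.mat m m (\<lambda>(i, j). inner_L2 \<Omega> (bc i) (poly_op (chebyshev k) P (bc j)))"
    and mass: "M = block_matrix m n n (\<lambda>k l.
         (1/2) \<cdot>\<^sub>m (D (k + l) + D (nat \<bar>int k - int l\<bar>)))"
    and stiffness: "S = block_matrix m n n (\<lambda>k l.
         (1/4) \<cdot>\<^sub>m (D (k + l + 1) + D (nat \<bar>int k - int l + 1\<bar>)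
                   + D (nat \<bar>int k + int l - 1\<bar>) + D (nat \<bar>int k - int l - 1\<bar>)))"
    and cholesky: "block_cholesky m n M L" "elements_mat L \<subseteq> \<real>"
    and Pt: "Pt = minv L * S * mat_adjoint (minv L)"
    and Bt: "Bt = minv L * block_matrix m n 1 (\<lambda>k _. D k)"
  shows "(\<forall>k<2*n. D k \<in> carrier_mat m m \<and> elements_mat (D k) \<subseteq> \<real>)
    \<and> Pt \<in> carrier_mat (m * n) (m * n) \<and> elements_mat Pt \<subseteq> \<real>
    \<and> Bt \<in> carrier_mat (m * n) m \<and> elements_mat Bt \<subseteq> \<real>
    \<and> (\<forall>k<2*n. D k = mat_adjoint Bt * poly_mat (chebyshev k) Pt * Bt)"
proof -
  interpret spectral_family \<Omega> E
    using resolution by unfold_locales (simp add: spectral_resolution_def)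
  \<comment> \<open>\<open>E\<close> resolves the negative of the symmetrized operator, so the
    spectral variable is what stands under the root in the propagator.\<close>
  let ?T = "\<lambda>w g. sym_op \<Omega> (frontier \<Omega> - BA) c w (\<lambda>x. - g x)"
  interpret conjugation_invariant \<Omega> E "\<lambda>s. cos (\<tau> * sqrt s)" P ?T "\<tau>\<^sup>2 / 2"
  proof
    show "(\<lambda>s. cos (\<tau> * sqrt s)) \<in> borel_measurable borel" by measurable
    show "\<bar>cos (\<tau> * sqrt s)\<bar> \<le> 1" for s by simp
    show "fun_calc \<Omega> E (\<lambda>s. cos (\<tau> * sqrt s)) w (P w)" if "w \<in> L2 \<Omega>" for w
      using propagator that by blast
    show "?T (\<lambda>x. cnj (w x)) (\<lambda>x. cnj (g x))" if "?T w g" for w g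
      using sym_op_cnj[OF domain(1) that] by simp
  qed (rule resolution cos_sqrt_lipschitz)+
  have b_L2: "bc j \<in> L2 \<Omega>" if "j < m" for j
    using transducer(2) that by (auto simp: fun_calc_surface_def)
  have b_cnj: "(\<lambda>x. cnj (bc j x)) = bc j" if "j < m" for j
    using transducer(1) that by simp
  \<comment> \<open>From here on \<open>c\<close> names the moments of the exact propagator, no
    longer the velocity; reality and symmetry of the data are reduced to those of these
    numbers.\<close>
  define c where "c = (\<lambda>i j r. inner_L2 \<Omega> (bc i) ((P ^^ r) (bc j)))"
  have c_real: "cnj (c i j r) = c i j r" if "i < m" "j < m" for i j r
  proof -
    have "cnj (c i j r) = inner_L2 \<Omega> (\<lambda>x. cnj (bc i x)) (\<lambda>x. cnj ((P ^^ r) (bc j) x))"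
      unfolding c_def by (rule inner_L2_cnj[symmetric])
    also have "\<dots> = inner_L2 \<Omega> (bc i) ((P ^^ r) (bc j))"
      using inner_cnj_P_funpow[OF b_L2[OF that(2)] b_L2[OF that(1)], of r] by (simp only: b_cnj that)
    finally show ?thesis by (simp only: c_def)
  qed
  have c_sym: "c j i r = c i j r" if "i < m" "j < m" for i j r
    using inner_P_funpow[OF b_L2[OF that(2)] b_L2[OF that(1)], of r]
      inner_L2_commute[of \<Omega> "(P ^^ r) (bc j)" "bc i"] c_real[OF that] by (simp add: c_def)
  have D_index: "D k $$ (i, j) = moment_functional (c i j) (chebyshev k)" if "k < 2 * n" "i < m" "j < m" for k i j
    using data that by (simp add: inner_poly_op_right b_L2 c_def)
  have D_carrier: "D k \<in> carrier_mat m m" if "k < 2 * n" for k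
    using data that by simp
  have D_Reals: "elements_mat (D k) \<subseteq> \<real>" if k: "k < 2 * n" for k
  proof
    fix x assume "x \<in> elements_mat (D k)"
    then obtain i j where ij: "i < m" "j < m" "x = D k $$ (i, j)"
      using D_carrier[OF k] by (auto dest!: elements_matD)
    have "cnj x = x"
      unfolding ij(3) D_index[OF k ij(1,2)] cnj_moment_functional using c_real[OF ij(1,2)] by simp
    then show "x \<in> \<real>" by (simp add: Reals_cnj_iff)
  qed
  have D_hermitian: "mat_adjoint (D k) = D k" if k: "k < 2 * n" for k
  proof (rule eq_matI)
    fix i j assume "i < dim_row (D k)" "j < dim_col (D k)"
    then have ij: "i < m" "j < m" using D_carrier[OF k] by auto
    have "mat_adjoint (D k) $$ (i, j) = cnj (D k $$ (j, i))"
      using D_carrier[OF k] ij by (intro mat_adjoint_index) auto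
    also have "\<dots> = moment_functional (\<lambda>r. cnj (c j i r)) (chebyshev k)"
      unfolding D_index[OF k ij(2,1)] cnj_moment_functional ..
    also have "\<dots> = D k $$ (i, j)"
      unfolding D_index[OF k ij] c_real[OF ij(2,1)] using c_sym[OF ij] by simp
    finally show "mat_adjoint (D k) $$ (i, j) = D k $$ (i, j)" .
  qed (use D_carrier[OF k] in auto)
  have L: "L \<in> carrier_mat (m * n) (m * n)" and LL: "L * mat_adjoint L = M"
    using cholesky(1) by (auto simp: block_cholesky_def)
  define u where "u k j = poly_op (chebyshev k) P (bc j)" for k j
  have u_L2: "u k j \<in> L2 \<Omega>" if "j < m" for k j
    unfolding u_def by (rule poly_op_L2[OF b_L2[OF that]])
  have gram: "M $$ (k * m + i, l * m + j) = inner_L2 \<Omega> (u k i) (u l j)"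
    if kl: "k < n" "l < n" and ij: "i < m" "j < m" for k l i j
  proof -
    have *: "k + l < 2 * n" "nat \<bar>int k - int l\<bar> < 2 * n" using kl by auto
    have "M $$ (k * m + i, l * m + j) = (D (k + l) $$ (i, j) + D (nat \<bar>int k - int l\<bar>) $$ (i, j)) / 2"
      unfolding mass block_matrix_index[OF kl ij] using *[THEN D_carrier] ij by simp
    also have "\<dots> = moment_functional (c i j) (chebyshev k * chebyshev l)"
      by (simp only: moment_functional_chebyshev_mult_abs D_index[OF *(1) ij] D_index[OF *(2) ij])
    finally show ?thesis
      unfolding u_def inner_poly_op[OF b_L2[OF ij(1)] b_L2[OF ij(2)]] c_def .
  qed
  \<comment> \<open>A kernel vector of the Gram matrix yields a combination of snapshots orthogonal
    to all of them, hence to itself, hence null; independence then makes its coefficients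
    vanish.\<close>
  have inj: "\<forall>v :: nat \<Rightarrow> complex. (\<forall>a<m * n. (\<Sum>b<m * n. M $$ (a, b) * v b) = 0) \<longrightarrow> (\<forall>b<m * n. v b = 0)"
  proof (intro allI impI)
    fix v :: "nat \<Rightarrow> complex" and b
    assume v: "\<forall>a<m * n. (\<Sum>b<m * n. M $$ (a, b) * v b) = 0" and b: "b < m * n"
    define f where "f = (\<lambda>x. \<Sum>l<n. \<Sum>j<m. v (l * m + j) * u l j x)"
    have f: "f \<in> L2 \<Omega>" unfolding f_def by (intro L2_sum L2_scale u_L2) simp
    have inner_f: "inner_L2 \<Omega> h f = (\<Sum>l<n. \<Sum>j<m. v (l * m + j) * inner_L2 \<Omega> h (u l j))"
      if h: "h \<in> L2 \<Omega>" for h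
    proof -
      have "inner_L2 \<Omega> h f = (\<Sum>l<n. inner_L2 \<Omega> h (\<lambda>x. \<Sum>j<m. v (l * m + j) * u l j x))"
        unfolding f_def by (intro inner_L2_sum_right h L2_sum L2_scale u_L2) simp
      also have "\<dots> = (\<Sum>l<n. \<Sum>j<m. inner_L2 \<Omega> h (\<lambda>x. v (l * m + j) * u l j x))"
        by (intro sum.cong refl inner_L2_sum_right h L2_scale u_L2) simp
      finally show ?thesis by (simp only: inner_L2_scale_right)
    qed
    have u_f: "inner_L2 \<Omega> (u k i) f = 0" if ki: "k < n" "i < m" for k i
    proof -
      have "inner_L2 \<Omega> (u k i) f = (\<Sum>l<n. \<Sum>j<m. M $$ (k * m + i, l * m + j) * v (l * m + j))"
        unfolding inner_f[OF u_L2[OF ki(2)]] by (intro sum.cong refl) (simp add: gram ki)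
      also have "\<dots> = (\<Sum>b<m * n. M $$ (k * m + i, b) * v b)"
        by (rule sum_blocks[of "\<lambda>b. M $$ (k * m + i, b) * v b"])
      also have "\<dots> = 0" using v block_index_less[OF ki] by blast
      finally show ?thesis .
    qed
    have "inner_L2 \<Omega> f (u l j) = 0" if "l < n" "j < m" for l j
      using u_f[OF that] inner_L2_commute[of \<Omega> f "u l j"] by simp
    then have "inner_L2 \<Omega> f f = 0" unfolding inner_f[OF f] by simp
    then have "norm_L2 \<Omega> f = 0" by (simp add: inner_L2_self)
    then have "eq_L2 \<Omega> f (\<lambda>x. 0)" using norm_L2_eq_0_iff[OF f] by blast
    then have "\<forall>k<n. \<forall>j<m. v (k * m + j) = 0"
      unfolding f_def u_def
      by (rule snapshots_independent[THEN spec[where x="\<lambda>k j. v (k * m + j)"], THEN mp])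
    moreover obtain k i where "b = k * m + i" "k < n" "i < m" using block_indexE[OF b] .
    ultimately show "v b = 0" by blast
  qed
  note X = minv_left_right[OF L LL mat_adjoint_carrier[OF L] inj]
  interpret sd: sampled_data m n D M S L "minv L"
    by unfold_locales (use params D_carrier D_hermitian mass stiffness L LL X in auto)
  have Pt_eq: "Pt = sd.reduced_P" and Bt_eq: "Bt = sd.reduced_B"
    unfolding sd.reduced_P_def sd.reduced_B_def Pt Bt by simp_all
  have D_index_Reals: "D k $$ (i, j) \<in> \<real>" if "k < 2 * n" "i < m" "j < m" for k i j
    using D_Reals[OF that(1)] elements_matI[OF D_carrier[OF that(1)] that(2,3) refl] by blast
  have X_Reals: "elements_mat (minv L) \<subseteq> \<real>"
    by (rule elements_mat_inverse_Reals[OF L cholesky(2) X(1,3,2)])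
  have S_Reals: "elements_mat S \<subseteq> \<real>"
  proof
    fix x assume "x \<in> elements_mat S"
    then obtain a b where ab: "a < m * n" "b < m * n" "x = S $$ (a, b)"
      using sd.S_carrier by (auto dest!: elements_matD)
    obtain k i where a: "a = k * m + i" "k < n" "i < m" using block_indexE[OF ab(1)] .
    obtain l j where b: "b = l * m + j" "l < n" "j < m" using block_indexE[OF ab(2)] .
    show "x \<in> \<real>"
      unfolding ab(3) a(1) b(1) sd.S_index[OF a(2) b(2) a(3) b(3)]
      by (intro Reals_divide Reals_add D_index_Reals a b) (use a b in auto)
  qed
  let ?B = "block_matrix m n 1 (\<lambda>k _. D k)"
  have B_carrier: "?B \<in> carrier_mat (m * n) m"
    using block_matrix_carrier[of m n 1] by simp
  have B_Reals: "elements_mat ?B \<subseteq> \<real>"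
  proof
    fix x assume "x \<in> elements_mat ?B"
    then obtain a j where aj: "a < m * n" "j < m" "x = ?B $$ (a, j)"
      using B_carrier by (auto dest!: elements_matD)
    obtain k i where a: "a = k * m + i" "k < n" "i < m" using block_indexE[OF aj(1)] .
    have "x = D k $$ (i, j)"
      using block_matrix_index[of k n 0 1 i m j "\<lambda>k _. D k"] a aj by simp
    then show "x \<in> \<real>" using D_index_Reals a aj by simp
  qed
  have Pt_Reals: "elements_mat Pt \<subseteq> \<real>"
    unfolding Pt
    by (rule elements_mat_mult_Reals[OF mult_carrier_mat[OF X(1) sd.S_carrier]
          elements_mat_mult_Reals[OF X(1) X_Reals sd.S_carrier S_Reals]
          mat_adjoint_carrier[OF X(1)] elements_mat_adjoint_Reals[OF X_Reals]])
  have Bt_Reals: "elements_mat Bt \<subseteq> \<real>"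
    unfolding Bt by (rule elements_mat_mult_Reals[OF X(1) X_Reals B_carrier B_Reals])
  have carriers: "Pt \<in> carrier_mat (m * n) (m * n)" "Bt \<in> carrier_mat (m * n) m"
    unfolding Pt_eq Bt_eq by (rule sd.reduced_P_carrier sd.reduced_B_carrier)+
  have "D k = mat_adjoint Bt * poly_mat (chebyshev k) Pt * Bt" if "k < 2 * n" for k
    unfolding Pt_eq Bt_eq by (rule sd.interpolation[OF that])
  then show ?thesis
    by (intro conjI allI impI D_carrier D_Reals Pt_Reals Bt_Reals carriers)
qed

end
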